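(* Let $(X,d_X,\mathfrak m_X)$ and $(Y,d_Y,\mathfrak m_Y)$ be metric measure spaces, $\varphi\colon X\to Y$ continuous, $p\in(1,\infty)$ and $K\ge0$. Then the following are equivalent. (1) $K_O(\varphi)\le K$. (2) For every open set $\Omega\subset Y$ with $\Omega'=\varphi^{-1}(\Omega)$, every metric space $Z$, and every $h\in D^{1,p}(\Omega,Z)$, we have $h\circ\varphi|_{\Omega'}\in D^{1,p}(\Omega',Z)$ with $$\int_{\Omega'}(g\circ\varphi)\,\rho_{h\circ\varphi|_{\Omega'}}^p\,d\mathfrak m_X\le K\int_\Omega g\,\rho_h^p\,d\mathfrak m_Y$$ for every nonnegative $g$ with $g\rho_h^p\in\mathcal L^1(\mathfrak m_Y|_{\mathscr B(\Omega)})$. (2') The same property as in (2) holds for every closed set $\Omega\subset Y$ with $\mathfrak m_Y(\Omega)<\infty$ (in place of every open set $\Omega\subset Y$). (3) $\varphi\in D^{1,p}_{loc}(X,Y)$ and $$\int_X(\mathbf 1_E\circ\varphi)\,\rho_\varphi^p\,d\mathfrak m_X\le K\,\mathfrak m_Y(E)\quad\text{for every Borel }E\subset Y.$$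
   Context: A metric measure space $(X,d,\mathfrak m)$ is a complete separable metric space $(X,d)$ with a Borel measure $\mathfrak m\ge0$ that is finite on bounded sets. A curve in $X$ is a continuous map $\gamma\colon I_\gamma\to X$ with $I_\gamma\subset\mathbb R$ a compact interval; $C(X)$ is the set of all curves. A curve is rectifiable if its length $\ell(\gamma)$ is finite; for rectifiable $\gamma$ with unit speed parametrization $\tilde\gamma\colon[0,\ell(\gamma)]\to X$ and Borel $\rho\colon X\to[0,\infty]$, $\int_\gamma\rho\,ds:=\int_0^{\ell(\gamma)}\rho(\tilde\gamma(t))\,dt$. For $\Gamma\subset C(X)$, a Borel $\rho\colon X\to[0,\infty]$ is admissible if $\int_\gamma\rho\,ds\ge1$ for every rectifiable $\gamma\in\Gamma$, and $\mathrm{Mod}_p(\Gamma):=\inf\{\int\rho^p\,d\mathfrak m:\rho\text{ admissible for }\Gamma\}$ (with $\inf\emptyset=\infty$). A property holds for $\mathrm{Mod}_p$-a.e. curve if it holds outside a curve family of zero $p$-modulus. Dilatation: a continuous map $\varphi\colon X\to Y$ has bounded outer dilatation if there is $K\ge0$ with $\mathrm{Mod}_p(\Gamma)\le K\,\mathrm{Mod}_p(\varphi\Gamma)$ for all $\Gamma\subset C(X)$, where $\varphi\Gamma=\{\varphi\circ\gamma:\gamma\in\Gamma\}$; the smallest such $K$ is $K_O(\varphi)$. So $K_O(\varphi)\le K$ means that the inequality holds with constant $K$. The inequality is regarded as satisfied whenever its right-hand modulus is $\infty$ (also if $K=0$). Upper gradients: a map $h\colon X\to Z$ into a metric space $(Z,d_Z)$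 is measurable if there is $N\subset X$ with $\mathfrak m(N)=0$, $h(X\setminus N)$ separable, and $h^{-1}(U)$ is $\mathfrak m$-measurable for every open $U\subset Z$. A Borel $g\colon X\to[0,\infty]$ is a weak upper gradient of $h$ if $d_Z(h(\gamma(b)),h(\gamma(a)))\le\int_\gamma g\,ds$ for $\mathrm{Mod}_p$-a.e. $\gamma\in C(X)$, $I_\gamma=[a,b]$. $\mathrm{UG}^p(h)$ (resp. $\mathrm{UG}^p_{loc}(h)$) is the set of weak upper gradients that are $p$-integrable (resp. locally $p$-integrable: every point has a neighbourhood on which $g$ is $p$-integrable). $D^{1,p}(X,Z)$ (resp. $D^{1,p}_{loc}(X,Z)$) is the set of measurable $h$ with $\mathrm{UG}^p(h)\ne\emptyset$ (resp. $\mathrm{UG}^p_{loc}(h)\ne\emptyset$). If $\mathrm{UG}^p_{loc}(h)\neq\emptyset$, $\rho_h$ denotes a minimal weak upper gradient: an element of $\mathrm{UG}^p_{loc}(h)$ that is $\mathfrak m$-a.e. less than or equal to every other element. For open or closed subsets $\Omega\subset Y$ (and their preimages $\Omega'\subset X$) the same notions are used with the restricted metric and the restricted measure, considering only curves in the subset. $\mathscr B(\Omega)$ is the Borel $\sigma$-algebra of $\Omega$, and $\mathcal L^1$ denotes the integrable functions.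
   Formalization: In the definition of a measurable map h, preimages of open sets are required to be Borel rather than measurable for the completion of the measure; with the completion, (1) does not imply (2), since h∘φ can fail to be measurable when φ maps into a null set. *)

theory Defs
  imports "HOL-Analysis.Analysis"
begin

text \<open>
  Complete separable metric spaces are types of class \<open>polish_space\<close>. All notions below take a
  measure \<open>M\<close> on such a type and live on the set \<open>space M\<close>: the whole space is a Borel measure
  with \<open>space M = UNIV\<close>, and a Borel subset \<open>S\<close> with the restricted metric and measure is
  \<open>restrict_space M S\<close>, whose measurable sets are the Borel subsets of \<open>S\<close>.
\<close>

definition metric_measure_space :: "'a::polish_space measure \<Rightarrow> bool" where
  "metric_measure_space M \<longleftrightarrow>
     sets M = sets borel \<and> (\<forall>B\<in>sets M. bounded B \<longrightarrow> emeasure M B < \<infinity>)"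

text \<open>Extension of \<open>x powr p\<close> to \<open>x = \<infinity>\<close>, intended for \<open>p > 0\<close>.\<close>

definition epowr :: "ennreal \<Rightarrow> real \<Rightarrow> ennreal" where
  "epowr x p = (if x = \<infinity> then \<infinity> else ennreal (enn2real x powr p))"

text \<open>
  A triple \<open>(a, b, \<gamma>)\<close> represents the curve \<open>\<gamma>\<close> restricted to \<open>{a..b}\<close>. The values of \<open>\<gamma>\<close> outside
  \<open>{a..b}\<close> are irrelevant to every notion below, so that several triples may represent the
  same curve.
\<close>

type_synonym 'a curve = "real \<times> real \<times> (real \<Rightarrow> 'a)"

definition curves :: "'a::metric_space set \<Rightarrow> 'a curve set" where
  "curves S = {(a, b, \<gamma>). a \<le> b \<and> continuous_on {a..b} \<gamma> \<and> \<gamma> ` {a..b} \<subseteq> S}"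

definition curve_map :: "('a \<Rightarrow> 'b) \<Rightarrow> 'a curve \<Rightarrow> 'b curve" where
  "curve_map \<phi> = (\<lambda>(a, b, \<gamma>). (a, b, \<phi> \<circ> \<gamma>))"

definition curve_length :: "'a::metric_space curve \<Rightarrow> ennreal" where
  "curve_length = (\<lambda>(a, b, \<gamma>).
     SUP (n, t) \<in> {(n::nat, t::nat \<Rightarrow> real). (\<forall>i\<le>n. t i \<in> {a..b}) \<and> (\<forall>i<n. t i \<le> t (Suc i))}.
       \<Sum>i<n. ennreal (dist (\<gamma> (t i)) (\<gamma> (t (Suc i)))))"

definition rectifiable :: "'a::metric_space curve \<Rightarrow> bool" where
  "rectifiable c \<longleftrightarrow> curve_length c < \<infinity>"

text \<open>
  For a rectifiable curve and \<open>0 \<le> s \<le> curve_length (a, b, \<gamma>)\<close>, the infimum is the first parameter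
  at which the curve has travelled length \<open>s\<close>.
\<close>

definition unit_speed :: "'a::metric_space curve \<Rightarrow> real \<Rightarrow> 'a" where
  "unit_speed = (\<lambda>(a, b, \<gamma>) s. \<gamma> (Inf {t \<in> {a..b}. curve_length (a, t, \<gamma>) = ennreal s}))"

text \<open>Only meaningful for rectifiable curves.\<close>

definition line_integral :: "('a::metric_space \<Rightarrow> ennreal) \<Rightarrow> 'a curve \<Rightarrow> ennreal" where
  "line_integral \<rho> c =
     (\<integral>\<^sup>+ s. \<rho> (unit_speed c s) * indicator {0..enn2real (curve_length c)} s \<partial>lborel)"

definition admissible :: "'a::metric_space measure \<Rightarrow> 'a curve set \<Rightarrow> ('a \<Rightarrow> ennreal) set" where
  "admissible M \<Gamma> =
     {\<rho> \<in> borel_measurable M. \<forall>c\<in>\<Gamma>. rectifiable c \<longrightarrow> 1 \<le> line_integral \<rho> c}"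

definition modulus :: "real \<Rightarrow> 'a::metric_space measure \<Rightarrow> 'a curve set \<Rightarrow> ennreal" where
  "modulus p M \<Gamma> = (INF \<rho>\<in>admissible M \<Gamma>. \<integral>\<^sup>+ x. epowr (\<rho> x) p \<partial>M)"

definition ae_curve :: "real \<Rightarrow> 'a::metric_space measure \<Rightarrow> ('a curve \<Rightarrow> bool) \<Rightarrow> bool" where
  "ae_curve p M P \<longleftrightarrow>
     (\<exists>\<Gamma>\<subseteq>curves (space M). modulus p M \<Gamma> = 0 \<and> (\<forall>c\<in>curves (space M) - \<Gamma>. P c))"

text \<open>
  \<open>K\<^sub>O(\<phi>) \<le> K\<close>. The case of an infinite right-hand modulus is separate because \<open>0 * \<infinity> = 0\<close> in
  \<^typ>\<open>ennreal\<close>.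
\<close>

definition outer_dilatation_le ::
  "real \<Rightarrow> 'a::metric_space measure \<Rightarrow> 'b::metric_space measure \<Rightarrow> ('a \<Rightarrow> 'b) \<Rightarrow> real \<Rightarrow> bool" where
  "outer_dilatation_le p M N \<phi> K \<longleftrightarrow>
     (\<forall>\<Gamma>\<subseteq>curves (space M). modulus p N (curve_map \<phi> ` \<Gamma>) = \<infinity> \<or>
        modulus p M \<Gamma> \<le> ennreal K * modulus p N (curve_map \<phi> ` \<Gamma>))"

text \<open>
  Metric targets are carrier sets \<open>Z\<close> with a distance \<open>d\<close>, as in locale \<^locale>\<open>Metric_space\<close>.
  Measurability of sets refers to the \<open>\<sigma>\<close>-algebra on which the Borel measure \<open>M\<close> is given, without
  completion; for completion-measurable \<open>h\<close> the composition \<open>h \<circ> \<phi>\<close> can be non-measurable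
  although \<open>\<phi>\<close> has bounded outer dilatation (\<open>\<phi>\<close> may map into a null set).
\<close>

definition measurable_map ::
  "'a measure \<Rightarrow> 'z set \<Rightarrow> ('z \<Rightarrow> 'z \<Rightarrow> real) \<Rightarrow> ('a \<Rightarrow> 'z) \<Rightarrow> bool" where
  "measurable_map M Z d h \<longleftrightarrow>
     h \<in> space M \<rightarrow> Z \<and>
     (\<exists>N\<in>null_sets M.
        separable_space (subtopology (Metric_space.mtopology Z d) (h ` (space M - N)))) \<and>
     (\<forall>U. openin (Metric_space.mtopology Z d) U \<longrightarrow> h -` U \<inter> space M \<in> sets M)"

text \<open>
  Non-rectifiable curves form a family of modulus zero, so leaving them out does not affect
  the almost-everywhere condition.
\<close>

definition weak_upper_gradient ::
  "real \<Rightarrow> 'a::metric_space measure \<Rightarrow> ('z \<Rightarrow> 'z \<Rightarrow> real) \<Rightarrow> ('a \<Rightarrow> 'z) \<Rightarrow> ('a \<Rightarrow> ennreal) \<Rightarrow> bool"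
where
  "weak_upper_gradient p M d h g \<longleftrightarrow>
     g \<in> borel_measurable M \<and>
     ae_curve p M (\<lambda>(a, b, \<gamma>). rectifiable (a, b, \<gamma>) \<longrightarrow>
       ennreal (d (h (\<gamma> b)) (h (\<gamma> a))) \<le> line_integral g (a, b, \<gamma>))"

definition UG ::
  "real \<Rightarrow> 'a::metric_space measure \<Rightarrow> ('z \<Rightarrow> 'z \<Rightarrow> real) \<Rightarrow> ('a \<Rightarrow> 'z) \<Rightarrow> ('a \<Rightarrow> ennreal) set" where
  "UG p M d h = {g. weak_upper_gradient p M d h g \<and> (\<integral>\<^sup>+ x. epowr (g x) p \<partial>M) < \<infinity>}"

definition UG_loc ::
  "real \<Rightarrow> 'a::metric_space measure \<Rightarrow> ('z \<Rightarrow> 'z \<Rightarrow> real) \<Rightarrow> ('a \<Rightarrow> 'z) \<Rightarrow> ('a \<Rightarrow> ennreal) set" where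
  "UG_loc p M d h = {g. weak_upper_gradient p M d h g \<and>
     (\<forall>x\<in>space M. \<exists>U. open U \<and> x \<in> U \<and> (\<integral>\<^sup>+ y\<in>U. epowr (g y) p \<partial>M) < \<infinity>)}"

definition Dir ::
  "real \<Rightarrow> 'a::metric_space measure \<Rightarrow> 'z set \<Rightarrow> ('z \<Rightarrow> 'z \<Rightarrow> real) \<Rightarrow> ('a \<Rightarrow> 'z) set" where
  "Dir p M Z d = {h. measurable_map M Z d h \<and> UG p M d h \<noteq> {}}"

definition Dir_loc ::
  "real \<Rightarrow> 'a::metric_space measure \<Rightarrow> 'z set \<Rightarrow> ('z \<Rightarrow> 'z \<Rightarrow> real) \<Rightarrow> ('a \<Rightarrow> 'z) set" where
  "Dir_loc p M Z d = {h. measurable_map M Z d h \<and> UG_loc p M d h \<noteq> {}}"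

definition is_min_wug ::
  "real \<Rightarrow> 'a::metric_space measure \<Rightarrow> ('z \<Rightarrow> 'z \<Rightarrow> real) \<Rightarrow> ('a \<Rightarrow> 'z) \<Rightarrow> ('a \<Rightarrow> ennreal) \<Rightarrow> bool"
where
  "is_min_wug p M d h \<rho> \<longleftrightarrow>
     \<rho> \<in> UG_loc p M d h \<and> (\<forall>g\<in>UG_loc p M d h. AE x in M. \<rho> x \<le> g x)"

text \<open>The function \<open>\<rho>\<^sub>h\<close>, which is unique up to \<open>M\<close>-null sets.\<close>

definition min_wug ::
  "real \<Rightarrow> 'a::metric_space measure \<Rightarrow> ('z \<Rightarrow> 'z \<Rightarrow> real) \<Rightarrow> ('a \<Rightarrow> 'z) \<Rightarrow> 'a \<Rightarrow> ennreal" where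
  "min_wug p M d h = (SOME \<rho>. is_min_wug p M d h \<rho>)"

text \<open>
  The weight \<open>g\<close> is not required to be measurable by itself, only \<open>g \<rho>\<^sub>h\<^sup>p\<close> is; integrability of
  this nonnegative function is Borel measurability together with finite integral.
\<close>

definition pullback_property ::
  "real \<Rightarrow> 'a::metric_space measure \<Rightarrow> 'b::metric_space measure \<Rightarrow> ('a \<Rightarrow> 'b) \<Rightarrow> real \<Rightarrow>
   'b set \<Rightarrow> 'z set \<Rightarrow> ('z \<Rightarrow> 'z \<Rightarrow> real) \<Rightarrow> bool" where
  "pullback_property p M N \<phi> K \<Omega> Z d \<longleftrightarrow>
     (let M' = restrict_space M (\<phi> -` \<Omega>); N' = restrict_space N \<Omega> in
      \<forall>h\<in>Dir p N' Z d.
        h \<circ> \<phi> \<in> Dir p M' Z d \<and>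
        (\<forall>g :: 'b \<Rightarrow> ennreal.
           (\<lambda>y. g y * epowr (min_wug p N' d h y) p) \<in> borel_measurable N' \<and>
           (\<integral>\<^sup>+ y. g y * epowr (min_wug p N' d h y) p \<partial>N') < \<infinity> \<longrightarrow>
           (\<integral>\<^sup>+ x. g (\<phi> x) * epowr (min_wug p M' d (h \<circ> \<phi>) x) p \<partial>M')
             \<le> ennreal K * (\<integral>\<^sup>+ y. g y * epowr (min_wug p N' d h y) p \<partial>N')))"

text \<open>
  The type of a target space cannot be quantified inside a formula. Targets are therefore arbitrary
  metric spaces carried by subsets of \<open>'b + 'c\<close>, for a free type variable \<open>'c\<close>: this
  covers every metric space on any type \<open>'c\<close>, and the summand \<open>'b\<close>, the type of \<open>Y\<close>, ensures that
  the range of targets always includes a copy of \<open>Y\<close> and of its subsets.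
\<close>

definition pullback_open ::
  "'c itself \<Rightarrow> real \<Rightarrow> 'a::metric_space measure \<Rightarrow> 'b::metric_space measure \<Rightarrow> ('a \<Rightarrow> 'b) \<Rightarrow> real \<Rightarrow>
   bool" where
  "pullback_open _ p M N \<phi> K \<longleftrightarrow>
     (\<forall>\<Omega> (Z :: ('b + 'c) set) d. open \<Omega> \<and> Metric_space Z d \<longrightarrow> pullback_property p M N \<phi> K \<Omega> Z d)"

definition pullback_closed ::
  "'c itself \<Rightarrow> real \<Rightarrow> 'a::metric_space measure \<Rightarrow> 'b::metric_space measure \<Rightarrow> ('a \<Rightarrow> 'b) \<Rightarrow> real \<Rightarrow>
   bool" where
  "pullback_closed _ p M N \<phi> K \<longleftrightarrow>
     (\<forall>\<Omega> (Z :: ('b + 'c) set) d. closed \<Omega> \<and> emeasure N \<Omega> < \<infinity> \<and> Metric_space Z d \<longrightarrow>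
        pullback_property p M N \<phi> K \<Omega> Z d)"

end

theory Submission
  imports Defs
begin

text \<open>
  Everything is reduced to the energy bound in the third condition. Integrating along a rectifiable
  curve means integrating against its arc length measure, so inequalities between distances and line
  integrals over all subcurves become inequalities between measures on an interval. This gives
  minima and gluings of weak upper gradients, hence minimal ones, and the chain rule
  \<open>\<integral>\<^bsub>\<phi> \<circ> \<gamma>\<^esub> \<rho> ds \<le> \<integral>\<^bsub>\<gamma>\<^esub> (\<rho> \<circ> \<phi>) g ds\<close> for a weak upper gradient \<open>g\<close> of \<open>\<phi>\<close>, from which the energy
  bound implies the other conditions.

  If the outer dilatation is at most \<open>K\<close> and \<open>\<Omega>\<close> is open, the curves whose image in \<open>\<Omega>\<close> joins points
  at distance at least \<open>\<delta>\<close> have modulus at most \<open>K \<delta>\<^sup>-\<^sup>p \<mu>\<^sub>Y(\<Omega>)\<close>. If \<open>\<rho>\<close> is almost optimal for them, then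
  \<open>\<delta> \<rho>\<close> is an upper gradient of \<open>\<phi>\<close> up to an error \<open>\<delta>\<close>, as one sees by cutting curves into pieces
  of size \<open>\<delta>\<close>; uniform convexity of \<open>L\<^sup>p\<close> lets \<open>\<delta>\<close> tend to \<open>0\<close>. Conversely, the pullback properties
  are applied to the identity of bounded balls in \<open>Y\<close>.

  That \<open>h \<circ> \<phi>\<close> is again essentially separably valued holds because every Borel map from a Polish
  space to a metric space is so.
\<close>

section \<open>Arc length\<close>

text \<open>The constant \<open>K\<close> must survive every limit. The approximate upper gradients
  obtained from moduli satisfy their inequality on every rectifiable curve, with an additive error.
  A supremum keeps such bounds curve by curve, and uniform convexity only has to ensure that it
  costs hardly any energy. The resulting estimate concerns the total energy over the preimage of an
  open set. It becomes a bound for each Borel \<open>E\<close> because minimal weak upper gradients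
  are local: over an open set that exceeds \<open>E\<close> by little measure they can be compared
  with a competitor built for that set alone.

  Exceptional curves are carried along as a \<open>p\<close>-integrable weight with infinite
  integral over them. Under \<phi> a weight \<tau> on \<open>Y\<close> becomes
  \<open>(\<tau> \<circ> \<phi>) g\<close>, so exceptional families are pulled back by the same
  chain rule and with the same energy bound as gradients.

  Separability of the values of \<open>h \<circ> \<phi>\<close> cannot be inherited from
  \<open>h\<close>: the null set discarded for \<open>h\<close> may contain the whole image of
  \<phi>. This forces the detour through the number of Borel sets.\<close>

lemma sum_lessThan_add:
  fixes f :: "nat \<Rightarrow> 'a::comm_monoid_add"
  shows "(\<Sum>i<m + n. f i) = (\<Sum>i<m. f i) + (\<Sum>i<n. f (m + i))"
  by (induction n) (simp_all add: add.assoc)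

text \<open>Points may repeat and the endpoints need not occur. Truncating all points at some
  \<open>x\<close> with \<open>min\<close> or \<open>max\<close> therefore gives a partition of the
  part before or after \<open>x\<close>.\<close>

definition partitions :: "real \<Rightarrow> real \<Rightarrow> (nat \<times> (nat \<Rightarrow> real)) set" where
  "partitions a b = {(n, t). (\<forall>i\<le>n. t i \<in> {a..b}) \<and> (\<forall>i<n. t i \<le> t (Suc i))}"

definition polygon_length :: "(real \<Rightarrow> 'a::metric_space) \<Rightarrow> nat \<times> (nat \<Rightarrow> real) \<Rightarrow> ennreal" where
  "polygon_length \<gamma> = (\<lambda>(n, t). \<Sum>i<n. ennreal (dist (\<gamma> (t i)) (\<gamma> (t (Suc i)))))"

lemma curve_length_eq_SUP: "curve_length (a, b, \<gamma>) = (SUP P\<in>partitions a b. polygon_length \<gamma> P)"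
  by (simp add: curve_length_def partitions_def polygon_length_def)

lemma polygon_length_le: "P \<in> partitions a b \<Longrightarrow> polygon_length \<gamma> P \<le> curve_length (a, b, \<gamma>)"
  unfolding curve_length_eq_SUP by (rule SUP_upper)

lemma partitions_nonempty: "a \<le> b \<Longrightarrow> partitions a b \<noteq> {}"
proof -
  assume "a \<le> b"
  then have "(0, \<lambda>_. a) \<in> partitions a b"
    by (simp add: partitions_def)
  then show ?thesis by blast
qed

lemma min_partition:
  "(n, t) \<in> partitions a b \<Longrightarrow> a \<le> x \<Longrightarrow> (n, \<lambda>i. min (t i) x) \<in> partitions a x"
  by (auto simp: partitions_def min_def)

lemma max_partition:
  "(n, t) \<in> partitions a b \<Longrightarrow> x \<le> b \<Longrightarrow> (n, \<lambda>i. max (t i) x) \<in> partitions x b"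
  by (auto simp: partitions_def max_def)

text \<open>Truncating a partition at \<open>x\<close> from both sides loses no length, by the
  triangle inequality on a segment that crosses \<open>x\<close>. Conversely, partitions of the two
  halves are concatenated.\<close>

lemma curve_length_add:
  assumes "a \<le> x" "x \<le> b"
  shows "curve_length (a, b, \<gamma>) = curve_length (a, x, \<gamma>) + curve_length (x, b, \<gamma>)"
proof (rule antisym)
  show "curve_length (a, b, \<gamma>) \<le> curve_length (a, x, \<gamma>) + curve_length (x, b, \<gamma>)"
    unfolding curve_length_eq_SUP[of a b]
  proof (rule SUP_least, clarify)
    fix n t assume P: "(n, t) \<in> partitions a b"
    have "polygon_length \<gamma> (n, t)
        \<le> polygon_length \<gamma> (n, \<lambda>i. min (t i) x) + polygon_length \<gamma> (n, \<lambda>i. max (t i) x)"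
      unfolding polygon_length_def split_conv sum.distrib[symmetric]
    proof (rule sum_mono)
      fix i assume "i \<in> {..<n}"
      then have "t i \<le> t (Suc i)"
        using P by (auto simp: partitions_def)
      then have "dist (\<gamma> (t i)) (\<gamma> (t (Suc i))) \<le> dist (\<gamma> (min (t i) x)) (\<gamma> (min (t (Suc i)) x))
          + dist (\<gamma> (max (t i) x)) (\<gamma> (max (t (Suc i)) x))"
        by (auto simp: min_def max_def dist_triangle)
      then show "ennreal (dist (\<gamma> (t i)) (\<gamma> (t (Suc i))))
          \<le> ennreal (dist (\<gamma> (min (t i) x)) (\<gamma> (min (t (Suc i)) x)))
          + ennreal (dist (\<gamma> (max (t i) x)) (\<gamma> (max (t (Suc i)) x)))"
        by (simp flip: ennreal_plus)
    qed
    also have "\<dots> \<le> curve_length (a, x, \<gamma>) + curve_length (x, b, \<gamma>)"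
      by (intro add_mono polygon_length_le min_partition[OF P] max_partition[OF P] assms)
    finally show "polygon_length \<gamma> (n, t) \<le> curve_length (a, x, \<gamma>) + curve_length (x, b, \<gamma>)" .
  qed
next
  have *: "polygon_length \<gamma> P + polygon_length \<gamma> Q \<le> curve_length (a, b, \<gamma>)"
    if PQ: "P \<in> partitions a x" "Q \<in> partitions x b" for P Q
  proof -
    obtain m u n v where P: "P = (m, u)" and Q: "Q = (n, v)"
      by (metis surj_pair)
    \<comment> \<open>The segment from \<open>u m\<close> to \<open>v 0\<close> is extra, hence
      \<open>Suc m + n\<close> segments; it can only lengthen the polygon.\<close>
    define t where "t i = (if i \<le> m then u i else v (i - Suc m))" for i
    have "(Suc m + n, t) \<in> partitions a b"
    proof -
      have "t i \<in> {a..b}" if i: "i \<le> Suc m + n" for i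
      proof (cases "i \<le> m")
        case True
        then have "u i \<in> {a..x}"
          using PQ P by (auto simp: partitions_def)
        then show ?thesis using True assms by (auto simp: t_def)
      next
        case False
        then have "i - Suc m \<le> n" using i by simp
        then have "v (i - Suc m) \<in> {x..b}"
          using PQ Q by (auto simp: partitions_def)
        then show ?thesis using False assms by (auto simp: t_def)
      qed
      moreover have "t i \<le> t (Suc i)" if i: "i < Suc m + n" for i
      proof -
        consider "i < m" | "i = m" | "i > m" by linarith
        then show ?thesis
        proof cases
          case 1
          then show ?thesis using PQ P by (auto simp: t_def partitions_def)
        next
          case 2
          have "u m \<in> {a..x}" "v 0 \<in> {x..b}"
            using PQ P Q by (auto simp: partitions_def)
          then show ?thesis using 2 by (simp add: t_def)
        next
          case 3
          then have "Suc i - Suc m = Suc (i - Suc m)" "i - Suc m < n"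
            using i by auto
          moreover have "v (i - Suc m) \<le> v (Suc (i - Suc m))"
            using PQ Q \<open>i - Suc m < n\<close> by (auto simp: partitions_def)
          ultimately show ?thesis using 3 by (simp add: t_def)
        qed
      qed
      ultimately show ?thesis by (simp add: partitions_def)
    qed
    then have "polygon_length \<gamma> (Suc m + n, t) \<le> curve_length (a, b, \<gamma>)"
      by (rule polygon_length_le)
    moreover have "polygon_length \<gamma> P + polygon_length \<gamma> Q \<le> polygon_length \<gamma> (Suc m + n, t)"
    proof -
      have "polygon_length \<gamma> (Suc m + n, t)
          = (\<Sum>i<m. ennreal (dist (\<gamma> (t i)) (\<gamma> (t (Suc i))))) + ennreal (dist (\<gamma> (t m)) (\<gamma> (t (Suc m))))
            + (\<Sum>i<n. ennreal (dist (\<gamma> (t (Suc m + i))) (\<gamma> (t (Suc (Suc m + i))))))"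
        unfolding polygon_length_def split_conv sum_lessThan_add by simp
      also have "(\<Sum>i<m. ennreal (dist (\<gamma> (t i)) (\<gamma> (t (Suc i))))) = polygon_length \<gamma> P"
        unfolding P polygon_length_def split_conv by (rule sum.cong) (auto simp: t_def)
      also have "(\<Sum>i<n. ennreal (dist (\<gamma> (t (Suc m + i))) (\<gamma> (t (Suc (Suc m + i))))))
          = polygon_length \<gamma> Q"
        unfolding Q polygon_length_def split_conv by (rule sum.cong) (auto simp: t_def)
      finally show ?thesis by (simp add: add_mono)
    qed
    ultimately show ?thesis by order
  qed
  show "curve_length (a, x, \<gamma>) + curve_length (x, b, \<gamma>) \<le> curve_length (a, b, \<gamma>)"
    unfolding curve_length_eq_SUP[of a x] curve_length_eq_SUP[of x b]
    by (subst ennreal_SUP_add_left[OF partitions_nonempty[OF assms(1)], symmetric], rule SUP_least,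
        subst ennreal_SUP_add_right[OF partitions_nonempty[OF assms(2)]], rule SUP_least)
      (rule *)
qed

lemma curve_length_refl: "curve_length (a, a, \<gamma>) = 0"
proof -
  have "polygon_length \<gamma> P = 0" if "P \<in> partitions a a" for P
    using that by (auto simp: partitions_def polygon_length_def)
  then have "curve_length (a, a, \<gamma>) \<le> 0"
    unfolding curve_length_eq_SUP by (intro SUP_least) simp
  then show ?thesis by simp
qed

lemma dist_le_curve_length:
  assumes "a \<le> b"
  shows "ennreal (dist (\<gamma> a) (\<gamma> b)) \<le> curve_length (a, b, \<gamma>)"
proof -
  have "(1, \<lambda>i. if i = 0 then a else b) \<in> partitions a b"
    using assms by (auto simp: partitions_def)
  from polygon_length_le[OF this, of \<gamma>] show ?thesis
    by (simp add: polygon_length_def)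
qed

text \<open>Summing over a partition telescopes. With a line integral as \<open>F\<close>, upper
  gradient inequalities on all subcurves of a curve bound the length of its image.\<close>

lemma curve_length_le_superadditive:
  assumes "a \<le> b"
    and dist_le: "\<And>s t. a \<le> s \<Longrightarrow> s \<le> t \<Longrightarrow> t \<le> b \<Longrightarrow> ennreal (dist (\<gamma> s) (\<gamma> t)) \<le> F s t"
    and add: "\<And>r s t. a \<le> r \<Longrightarrow> r \<le> s \<Longrightarrow> s \<le> t \<Longrightarrow> t \<le> b \<Longrightarrow> F r s + F s t \<le> F r t"
  shows "curve_length (a, b, \<gamma>) \<le> F a b"
  unfolding curve_length_eq_SUP
proof (rule SUP_least, clarify)
  fix n t assume P: "(n, t) \<in> partitions a b"
  have "k \<le> n \<Longrightarrow> polygon_length \<gamma> (k, t) \<le> F a (t k)" for k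
  proof (induction k)
    case 0
    show ?case by (simp add: polygon_length_def)
  next
    case (Suc k)
    have t: "t k \<le> t (Suc k)" "a \<le> t k" "t (Suc k) \<le> b"
      using P Suc.prems by (auto simp: partitions_def)
    have "polygon_length \<gamma> (Suc k, t)
        = polygon_length \<gamma> (k, t) + ennreal (dist (\<gamma> (t k)) (\<gamma> (t (Suc k))))"
      by (simp add: polygon_length_def del: sum_ennreal)
    also have "\<dots> \<le> F a (t k) + F (t k) (t (Suc k))"
      using Suc t by (intro add_mono dist_le) auto
    also have "\<dots> \<le> F a (t (Suc k))"
      using t by (intro add) auto
    finally show ?case .
  qed
  then have "polygon_length \<gamma> (n, t) \<le> F a (t n)" by simp
  \<comment> \<open>The partition may stop before \<open>b\<close>.\<close>
  also have "\<dots> \<le> F a (t n) + F (t n) b" by simp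
  also have "\<dots> \<le> F a b"
    using P by (intro add) (auto simp: partitions_def)
  finally show "polygon_length \<gamma> (n, t) \<le> F a b" .
qed

section \<open>Rectifiable curves and their length function\<close>

locale rectifiable_curve =
  fixes a b :: real and \<gamma> :: "real \<Rightarrow> 'a::metric_space"
  assumes le: "a \<le> b" and cont: "continuous_on {a..b} \<gamma>"
    and length_finite: "curve_length (a, b, \<gamma>) < \<infinity>"
begin

lemma length_subcurve_le:
  assumes "a \<le> s" "s \<le> t" "t \<le> b"
  shows "curve_length (s, t, \<gamma>) \<le> curve_length (a, b, \<gamma>)"
proof -
  have "curve_length (s, t, \<gamma>) \<le> curve_length (a, t, \<gamma>)"
    using curve_length_add[of a s t \<gamma>] assms by simp
  also have "\<dots> \<le> curve_length (a, b, \<gamma>)"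
    using curve_length_add[of a t b \<gamma>] assms by simp
  finally show ?thesis .
qed

lemma subcurve: "a \<le> s \<Longrightarrow> s \<le> t \<Longrightarrow> t \<le> b \<Longrightarrow> rectifiable_curve s t \<gamma>"
  using length_subcurve_le[of s t] cont length_finite
  by unfold_locales (auto intro: continuous_on_subset le_less_trans)

definition len :: "real \<Rightarrow> real" where
  "len t = enn2real (curve_length (a, t, \<gamma>))"

lemma curve_length_finite:
  assumes "a \<le> s" "s \<le> t" "t \<le> b"
  shows "curve_length (s, t, \<gamma>) < top"
  using length_subcurve_le[OF assms] length_finite by (simp add: le_less_trans)

lemma ennreal_len: "t \<in> {a..b} \<Longrightarrow> ennreal (len t) = curve_length (a, t, \<gamma>)"
  using curve_length_finite[of a t] by (auto simp: len_def)

lemma len_nonneg: "0 \<le> len t"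
  by (simp add: len_def)

lemma len_left: "len a = 0"
  by (simp add: len_def curve_length_refl)

lemma curve_length_eq_len:
  assumes "a \<le> s" "s \<le> t" "t \<le> b"
  shows "curve_length (s, t, \<gamma>) = ennreal (len t - len s)"
proof -
  have "curve_length (s, t, \<gamma>) = ennreal (len t) - ennreal (len s)"
    using curve_length_add[of a s t \<gamma>] assms curve_length_finite[of a s] ennreal_len
    by (simp add: ennreal_add_diff_cancel_left)
  then show ?thesis by (simp add: ennreal_minus len_nonneg)
qed

lemma len_mono: "a \<le> s \<Longrightarrow> s \<le> t \<Longrightarrow> t \<le> b \<Longrightarrow> len s \<le> len t"
  using curve_length_add[of a s t \<gamma>] curve_length_finite[of a t]
  unfolding len_def by (intro enn2real_mono) auto

text \<open>
  Both \<open>x \<mapsto> curve_length (a, x, \<gamma>)\<close> and \<open>x \<mapsto> curve_length (x, b, \<gamma>)\<close> are suprema of continuous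
  functions, hence lower semicontinuous, and their sum is constant.
\<close>

lemma curve_length_lsc_left:
  assumes "x \<in> {a..b}" "c < curve_length (a, x, \<gamma>)"
  shows "\<forall>\<^sub>F y in at x within {a..b}. c < curve_length (a, y, \<gamma>)"
proof -
  obtain n t where P: "(n, t) \<in> partitions a x" "c < polygon_length \<gamma> (n, t)"
    using assms(2) unfolding curve_length_eq_SUP less_SUP_iff by auto
  let ?F = "\<lambda>y. polygon_length \<gamma> (n, \<lambda>i. min (t i) y)"
  have tb: "i \<le> n \<Longrightarrow> t i \<in> {a..b} \<and> t i \<le> x" for i
    using P(1) assms(1) by (auto simp: partitions_def)
  have cont_i: "continuous_on {a..b} (\<lambda>y. \<gamma> (min (t i) y))" if "i \<le> n" for i
    by (rule continuous_on_compose2[OF cont]) (use tb[OF that] in \<open>auto intro!: continuous_intros\<close>)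
  have "continuous_on {a..b} ?F"
    unfolding polygon_length_def split_conv
    by (intro continuous_intros continuous_on_sum continuous_on_ennreal cont_i) auto
  then have "(?F \<longlongrightarrow> ?F x) (at x within {a..b})"
    using assms(1) by (auto simp: continuous_on_def)
  moreover have "?F x = polygon_length \<gamma> (n, t)"
    unfolding polygon_length_def split_conv by (rule sum.cong) (auto simp: tb min_absorb1)
  ultimately have "\<forall>\<^sub>F y in at x within {a..b}. c < ?F y"
    using P(2) by (auto intro: order_tendstoD)
  moreover have "\<forall>\<^sub>F y in at x within {a..b}. y \<in> {a..b}"
    by (simp add: eventually_at_filter)
  ultimately show ?thesis
  proof eventually_elim
    case (elim y)
    then have "?F y \<le> curve_length (a, y, \<gamma>)"
      by (intro polygon_length_le min_partition[OF P(1)]) auto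
    with elim show ?case by order
  qed
qed

lemma curve_length_lsc_right:
  assumes "x \<in> {a..b}" "c < curve_length (x, b, \<gamma>)"
  shows "\<forall>\<^sub>F y in at x within {a..b}. c < curve_length (y, b, \<gamma>)"
proof -
  obtain n t where P: "(n, t) \<in> partitions x b" "c < polygon_length \<gamma> (n, t)"
    using assms(2) unfolding curve_length_eq_SUP less_SUP_iff by auto
  let ?F = "\<lambda>y. polygon_length \<gamma> (n, \<lambda>i. max (t i) y)"
  have tb: "i \<le> n \<Longrightarrow> t i \<in> {a..b} \<and> x \<le> t i" for i
    using P(1) assms(1) by (auto simp: partitions_def)
  have cont_i: "continuous_on {a..b} (\<lambda>y. \<gamma> (max (t i) y))" if "i \<le> n" for i
    by (rule continuous_on_compose2[OF cont]) (use tb[OF that] in \<open>auto intro!: continuous_intros\<close>)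
  have "continuous_on {a..b} ?F"
    unfolding polygon_length_def split_conv
    by (intro continuous_intros continuous_on_sum continuous_on_ennreal cont_i) auto
  then have "(?F \<longlongrightarrow> ?F x) (at x within {a..b})"
    using assms(1) by (auto simp: continuous_on_def)
  moreover have "?F x = polygon_length \<gamma> (n, t)"
    unfolding polygon_length_def split_conv by (rule sum.cong) (auto simp: tb max_absorb1)
  ultimately have "\<forall>\<^sub>F y in at x within {a..b}. c < ?F y"
    using P(2) by (auto intro: order_tendstoD)
  moreover have "\<forall>\<^sub>F y in at x within {a..b}. y \<in> {a..b}"
    by (simp add: eventually_at_filter)
  ultimately show ?thesis
  proof eventually_elim
    case (elim y)
    then have "?F y \<le> curve_length (y, b, \<gamma>)"
      by (intro polygon_length_le max_partition[OF P(1)]) auto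
    with elim show ?case by order
  qed
qed

lemma continuous_len: "continuous_on {a..b} len"
  unfolding continuous_on_def
proof (intro ballI order_tendstoI)
  fix x c assume x: "x \<in> {a..b}" and c: "c < len x"
  have *: "\<forall>\<^sub>F y in at x within {a..b}. y \<in> {a..b}"
    by (simp add: eventually_at_filter)
  show "\<forall>\<^sub>F y in at x within {a..b}. c < len y"
  proof (cases "0 \<le> c")
    case True
    then have "ennreal c < curve_length (a, x, \<gamma>)"
      using c ennreal_len[OF x] by (metis ennreal_lessI len_nonneg less_le_trans order_le_less_trans)
    from curve_length_lsc_left[OF x this] * show ?thesis
      by eventually_elim (metis True ennreal_len ennreal_less_iff)
  next
    case False
    then have "c < len y" for y using len_nonneg[of y] by linarith
    then show ?thesis by simp
  qed
next
  fix x c assume x: "x \<in> {a..b}" and c: "len x < c"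
  have *: "\<forall>\<^sub>F y in at x within {a..b}. y \<in> {a..b}"
    by (simp add: eventually_at_filter)
  show "\<forall>\<^sub>F y in at x within {a..b}. len y < c"
  proof (cases "c \<le> len b")
    case True
    \<comment> \<open>An upper bound for \<open>len y\<close> is a lower bound for the length of the
      remaining piece.\<close>
    then have "ennreal (len b - c) < curve_length (x, b, \<gamma>)"
      using c x by (simp add: curve_length_eq_len ennreal_less_iff)
    from curve_length_lsc_right[OF x this] * show ?thesis
    proof eventually_elim
      case (elim y)
      then have "len b - c < len b - len y"
        using True by (simp add: curve_length_eq_len ennreal_less_iff)
      then show ?case by simp
    qed
  next
    case False
    from * show ?thesis
    proof eventually_elim
      case (elim y)
      then have "len y \<le> len b" by (intro len_mono) auto
      then show ?case using False by simp
    qed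
  qed
qed

section \<open>Arc length parametrization and arc length measure\<close>

definition arc_param :: "real \<Rightarrow> real" where
  "arc_param s = Inf {t \<in> {a..b}. curve_length (a, t, \<gamma>) = ennreal s}"

lemma unit_speed_eq: "unit_speed (a, b, \<gamma>) s = \<gamma> (arc_param s)"
  by (simp add: unit_speed_def arc_param_def)

text \<open>Continuity of \<open>len\<close> makes the infimum attained. By the last claim
  \<open>arc_param\<close> and \<open>len\<close> form a Galois connection, so parameters in
  \<open>{s<..t}\<close> correspond exactly to lengths in \<open>{len s<..len t}\<close>. Half-open
  intervals are used throughout for this reason.\<close>

lemma arc_param:
  assumes "s \<in> {0..len b}"
  shows "arc_param s \<in> {a..b}" and "len (arc_param s) = s"
    and arc_param_le_iff: "t \<in> {a..b} \<Longrightarrow> arc_param s \<le> t \<longleftrightarrow> s \<le> len t"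
proof -
  let ?T = "{t \<in> {a..b}. len t = s}"
  have T: "{t \<in> {a..b}. curve_length (a, t, \<gamma>) = ennreal s} = ?T"
    using assms ennreal_len by (auto simp: len_nonneg) (metis atLeastAtMost_iff ennreal_inj len_nonneg)
  have ex: "\<exists>t'\<in>?T. t' \<le> t" if "t \<in> {a..b}" "s \<le> len t" for t
  proof -
    have "\<exists>x\<ge>a. x \<le> t \<and> len x = s"
      using that assms by (intro IVT' continuous_on_subset[OF continuous_len]) (auto simp: len_left)
    then show ?thesis using that by force
  qed
  have "closed ?T"
    using continuous_closed_preimage_constant[OF continuous_len] by simp
  moreover have "?T \<noteq> {}"
    using ex[of b] le assms by auto
  moreover have "bdd_below ?T"
    by (rule bdd_belowI[of _ a]) auto
  ultimately have mem: "arc_param s \<in> ?T"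
    unfolding arc_param_def T by (metis (no_types, lifting) closed_contains_Inf)
  then show *: "arc_param s \<in> {a..b}" "len (arc_param s) = s"
    by auto
  show "arc_param s \<le> t \<longleftrightarrow> s \<le> len t" if t: "t \<in> {a..b}"
  proof
    assume "arc_param s \<le> t"
    then show "s \<le> len t" using len_mono[of "arc_param s" t] * t by auto
  next
    assume "s \<le> len t"
    then obtain t' where t': "t' \<in> ?T" "t' \<le> t" using ex t by blast
    have "arc_param s \<le> t'"
      unfolding arc_param_def T using t'(1) \<open>bdd_below ?T\<close> by (rule cInf_lower)
    with t'(2) show "arc_param s \<le> t" by linarith
  qed
qed

text \<open>The Stieltjes measure of \<open>len\<close>, obtained by transporting Lebesgue measure.
  Clamping the argument to \<open>{0..len b}\<close> makes the transporting map monotone on the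
  whole line and hence Borel.\<close>

definition arc_measure :: "real measure" where
  "arc_measure = distr (density lborel (indicator {0..len b})) borel
     (\<lambda>s. arc_param (max 0 (min (len b) s)))"

lemma measurable_arc_param [measurable]:
  "(\<lambda>s. arc_param (max 0 (min (len b) s))) \<in> borel_measurable borel"
proof (rule borel_measurable_mono, rule monoI)
  fix s t :: real assume "s \<le> t"
  let ?c = "\<lambda>s. max 0 (min (len b) s)"
  have "?c s \<in> {0..len b}" "?c t \<in> {0..len b}" "?c s \<le> ?c t"
    using len_nonneg[of b] \<open>s \<le> t\<close> by auto
  then show "arc_param (?c s) \<le> arc_param (?c t)"
    using arc_param[of "?c t"] arc_param_le_iff[of "?c s" "arc_param (?c t)"] by auto
qed

lemma sets_arc_measure [measurable_cong, simp]: "sets arc_measure = sets borel"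
  by (simp add: arc_measure_def)

lemma space_arc_measure [simp]: "space arc_measure = UNIV"
  by (simp add: arc_measure_def)

lemma nn_integral_arc_measure:
  assumes [measurable]: "f \<in> borel_measurable borel"
  shows "(\<integral>\<^sup>+ t. f t \<partial>arc_measure) = (\<integral>\<^sup>+ s. f (arc_param s) * indicator {0..len b} s \<partial>lborel)"
proof -
  have "(\<integral>\<^sup>+ t. f t \<partial>arc_measure)
      = (\<integral>\<^sup>+ s. indicator {0..len b} s * f (arc_param (max 0 (min (len b) s))) \<partial>lborel)"
    unfolding arc_measure_def by (simp add: nn_integral_distr nn_integral_density)
  also have "\<dots> = (\<integral>\<^sup>+ s. f (arc_param s) * indicator {0..len b} s \<partial>lborel)"
    by (rule nn_integral_cong) (auto split: split_indicator simp: min_def max_def)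
  finally show ?thesis .
qed

text \<open>Outside \<open>{a..b}\<close> the map \<gamma> is arbitrary, so measurability is
  available for the composition cut off by the indicator. The factors
  \<open>indicator {a..b}\<close> below go back to this.\<close>

lemma borel_measurable_curve_compose [measurable]:
  assumes "\<rho> \<in> borel_measurable borel"
  shows "(\<lambda>t. \<rho> (\<gamma> t) * indicator {a..b} t :: ennreal) \<in> borel_measurable borel"
proof -
  have "\<gamma> \<in> borel_measurable (restrict_space borel {a..b})"
    using cont by (rule borel_measurable_continuous_on_restrict)
  then have "(\<lambda>t. \<rho> (\<gamma> t)) \<in> borel_measurable (restrict_space borel {a..b})"
    using assms by measurable
  then show ?thesis
    by (subst (asm) borel_measurable_restrict_space_iff_ennreal) auto
qed

text \<open>The condition \<open>0 < r\<close> matters: if \<gamma> is constant just before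
  \<open>s\<close>, the whole curve reaches length \<open>len s\<close> earlier than
  \<open>s\<close>, whereas the subcurve starts at \<open>s\<close>.\<close>

lemma arc_param_subcurve:
  assumes st: "a \<le> s" "s \<le> t" "t \<le> b" and r: "0 < r" "r \<le> len t - len s"
  shows "rectifiable_curve.arc_param s t \<gamma> r = arc_param (len s + r)"
proof -
  interpret S: rectifiable_curve s t \<gamma>
    using st by (rule subcurve)
  have S_len: "S.len x = len x - len s" if "x \<in> {s..t}" for x
    using curve_length_eq_len[of s x] len_mono[of s x] st that by (simp add: S.len_def)
  have "S.len t = len t - len s" using st by (simp add: S_len)
  then have r': "r \<in> {0..S.len t}" using r by simp
  have "len t \<le> len b" using st by (intro len_mono) auto
  then have lr: "len s + r \<in> {0..len b}" using r len_nonneg[of s] by auto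
  have 1: "arc_param (len s + r) \<le> t" "\<not> arc_param (len s + r) \<le> s"
    using st r by (auto simp: arc_param_le_iff[OF lr])
  show ?thesis
  proof (rule antisym)
    show "S.arc_param r \<le> arc_param (len s + r)"
      using 1 S_len[of "arc_param (len s + r)"] arc_param(2)[OF lr]
      by (subst S.arc_param_le_iff[OF r']) auto
    show "arc_param (len s + r) \<le> S.arc_param r"
      using S.arc_param(1,2)[OF r'] st S_len[of "S.arc_param r"]
      by (subst arc_param_le_iff[OF lr]) auto
  qed
qed

text \<open>One measure represents the line integrals over all subcurves, which turns additivity and
  comparison of line integrals into statements about measures.\<close>

lemma line_integral_subcurve:
  assumes st: "a \<le> s" "s \<le> t" "t \<le> b" and \<rho> [measurable]: "\<rho> \<in> borel_measurable borel"
  shows "line_integral \<rho> (s, t, \<gamma>)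
    = (\<integral>\<^sup>+ x. \<rho> (\<gamma> x) * indicator {s<..t} x \<partial>arc_measure)"
proof -
  interpret S: rectifiable_curve s t \<gamma>
    using st by (rule subcurve)
  have S_len: "S.len t = len t - len s"
    using curve_length_eq_len[of s t] len_mono[of s t] st by (simp add: S.len_def)
  have lt: "len t \<le> len b" using st by (intro len_mono) auto
  let ?f = "\<lambda>x. \<rho> (\<gamma> x) * indicator {a..b} x * indicator {s<..t} x"
  have "line_integral \<rho> (s, t, \<gamma>)
      = (\<integral>\<^sup>+ r. \<rho> (\<gamma> (S.arc_param r)) * indicator {0..S.len t} r \<partial>lborel)"
    by (simp add: line_integral_def S.unit_speed_eq S.len_def)
  \<comment> \<open>The shift by \<open>len s\<close>, written with a factor \<open>1\<close> to fit
    the affine substitution below, aligns the two parametrizations. They can differ at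
    \<open>r = 0\<close>, which is a null set.\<close>
  also have "\<dots> = (\<integral>\<^sup>+ r. ?f (arc_param (len s + 1 * r)) * indicator {0..len b} (len s + 1 * r) \<partial>lborel)"
  proof (rule nn_integral_cong_AE, rule AE_mp[OF AE_lborel_singleton[of 0]], rule AE_I2, rule impI)
    fix r :: real assume "r \<noteq> 0"
    then consider "0 < r" "r \<le> len t - len s" | "\<not> (0 \<le> r \<and> r \<le> len t - len s)" by linarith
    then show "\<rho> (\<gamma> (S.arc_param r)) * indicator {0..S.len t} r
        = ?f (arc_param (len s + 1 * r)) * indicator {0..len b} (len s + 1 * r)"
    proof cases
      case 1
      then have lr: "len s + r \<in> {0..len b}" using lt len_nonneg[of s] by auto
      have "arc_param (len s + r) \<le> t" "\<not> arc_param (len s + r) \<le> s"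
        using st 1 by (auto simp: arc_param_le_iff[OF lr])
      then show ?thesis
        using 1 lr st by (simp add: arc_param_subcurve S_len)
    next
      case 2
      have "?f (arc_param (len s + r)) * indicator {0..len b} (len s + r) = 0"
      proof (cases "len s + r \<in> {0..len b}")
        case True
        then have "\<not> (s < arc_param (len s + r) \<and> arc_param (len s + r) \<le> t)"
          using 2 st arc_param_le_iff[OF True, of s] arc_param_le_iff[OF True, of t] by auto
        then show ?thesis by (auto split: split_indicator)
      qed simp
      then show ?thesis using 2 by (simp add: S_len)
    qed
  qed
  also have "\<dots> = (\<integral>\<^sup>+ r. ?f (arc_param r) * indicator {0..len b} r \<partial>lborel)"
  proof -
    have "(\<lambda>r. ?f (arc_param (max 0 (min (len b) r))) * indicator {0..len b} r) \<in> borel_measurable borel"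
      by measurable
    moreover have "(\<lambda>r. ?f (arc_param (max 0 (min (len b) r))) * indicator {0..len b} r)
        = (\<lambda>r. ?f (arc_param r) * indicator {0..len b} r)"
      by (rule ext) (auto split: split_indicator simp: min_def max_def)
    ultimately have [measurable]: "(\<lambda>r. ?f (arc_param r) * indicator {0..len b} r) \<in> borel_measurable borel"
      by simp
    show ?thesis
      using nn_integral_real_affine[of "\<lambda>r. ?f (arc_param r) * indicator {0..len b} r" 1 "len s"]
      by simp
  qed
  also have "\<dots> = (\<integral>\<^sup>+ x. ?f x \<partial>arc_measure)"
    by (subst nn_integral_arc_measure) auto
  also have "\<dots> = (\<integral>\<^sup>+ x. \<rho> (\<gamma> x) * indicator {s<..t} x \<partial>arc_measure)"
    using st by (intro nn_integral_cong) (auto split: split_indicator)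
  finally show ?thesis .
qed

lemma emeasure_arc_measure:
  assumes st: "a \<le> s" "s \<le> t" "t \<le> b"
  shows "emeasure arc_measure {s<..t} = curve_length (s, t, \<gamma>)"
proof -
  interpret S: rectifiable_curve s t \<gamma>
    using st by (rule subcurve)
  have "emeasure arc_measure {s<..t} = line_integral (\<lambda>_. 1) (s, t, \<gamma>)"
    by (subst line_integral_subcurve[OF st]) simp_all
  also have "\<dots> = curve_length (s, t, \<gamma>)"
    using curve_length_eq_len[OF st] len_mono[OF st] by (simp add: line_integral_def)
  finally show ?thesis .
qed

end

section \<open>Comparison of measures along a curve\<close>

lemma compact_subset_emeasure_diff_le:
  fixes M :: "'a::{second_countable_topology, complete_space} measure"
  assumes "finite_measure M" "sets M = sets borel" "A \<in> sets borel" "0 < e"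
  obtains K where "compact K" "K \<subseteq> A" "emeasure M (A - K) \<le> ennreal e"
proof -
  interpret finite_measure M by fact
  have "\<exists>K\<in>{K. K \<subseteq> A \<and> compact K}. emeasure M A < emeasure M K + ennreal e"
  proof (cases "emeasure M A = 0")
    \<comment> \<open>Subtracting \<open>e\<close> from measure zero does not give a strictly
      smaller value; the empty set serves instead.\<close>
    case True
    then show ?thesis using \<open>0 < e\<close> by (intro bexI[of _ "{}"]) auto
  next
    case False
    then have "emeasure M A - ennreal e < emeasure M A"
      using \<open>0 < e\<close> by (intro ennreal_between) (auto simp: zero_less_iff_neq_zero less_top[symmetric] emeasure_finite)
    then have "\<exists>K\<in>{K. K \<subseteq> A \<and> compact K}. emeasure M A - ennreal e < emeasure M K"
      using inner_regular[OF assms(2) _ assms(3)] emeasure_finite by (simp add: less_SUP_iff)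
    then obtain K where K: "K \<subseteq> A" "compact K" "ennreal (measure M A - e) < ennreal (measure M K)"
      using \<open>0 < e\<close> by (auto simp: emeasure_eq_measure ennreal_minus)
    then have "measure M A < measure M K + e"
      by (metis ennreal_leI less_diff_eq add.commute diff_less_eq not_less)
    with K show ?thesis
      using \<open>0 < e\<close> by (auto simp: emeasure_eq_measure ennreal_less_iff simp flip: ennreal_plus)
  qed
  then obtain K where K: "K \<subseteq> A" "compact K" "emeasure M A < emeasure M K + ennreal e" by auto
  have Kb: "K \<in> sets M" using K(2) assms(2) by (simp add: borel_compact)
  have "emeasure M (A - K) \<le> ennreal e"
    using K(3) emeasure_Diff[of M K A] assms(2,3) Kb K(1) emeasure_finite[of K]
    by (auto simp: ennreal_minus_le_iff)
  with K show thesis using that by blast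
qed

text \<open>Up to small measure, \<open>A\<close> and its complement are replaced by disjoint
  compact sets \<open>K\<^sub>1\<close> and \<open>K\<^sub>2\<close>, where \<open>K\<^sub>1\<close>
  has distance at least \<eta> from \<open>K\<^sub>2\<close> and from the complement of
  \<open>T\<close>. An interval shorter than \<eta> that meets \<open>K\<^sub>1\<close> avoids
  \<open>K\<^sub>2\<close> and lies in \<open>T\<close>, so \<open>\<nu>\<^sub>1\<close> bounds
  \<open>D\<close> on it; on all others \<open>\<nu>\<^sub>2\<close> does. Subadditivity sums the
  estimates over a fine subdivision.\<close>

lemma subadditive_le_split_measure:
  fixes D :: "real \<Rightarrow> real \<Rightarrow> ennreal" and \<nu>\<^sub>1 \<nu>\<^sub>2 :: "real measure"
  assumes "a \<le> b"
    and fin: "finite_measure \<nu>\<^sub>1" "finite_measure \<nu>\<^sub>2"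
    and sets [simp, measurable_cong]: "sets \<nu>\<^sub>1 = sets borel" "sets \<nu>\<^sub>2 = sets borel"
    and tri: "\<And>r s t. a \<le> r \<Longrightarrow> r \<le> s \<Longrightarrow> s \<le> t \<Longrightarrow> t \<le> b \<Longrightarrow> D r t \<le> D r s + D s t"
    and D2: "\<And>s t. a \<le> s \<Longrightarrow> s \<le> t \<Longrightarrow> t \<le> b \<Longrightarrow> D s t \<le> emeasure \<nu>\<^sub>2 {s<..t}"
    and D1: "\<And>s t. a \<le> s \<Longrightarrow> s \<le> t \<Longrightarrow> t \<le> b \<Longrightarrow> {s..t} \<subseteq> T \<Longrightarrow> D s t \<le> emeasure \<nu>\<^sub>1 {s<..t}"
    and T: "open T" and A [measurable]: "A \<in> sets borel" and AT: "A \<subseteq> T"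
  shows "D a b \<le> emeasure \<nu>\<^sub>1 ({a<..b} \<inter> A) + emeasure \<nu>\<^sub>2 ({a<..b} - A)"
proof (rule ennreal_le_epsilon)
  fix e :: real assume "0 < e"
  then have "0 < e / 2" by simp
  have Ac: "- A \<in> sets borel" by measurable
  obtain K\<^sub>1 where K1: "compact K\<^sub>1" "K\<^sub>1 \<subseteq> A" "emeasure \<nu>\<^sub>2 (A - K\<^sub>1) \<le> ennreal (e / 2)"
    using compact_subset_emeasure_diff_le[OF fin(2) sets(2) A \<open>0 < e / 2\<close>] by blast
  obtain K\<^sub>2 where K2: "compact K\<^sub>2" "K\<^sub>2 \<subseteq> - A" "emeasure \<nu>\<^sub>1 (- A - K\<^sub>2) \<le> ennreal (e / 2)"
    using compact_subset_emeasure_diff_le[OF fin(1) sets(1) Ac \<open>0 < e / 2\<close>] by blast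
  have [measurable]: "K\<^sub>1 \<in> sets borel" "K\<^sub>2 \<in> sets borel"
    using K1 K2 by (auto simp: borel_compact)
  have "closed (K\<^sub>2 \<union> - T)" "K\<^sub>1 \<inter> (K\<^sub>2 \<union> - T) = {}"
    using K1 K2 T AT by (auto simp: compact_imp_closed)
  from separate_compact_closed[OF K1(1) this] obtain \<eta>
    where \<eta>: "0 < \<eta>" "\<And>x y. x \<in> K\<^sub>1 \<Longrightarrow> y \<in> K\<^sub>2 \<union> - T \<Longrightarrow> \<eta> \<le> dist x y"
    by blast
  \<comment> \<open>The claimed bound on \<open>{s<..t}\<close> together with the two errors: the
    mass of \<open>\<nu>\<^sub>1\<close> outside both \<open>A\<close> and \<open>K\<^sub>2\<close>,
    and the mass of \<open>\<nu>\<^sub>2\<close> in \<open>A - K\<^sub>1\<close>.\<close>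
  define \<tau> where "\<tau> s t = emeasure \<nu>\<^sub>1 ({s<..t} \<inter> A) + emeasure \<nu>\<^sub>2 ({s<..t} - A)
      + emeasure \<nu>\<^sub>1 ({s<..t} \<inter> (- A - K\<^sub>2)) + emeasure \<nu>\<^sub>2 ({s<..t} \<inter> (A - K\<^sub>1))" for s t
  have \<tau>_add: "\<tau> r s + \<tau> s t \<le> \<tau> r t" if "r \<le> s" "s \<le> t" for r s t
  proof -
    have split: "{r<..t} = {r<..s} \<union> {s<..t}" using that by auto
    have "emeasure \<nu>\<^sub>1 ({r<..t} \<inter> B) = emeasure \<nu>\<^sub>1 ({r<..s} \<inter> B) + emeasure \<nu>\<^sub>1 ({s<..t} \<inter> B)"
      "emeasure \<nu>\<^sub>2 ({r<..t} \<inter> B) = emeasure \<nu>\<^sub>2 ({r<..s} \<inter> B) + emeasure \<nu>\<^sub>2 ({s<..t} \<inter> B)"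
      if [measurable]: "B \<in> sets borel" for B
      unfolding split Int_Un_distrib2 by (subst plus_emeasure; auto)+
    from this[of A] this[of "- A"] this[of "- A - K\<^sub>2"] this[of "A - K\<^sub>1"] show ?thesis
      unfolding \<tau>_def Diff_eq by (simp add: ac_simps)
  qed
  have step: "D s t \<le> \<tau> s t" if st: "a \<le> s" "s \<le> t" "t \<le> b" "t - s < \<eta>" for s t
  proof (cases "{s<..t} \<inter> K\<^sub>1 = {}")
    case True
    have "D s t \<le> emeasure \<nu>\<^sub>2 {s<..t}" using st by (intro D2)
    also have "{s<..t} = ({s<..t} - A) \<union> ({s<..t} \<inter> (A - K\<^sub>1))" using True by auto
    also have "emeasure \<nu>\<^sub>2 \<dots> \<le> emeasure \<nu>\<^sub>2 ({s<..t} - A) + emeasure \<nu>\<^sub>2 ({s<..t} \<inter> (A - K\<^sub>1))"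
      by (rule emeasure_subadditive) auto
    also have "\<dots> \<le> \<tau> s t"
      unfolding \<tau>_def by (simp add: add_increasing ac_simps)
    finally show ?thesis .
  next
    case False
    then obtain x where x: "x \<in> K\<^sub>1" "s < x" "x \<le> t" by auto
    have far: "y \<notin> K\<^sub>2 \<union> - T" if "y \<in> {s..t}" for y
    proof
      assume "y \<in> K\<^sub>2 \<union> - T"
      from \<eta>(2)[OF x(1) this] show False using that x st by (auto simp: dist_real_def abs_real_def split: if_splits)
    qed
    then have "{s..t} \<subseteq> T" by auto
    then have "D s t \<le> emeasure \<nu>\<^sub>1 {s<..t}" using st by (intro D1)
    also have "{s<..t} = ({s<..t} \<inter> A) \<union> ({s<..t} \<inter> (- A - K\<^sub>2))" using far by auto
    also have "emeasure \<nu>\<^sub>1 \<dots> \<le> emeasure \<nu>\<^sub>1 ({s<..t} \<inter> A) + emeasure \<nu>\<^sub>1 ({s<..t} \<inter> (- A - K\<^sub>2))"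
      by (rule emeasure_subadditive) auto
    also have "\<dots> \<le> \<tau> s t"
      unfolding \<tau>_def by (simp add: add_increasing ac_simps)
    finally show ?thesis .
  qed
  \<comment> \<open>A mesh below \<eta>, so that \<open>step\<close> applies to each piece.\<close>
  obtain n :: nat where n: "(b - a) / \<eta> < real n"
    using reals_Archimedean2 by blast
  have "0 < n"
    using n \<eta>(1) \<open>a \<le> b\<close> by (metis diff_ge_0_iff_ge divide_nonneg_pos gr0I not_less of_nat_0)
  define h where "h = (b - a) / n"
  have h: "0 \<le> h" "h < \<eta>" "a + n * h = b"
    using n \<eta>(1) \<open>0 < n\<close> \<open>a \<le> b\<close> by (auto simp: h_def field_simps)
  have "k \<le> n \<Longrightarrow> D a (a + k * h) \<le> \<tau> a (a + k * h)" for k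
  proof (induction k)
    case 0
    show ?case using D2[of a a] \<open>a \<le> b\<close> by simp
  next
    case (Suc k)
    have le: "a \<le> a + k * h" "a + k * h \<le> a + Suc k * h" "a + Suc k * h - (a + k * h) < \<eta>"
      using h by (auto simp: field_simps)
    have "Suc k * h \<le> n * h"
      using h Suc.prems by (intro mult_right_mono) auto
    then have "a + Suc k * h \<le> b" using h by linarith
    note le = le this
    have "D a (a + Suc k * h) \<le> D a (a + k * h) + D (a + k * h) (a + Suc k * h)"
      by (rule tri) (use le in auto)
    also have "\<dots> \<le> \<tau> a (a + k * h) + \<tau> (a + k * h) (a + Suc k * h)"
      using Suc.prems by (intro add_mono Suc.IH step[OF le(1,2,4,3)]) simp
    also have "\<dots> \<le> \<tau> a (a + Suc k * h)"
      by (rule \<tau>_add[OF le(1,2)])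
    finally show ?case .
  qed
  from this[of n] have "D a b \<le> \<tau> a b" using h by simp
  also have "\<dots> \<le> emeasure \<nu>\<^sub>1 ({a<..b} \<inter> A) + emeasure \<nu>\<^sub>2 ({a<..b} - A) + ennreal (e / 2) + ennreal (e / 2)"
    unfolding \<tau>_def
    by (intro add_mono order_refl order_trans[OF emeasure_mono K2(3)] order_trans[OF emeasure_mono K1(3)])
      auto
  also have "\<dots> = emeasure \<nu>\<^sub>1 ({a<..b} \<inter> A) + emeasure \<nu>\<^sub>2 ({a<..b} - A) + ennreal e"
    using \<open>0 < e\<close> by (simp add: add.assoc flip: ennreal_plus)
  finally show "D a b \<le> emeasure \<nu>\<^sub>1 ({a<..b} \<inter> A) + emeasure \<nu>\<^sub>2 ({a<..b} - A) + ennreal e" .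
qed

text \<open>The preceding lemma with \<open>D\<close> the mass under \<nu>: it is bounded by \<mu>
  on \<open>A\<close> and by \<nu> itself off \<open>A\<close>, and the finite mass of
  \<open>{a<..b} - A\<close> under \<nu> cancels.\<close>

lemma emeasure_le_if_interval_le:
  fixes \<mu> \<nu> :: "real measure"
  assumes "a \<le> b" and fin: "finite_measure \<mu>" "finite_measure \<nu>"
    and sets [simp, measurable_cong]: "sets \<mu> = sets borel" "sets \<nu> = sets borel"
    and le: "\<And>s t. a \<le> s \<Longrightarrow> s \<le> t \<Longrightarrow> t \<le> b \<Longrightarrow> emeasure \<nu> {s<..t} \<le> emeasure \<mu> {s<..t}"
    and A [measurable]: "A \<in> sets borel" and sub: "A \<subseteq> {a<..b}"
  shows "emeasure \<nu> A \<le> emeasure \<mu> A"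
proof -
  interpret \<nu>: finite_measure \<nu> by fact
  have "emeasure \<nu> {a<..b} \<le> emeasure \<mu> ({a<..b} \<inter> A) + emeasure \<nu> ({a<..b} - A)"
  proof (rule subadditive_le_split_measure[where T = UNIV])
    fix r s t :: real assume "r \<le> s" "s \<le> t"
    then have "{r<..t} = {r<..s} \<union> {s<..t}" by auto
    then show "emeasure \<nu> {r<..t} \<le> emeasure \<nu> {r<..s} + emeasure \<nu> {s<..t}"
      by (metis emeasure_subadditive greaterThanAtMost_borel sets(2))
  qed (use assms in auto)
  moreover have "emeasure \<nu> {a<..b} = emeasure \<nu> A + emeasure \<nu> ({a<..b} - A)"
    using sub by (subst plus_emeasure) (auto simp: Un_absorb1)
  ultimately have "emeasure \<nu> A + emeasure \<nu> ({a<..b} - A) \<le> emeasure \<mu> A + emeasure \<nu> ({a<..b} - A)"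
    using sub by (simp add: Int_absorb1)
  then show ?thesis
    by (simp add: \<nu>.emeasure_finite ennreal_add_left_cancel_le add.commute)
qed

context rectifiable_curve
begin

lemma line_integral_eq:
  "\<rho> \<in> borel_measurable borel \<Longrightarrow>
    line_integral \<rho> (a, b, \<gamma>) = (\<integral>\<^sup>+ x. \<rho> (\<gamma> x) * indicator {a<..b} x \<partial>arc_measure)"
  using line_integral_subcurve[of a b] le by simp

text \<open>The measure whose value on \<open>{s<..t}\<close> is the integral of \<rho> over the
  subcurve from \<open>s\<close> to \<open>t\<close>. The two indicators serve measurability and the
  half-open convention.\<close>

definition weighted_arc_measure :: "('a \<Rightarrow> ennreal) \<Rightarrow> real measure" where
  "weighted_arc_measure \<rho> =
     density arc_measure (\<lambda>t. \<rho> (\<gamma> t) * indicator {a..b} t * indicator {a<..b} t)"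

lemma sets_weighted_arc_measure [simp, measurable_cong]:
  "sets (weighted_arc_measure \<rho>) = sets borel"
  by (simp add: weighted_arc_measure_def)

lemma emeasure_weighted_arc_measure:
  assumes [measurable]: "\<rho> \<in> borel_measurable borel" "A \<in> sets borel"
  shows "emeasure (weighted_arc_measure \<rho>) A
    = (\<integral>\<^sup>+ x. \<rho> (\<gamma> x) * indicator {a<..b} x * indicator A x \<partial>arc_measure)"
proof -
  have "emeasure (weighted_arc_measure \<rho>) A
    = (\<integral>\<^sup>+ x. \<rho> (\<gamma> x) * indicator {a..b} x * indicator {a<..b} x * indicator A x \<partial>arc_measure)"
    unfolding weighted_arc_measure_def by (subst emeasure_density) auto
  also have "\<dots> = (\<integral>\<^sup>+ x. \<rho> (\<gamma> x) * indicator {a<..b} x * indicator A x \<partial>arc_measure)"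
    by (rule nn_integral_cong) (auto split: split_indicator)
  finally show ?thesis .
qed

lemma emeasure_weighted_arc_measure_interval:
  assumes "\<rho> \<in> borel_measurable borel" and "a \<le> s" "s \<le> t" "t \<le> b"
  shows "emeasure (weighted_arc_measure \<rho>) {s<..t} = line_integral \<rho> (s, t, \<gamma>)"
  using assms
  by (auto simp: emeasure_weighted_arc_measure line_integral_subcurve split: split_indicator
      intro!: nn_integral_cong)

lemma finite_weighted_arc_measure:
  assumes "\<rho> \<in> borel_measurable borel" and "line_integral \<rho> (a, b, \<gamma>) < \<infinity>"
  shows "finite_measure (weighted_arc_measure \<rho>)"
proof (rule finite_measureI)
  have "space (weighted_arc_measure \<rho>) = UNIV"
    by (simp add: weighted_arc_measure_def)
  then show "emeasure (weighted_arc_measure \<rho>) (space (weighted_arc_measure \<rho>)) \<noteq> \<infinity>"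
    using assms by (simp add: emeasure_weighted_arc_measure line_integral_eq)
qed

lemma line_integral_add:
  assumes "\<rho> \<in> borel_measurable borel" and st: "a \<le> s" "s \<le> b"
  shows "line_integral \<rho> (a, b, \<gamma>) = line_integral \<rho> (a, s, \<gamma>) + line_integral \<rho> (s, b, \<gamma>)"
proof -
  have "{a<..b} = {a<..s} \<union> {s<..b}" using st by auto
  then have "emeasure (weighted_arc_measure \<rho>) {a<..b}
      = emeasure (weighted_arc_measure \<rho>) {a<..s} + emeasure (weighted_arc_measure \<rho>) {s<..b}"
    by (simp add: plus_emeasure)
  then show ?thesis
    using assms le by (simp add: emeasure_weighted_arc_measure_interval)
qed

lemma line_integral_subcurve_le:
  assumes "\<rho> \<in> borel_measurable borel" and st: "a \<le> s" "s \<le> t" "t \<le> b"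
  shows "line_integral \<rho> (s, t, \<gamma>) \<le> line_integral \<rho> (a, b, \<gamma>)"
proof -
  have "emeasure (weighted_arc_measure \<rho>) {s<..t} \<le> emeasure (weighted_arc_measure \<rho>) {a<..b}"
    using st by (intro emeasure_mono) auto
  then show ?thesis
    using assms le by (simp add: emeasure_weighted_arc_measure_interval)
qed

text \<open>The source of minima and gluings. Preimages under \<gamma> transport \<open>U\<close>
  and \<open>A\<close> to the parameter interval, where \<open>subadditive_le_split_measure\<close>
  applies to the two weighted arc measures. \<open>A\<close> is an arbitrary Borel subset of
  \<open>U\<close>, while the inequality for \<open>g\<^sub>1\<close> is known only on pieces inside
  \<open>U\<close>.\<close>

lemma subadditive_le_glued_line_integral:
  fixes D :: "real \<Rightarrow> real \<Rightarrow> ennreal"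
  assumes g [measurable]: "g\<^sub>1 \<in> borel_measurable borel" "g\<^sub>2 \<in> borel_measurable borel"
    and fin: "line_integral g\<^sub>1 (a, b, \<gamma>) < \<infinity>" "line_integral g\<^sub>2 (a, b, \<gamma>) < \<infinity>"
    and tri: "\<And>r s t. a \<le> r \<Longrightarrow> r \<le> s \<Longrightarrow> s \<le> t \<Longrightarrow> t \<le> b \<Longrightarrow> D r t \<le> D r s + D s t"
    and D2: "\<And>s t. a \<le> s \<Longrightarrow> s \<le> t \<Longrightarrow> t \<le> b \<Longrightarrow> D s t \<le> line_integral g\<^sub>2 (s, t, \<gamma>)"
    and D1: "\<And>s t. a \<le> s \<Longrightarrow> s \<le> t \<Longrightarrow> t \<le> b \<Longrightarrow> \<gamma> ` {s..t} \<subseteq> U \<Longrightarrow>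
      D s t \<le> line_integral g\<^sub>1 (s, t, \<gamma>)"
    and U: "open U" and A [measurable]: "A \<in> sets borel" and AU: "A \<subseteq> U"
  shows "D a b \<le> line_integral (\<lambda>x. if x \<in> A then g\<^sub>1 x else g\<^sub>2 x) (a, b, \<gamma>)"
proof -
  have "\<exists>T. open T \<and> T \<inter> {a..b} = \<gamma> -` U \<inter> {a..b}"
    using cont U by (metis continuous_on_open_invariant)
  then obtain T where T: "open T" "T \<inter> {a..b} = \<gamma> -` U \<inter> {a..b}" by auto
  \<comment> \<open>Written as a level set of a function known to be measurable, because \<gamma>
    itself is controlled only on \<open>{a..b}\<close>.\<close>
  define B where "B = {t. indicator A (\<gamma> t) * indicator {a..b} t = (1::ennreal)}"
  have "(\<lambda>x. indicator A x) \<in> borel_measurable borel" by measurable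
  from borel_measurable_curve_compose[OF this]
  have B [measurable]: "B \<in> sets borel" unfolding B_def by measurable
  have B_eq: "B = {t \<in> {a..b}. \<gamma> t \<in> A}" by (auto simp: B_def indicator_def)
  have "D a b \<le> emeasure (weighted_arc_measure g\<^sub>1) ({a<..b} \<inter> B)
      + emeasure (weighted_arc_measure g\<^sub>2) ({a<..b} - B)"
  proof (rule subadditive_le_split_measure[where T = T])
    show "B \<subseteq> T" using AU T(2) unfolding B_eq by blast
    fix s t assume st: "a \<le> s" "s \<le> t" "t \<le> b"
    show "D s t \<le> emeasure (weighted_arc_measure g\<^sub>2) {s<..t}"
      using D2 st by (simp add: emeasure_weighted_arc_measure_interval)
    assume "{s..t} \<subseteq> T"
    moreover have "{s..t} \<subseteq> {a..b}" using st by auto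
    ultimately have "\<gamma> ` {s..t} \<subseteq> U" using T by blast
    then show "D s t \<le> emeasure (weighted_arc_measure g\<^sub>1) {s<..t}"
      using D1 st by (simp add: emeasure_weighted_arc_measure_interval)
  qed (use assms T le in \<open>auto intro!: finite_weighted_arc_measure\<close>)
  also have "\<dots> = emeasure (weighted_arc_measure (\<lambda>x. if x \<in> A then g\<^sub>1 x else g\<^sub>2 x)) ({a<..b} \<inter> B)
      + emeasure (weighted_arc_measure (\<lambda>x. if x \<in> A then g\<^sub>1 x else g\<^sub>2 x)) ({a<..b} - B)"
  proof (rule arg_cong2[where f = "(+)"])
    show "emeasure (weighted_arc_measure g\<^sub>1) ({a<..b} \<inter> B)
        = emeasure (weighted_arc_measure (\<lambda>x. if x \<in> A then g\<^sub>1 x else g\<^sub>2 x)) ({a<..b} \<inter> B)"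
      by (subst (1 2) emeasure_weighted_arc_measure)
        (measurable, auto simp: B_eq split: split_indicator intro!: nn_integral_cong)
    show "emeasure (weighted_arc_measure g\<^sub>2) ({a<..b} - B)
        = emeasure (weighted_arc_measure (\<lambda>x. if x \<in> A then g\<^sub>1 x else g\<^sub>2 x)) ({a<..b} - B)"
      by (subst (1 2) emeasure_weighted_arc_measure)
        (measurable, auto simp: B_eq split: split_indicator intro!: nn_integral_cong)
  qed
  also have "\<dots> = emeasure (weighted_arc_measure (\<lambda>x. if x \<in> A then g\<^sub>1 x else g\<^sub>2 x)) {a<..b}"
    by (subst plus_emeasure) (auto intro!: arg_cong[where f = "emeasure _"])
  also have "\<dots> = line_integral (\<lambda>x. if x \<in> A then g\<^sub>1 x else g\<^sub>2 x) (a, b, \<gamma>)"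
    using le by (subst emeasure_weighted_arc_measure_interval) auto
  finally show ?thesis .
qed

text \<open>By \<open>len_le\<close>, the arc length measure \<nu> of
  \<open>\<phi> \<circ> \<gamma>\<close> is at most the measure \<mu> with density \<open>g\<close>
  on half-open intervals, hence on Borel sets, hence for integrals of nonnegative functions. This
  concerns a single curve on all of whose subcurves the upper gradient inequality holds.\<close>

lemma
  fixes \<phi> :: "'a \<Rightarrow> 'b::metric_space"
  assumes \<phi>: "continuous_on UNIV \<phi>" and g [measurable]: "g \<in> borel_measurable borel"
    and fin: "line_integral g (a, b, \<gamma>) < \<infinity>"
    and ug: "\<And>s t. a \<le> s \<Longrightarrow> s \<le> t \<Longrightarrow> t \<le> b \<Longrightarrow>
      ennreal (dist (\<phi> (\<gamma> s)) (\<phi> (\<gamma> t))) \<le> line_integral g (s, t, \<gamma>)"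
  shows rectifiable_image: "rectifiable_curve a b (\<phi> \<circ> \<gamma>)"
    and line_integral_image_le: "\<rho> \<in> borel_measurable borel \<Longrightarrow>
      line_integral \<rho> (a, b, \<phi> \<circ> \<gamma>) \<le> line_integral (\<lambda>x. \<rho> (\<phi> x) * g x) (a, b, \<gamma>)"
proof -
  have len_le: "curve_length (s, t, \<phi> \<circ> \<gamma>) \<le> line_integral g (s, t, \<gamma>)"
    if st: "a \<le> s" "s \<le> t" "t \<le> b" for s t
  proof (rule curve_length_le_superadditive[OF st(2)])
    fix r x y assume "s \<le> r" "r \<le> x" "x \<le> y" "y \<le> t"
    moreover from this st have "rectifiable_curve r y \<gamma>" by (intro subcurve) auto
    ultimately show "line_integral g (r, x, \<gamma>) + line_integral g (x, y, \<gamma>) \<le> line_integral g (r, y, \<gamma>)"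
      using rectifiable_curve.line_integral_add[of r y \<gamma> g x] by simp
  qed (use ug st in auto)
  have "continuous_on {a..b} (\<phi> \<circ> \<gamma>)"
    using continuous_on_compose[OF cont continuous_on_subset[OF \<phi>]] by simp
  moreover have "curve_length (a, b, \<phi> \<circ> \<gamma>) < \<infinity>"
    using len_le[of a b] le fin by (auto intro: le_less_trans)
  ultimately show rect: "rectifiable_curve a b (\<phi> \<circ> \<gamma>)"
    using le by unfold_locales
  interpret I: rectifiable_curve a b "\<phi> \<circ> \<gamma>" by (rule rect)
  assume \<rho> [measurable]: "\<rho> \<in> borel_measurable borel"
  have \<phi>_meas [measurable]: "\<phi> \<in> borel_measurable borel"
    using \<phi> by (simp add: borel_measurable_continuous_onI)
  \<comment> \<open>Weight \<open>1\<close> restricts the arc length measure to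
    \<open>{a<..b}\<close>.\<close>
  define \<nu> where "\<nu> = I.weighted_arc_measure (\<lambda>_. 1)"
  define \<mu> where "\<mu> = weighted_arc_measure g"
  have \<nu>_interval: "emeasure \<nu> {s<..t} = curve_length (s, t, \<phi> \<circ> \<gamma>)" if "a \<le> s" "s \<le> t" "t \<le> b" for s t
    using that I.emeasure_arc_measure[OF that] unfolding \<nu>_def
    by (simp add: I.emeasure_weighted_arc_measure_interval I.line_integral_subcurve)
  have [simp, measurable_cong]: "sets \<nu> = sets borel" "sets \<mu> = sets borel"
    by (auto simp: \<nu>_def \<mu>_def)
  have [simp]: "space \<nu> = UNIV" "space \<mu> = UNIV"
    by (auto simp: \<nu>_def \<mu>_def I.weighted_arc_measure_def weighted_arc_measure_def)
  have \<nu>_le_\<mu>: "emeasure \<nu> A \<le> emeasure \<mu> A" if "A \<in> sets borel" "A \<subseteq> {a<..b}" for A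
  proof (rule emeasure_le_if_interval_le[OF le _ _ _ _ _ that])
    show "finite_measure \<mu>" unfolding \<mu>_def by (intro finite_weighted_arc_measure g fin)
    show "finite_measure \<nu>" unfolding \<nu>_def
      using \<nu>_interval[of a b] I.length_finite le unfolding \<nu>_def
      by (intro I.finite_weighted_arc_measure) (auto simp: I.emeasure_weighted_arc_measure_interval)
    fix s t assume st: "a \<le> s" "s \<le> t" "t \<le> b"
    show "emeasure \<nu> {s<..t} \<le> emeasure \<mu> {s<..t}"
      using len_le[OF st] st by (simp add: \<nu>_interval \<mu>_def emeasure_weighted_arc_measure_interval)
  qed auto
  have "\<nu> \<le> \<mu>"
    unfolding le_measure_iff
  proof (simp add: le_fun_def, rule allI)
    fix A
    show "emeasure \<nu> A \<le> emeasure \<mu> A"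
    proof (cases "A \<in> sets borel")
      case True
      then have "emeasure \<nu> A = emeasure \<nu> (A \<inter> {a<..b})"
        unfolding \<nu>_def
        by (subst (1 2) I.emeasure_weighted_arc_measure)
          (auto split: split_indicator intro!: nn_integral_cong)
      also have "\<dots> \<le> emeasure \<mu> (A \<inter> {a<..b})" using True by (intro \<nu>_le_\<mu>) auto
      also have "\<dots> \<le> emeasure \<mu> A" using True by (intro emeasure_mono) auto
      finally show ?thesis .
    qed (simp add: emeasure_notin_sets)
  qed
  then have le_int: "(\<integral>\<^sup>+ x. f x \<partial>\<nu>) \<le> (\<integral>\<^sup>+ x. f x \<partial>\<mu>)" for f
    by (intro nn_integral_mono_measure) auto
  let ?f = "\<lambda>x. \<rho> ((\<phi> \<circ> \<gamma>) x) * indicator {a..b} x"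
  have f [measurable]: "?f \<in> borel_measurable borel"
    by (rule I.borel_measurable_curve_compose) measurable
  have "line_integral \<rho> (a, b, \<phi> \<circ> \<gamma>) = (\<integral>\<^sup>+ x. ?f x \<partial>\<nu>)"
    unfolding \<nu>_def I.weighted_arc_measure_def
    by (subst nn_integral_density)
      (auto simp: I.line_integral_eq split: split_indicator intro!: nn_integral_cong)
  also have "\<dots> \<le> (\<integral>\<^sup>+ x. ?f x \<partial>\<mu>)" by (rule le_int)
  also have "\<dots> = line_integral (\<lambda>x. \<rho> (\<phi> x) * g x) (a, b, \<gamma>)"
    unfolding \<mu>_def weighted_arc_measure_def
    by (subst nn_integral_density, measurable)
      (auto simp: line_integral_eq ac_simps split: split_indicator intro!: nn_integral_cong)
  finally show "line_integral \<rho> (a, b, \<phi> \<circ> \<gamma>) \<le> line_integral (\<lambda>x. \<rho> (\<phi> x) * g x) (a, b, \<gamma>)" .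
qed

end

section \<open>Modulus and almost all curves\<close>

lemma epowr_ennreal: "0 \<le> x \<Longrightarrow> epowr (ennreal x) p = ennreal (x powr p)"
  by (simp add: epowr_def)

lemma epowr_top [simp]: "epowr top p = top"
  by (simp add: epowr_def)

lemma epowr_0 [simp]: "epowr 0 p = 0"
  by (simp add: epowr_def)

lemma epowr_1 [simp]: "epowr 1 p = 1"
  by (simp add: epowr_def)

lemma epowr_mono: "0 < p \<Longrightarrow> x \<le> y \<Longrightarrow> epowr x p \<le> epowr y p"
  by (cases x; cases y) (auto simp: epowr_ennreal powr_mono2 top_unique)

lemma epowr_mult: "0 < p \<Longrightarrow> epowr (x * y) p = epowr x p * epowr y p"
  by (cases x; cases y; cases "x = 0"; cases "y = 0")
    (auto simp: epowr_ennreal powr_mult ennreal_mult_top ennreal_top_mult simp flip: ennreal_mult)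

lemma epowr_inverse: "0 < p \<Longrightarrow> epowr (epowr x p) (1 / p) = x"
  by (cases x) (auto simp: epowr_ennreal powr_powr)

lemma epowr_inverse': "0 < p \<Longrightarrow> epowr (epowr x (1 / p)) p = x"
  by (cases x) (auto simp: epowr_ennreal powr_powr)

lemma borel_measurable_epowr [measurable]:
  assumes [measurable]: "f \<in> borel_measurable M"
  shows "(\<lambda>x. epowr (f x) p) \<in> borel_measurable M"
  unfolding epowr_def by measurable

text \<open>\<open>epowr\<close> with exponent \<open>p\<close> is an order isomorphism whose
  inverse has exponent \<open>1 / p\<close>.\<close>

lemma epowr_SUP:
  assumes "0 < p"
  shows "epowr (SUP i\<in>I. f i) p = (SUP i\<in>I. epowr (f i) p)"
proof (rule antisym)
  have "(SUP i\<in>I. f i) \<le> epowr (SUP i\<in>I. epowr (f i) p) (1 / p)"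
  proof (rule SUP_least)
    fix i assume "i \<in> I"
    have "f i = epowr (epowr (f i) p) (1 / p)"
      using assms by (simp add: epowr_inverse)
    also have "\<dots> \<le> epowr (SUP i\<in>I. epowr (f i) p) (1 / p)"
      using assms \<open>i \<in> I\<close> by (intro epowr_mono SUP_upper) auto
    finally show "f i \<le> epowr (SUP i\<in>I. epowr (f i) p) (1 / p)" .
  qed
  then have "epowr (SUP i\<in>I. f i) p \<le> epowr (epowr (SUP i\<in>I. epowr (f i) p) (1 / p)) p"
    using assms by (intro epowr_mono)
  then show "epowr (SUP i\<in>I. f i) p \<le> (SUP i\<in>I. epowr (f i) p)"
    using assms by (simp add: epowr_inverse')
  show "(SUP i\<in>I. epowr (f i) p) \<le> epowr (SUP i\<in>I. f i) p"
    using assms by (intro SUP_least epowr_mono SUP_upper)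
qed

lemma SUP_le_suminf_ennreal: "(SUP n. f n) \<le> (\<Sum>n. f n :: ennreal)"
proof (rule SUP_least)
  fix n
  have "f n \<le> sum f {..<Suc n}" by (rule member_le_sum) auto
  also have "\<dots> \<le> (\<Sum>n. f n)" by (rule sum_le_suminf) auto
  finally show "f n \<le> (\<Sum>n. f n)" .
qed

definition p_integrable :: "real \<Rightarrow> 'a measure \<Rightarrow> ('a \<Rightarrow> ennreal) \<Rightarrow> bool" where
  "p_integrable p M \<rho> \<longleftrightarrow> \<rho> \<in> borel_measurable M \<and> (\<integral>\<^sup>+ x. epowr (\<rho> x) p \<partial>M) < \<infinity>"

text \<open>Countably many functions are merged by a supremum instead of a sum, since the
  \<open>p\<close>-th power of a supremum is at most the sum of the \<open>p\<close>-th powers. This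
  takes the place of Minkowski's inequality.\<close>

lemma nn_integral_epowr_SUP_le:
  assumes "0 < p" and [measurable]: "\<And>n::nat. \<rho> n \<in> borel_measurable M"
  shows "(\<integral>\<^sup>+ x. epowr (SUP n. \<rho> n x) p \<partial>M) \<le> (\<Sum>n. \<integral>\<^sup>+ x. epowr (\<rho> n x) p \<partial>M)"
proof -
  have "(\<integral>\<^sup>+ x. epowr (SUP n. \<rho> n x) p \<partial>M) \<le> (\<integral>\<^sup>+ x. (\<Sum>n. epowr (\<rho> n x) p) \<partial>M)"
    using assms(1) by (intro nn_integral_mono) (simp add: epowr_SUP SUP_le_suminf_ennreal)
  also have "\<dots> = (\<Sum>n. \<integral>\<^sup>+ x. epowr (\<rho> n x) p \<partial>M)"
    by (rule nn_integral_suminf) measurable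
  finally show ?thesis .
qed

lemma suminf_half_power_ennreal: "(\<Sum>n. ennreal ((1 / 2) ^ n)) = 2"
  by (subst suminf_ennreal_eq[where x = 2]) (use geometric_sums[of "1 / 2 :: real"] in auto)

lemma p_integrable_SUP:
  assumes "0 < p" and [measurable]: "\<And>n::nat. \<rho> n \<in> borel_measurable M"
    and le: "\<And>n. (\<integral>\<^sup>+ x. epowr (\<rho> n x) p \<partial>M) \<le> ennreal ((1 / 2) ^ n)"
  shows "p_integrable p M (\<lambda>x. SUP n. \<rho> n x)"
proof -
  have "(\<integral>\<^sup>+ x. epowr (SUP n. \<rho> n x) p \<partial>M) \<le> (\<Sum>n. \<integral>\<^sup>+ x. epowr (\<rho> n x) p \<partial>M)"
    using assms(1) by (intro nn_integral_epowr_SUP_le) measurable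
  also have "\<dots> \<le> (\<Sum>n. ennreal ((1 / 2) ^ n))"
    by (intro suminf_le le) auto
  also have "\<dots> < \<infinity>"
    unfolding suminf_half_power_ennreal by simp
  finally show ?thesis
    unfolding p_integrable_def by simp
qed

lemma ex_powr_mult_le:
  assumes "0 < p" "I < (\<infinity>::ennreal)" "0 < e"
  obtains \<delta> :: real where "0 < \<delta>" "ennreal (\<delta> powr p) * I \<le> ennreal e"
proof -
  obtain i where i: "I = ennreal i" "0 \<le> i"
    using assms(2) by (cases I) auto
  \<comment> \<open>Chosen so that \<open>\<delta> powr p * (1 + i) = e\<close>; the summand
    \<open>1\<close> covers \<open>i = 0\<close>.\<close>
  define \<delta> where "\<delta> = (e / (1 + i)) powr (1 / p)"
  have "\<delta> powr p = e / (1 + i)"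
    using assms i by (simp add: \<delta>_def powr_powr)
  then have "\<delta> powr p * (1 + i) = e"
    using i by simp
  then have "\<delta> powr p * i = e - \<delta> powr p"
    by (simp add: algebra_simps)
  then have "\<delta> powr p * i \<le> e"
    by simp
  then have "ennreal (\<delta> powr p) * I \<le> ennreal e"
    using i(2) by (simp add: i(1) ennreal_leI flip: ennreal_mult)
  moreover have "0 < \<delta>" using assms i by (simp add: \<delta>_def)
  ultimately show thesis by (rule that[rotated])
qed

context rectifiable_curve
begin

lemma unit_speed_mem:
  "s \<in> {0..enn2real (curve_length (a, b, \<gamma>))} \<Longrightarrow> unit_speed (a, b, \<gamma>) s \<in> \<gamma> ` {a..b}"
  using arc_param(1)[of s] by (auto simp: unit_speed_eq len_def)

lemma line_integral_mono:
  "(\<And>x. x \<in> \<gamma> ` {a..b} \<Longrightarrow> f x \<le> g x) \<Longrightarrow> line_integral f (a, b, \<gamma>) \<le> line_integral g (a, b, \<gamma>)"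
  unfolding line_integral_def
  using unit_speed_mem by (intro nn_integral_mono) (auto split: split_indicator)

lemma line_integral_cong:
  "(\<And>x. x \<in> \<gamma> ` {a..b} \<Longrightarrow> f x = g x) \<Longrightarrow> line_integral f (a, b, \<gamma>) = line_integral g (a, b, \<gamma>)"
  by (intro antisym line_integral_mono) auto

lemma line_integral_const: "line_integral (\<lambda>_. 1) (a, b, \<gamma>) = curve_length (a, b, \<gamma>)"
  using emeasure_arc_measure[of a b] le by (simp add: line_integral_eq)

end

section \<open>Measures on Borel subsets of a Polish space\<close>

locale borel_subspace = sigma_finite_measure M for M :: "'a::polish_space measure" +
  assumes space_borel: "space M \<in> sets borel"
    and sets_eq: "sets M = sets (restrict_space borel (space M))"
begin

lemma measurable_borel:
  assumes "f \<in> borel_measurable borel" shows "f \<in> borel_measurable M"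
  using measurable_restrict_space1[OF assms, of "space M"] by (subst measurable_cong_sets[OF sets_eq refl])

lemma sets_iff: "A \<in> sets M \<longleftrightarrow> A \<in> sets borel \<and> A \<subseteq> space M"
  using space_borel by (subst sets_eq, subst sets_restrict_space_iff) (auto simp: space_restrict_space)

text \<open>The results on single curves ask for functions that are Borel on the whole type.
  Extending by zero supplies them without changing integrals over curves inside
  \<open>space M\<close>.\<close>

lemma zero_extension_measurable:
  assumes "\<rho> \<in> borel_measurable M"
  shows "(\<lambda>x. \<rho> x * indicator (space M) x :: ennreal) \<in> borel_measurable borel"
proof -
  have "\<rho> \<in> borel_measurable (restrict_space borel (space M))"
    using assms measurable_cong_sets[OF sets_eq refl] by blast
  then show ?thesis
    using space_borel by (subst (asm) borel_measurable_restrict_space_iff_ennreal) auto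
qed

text \<open>Restriction stays within the locale, so the theory of weak upper gradients applies at
  once to the whole spaces, to \<Omega> and to its preimage. Sigma-finiteness is inherited and
  yields the positive integrable weights used below.\<close>

lemma restrict: "S \<in> sets borel \<Longrightarrow> borel_subspace (restrict_space M S)"
proof -
  assume S: "S \<in> sets borel"
  have *: "space (restrict_space M S) = space M \<inter> S" by (auto simp: space_restrict_space)
  have SM: "space M \<inter> S \<in> sets M"
    using S space_borel by (auto simp: sets_iff)
  have "(\<inter>) S ` sets M = (\<inter>) (space M \<inter> S) ` sets M"
    using sets.sets_into_space by (intro image_cong) blast+
  then have r: "restrict_space M S = restrict_space M (space M \<inter> S)"
    by (simp add: restrict_space_def Int_ac)
  interpret R: sigma_finite_measure "restrict_space M S"
    unfolding r by (rule sigma_finite_measure_restrict_space[OF sigma_finite_measure_axioms SM])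
  show ?thesis
  proof
    show "space (restrict_space M S) \<in> sets borel" using S space_borel by (simp add: *)
    show "sets (restrict_space M S) = sets (restrict_space borel (space (restrict_space M S)))"
    proof (rule set_eqI)
      fix A
      have "A \<in> sets (restrict_space M S) \<longleftrightarrow> A \<subseteq> space M \<inter> S \<and> A \<in> sets M"
        using SM by (subst r, subst sets_restrict_space_iff) auto
      also have "\<dots> \<longleftrightarrow> A \<subseteq> space M \<inter> S \<and> A \<in> sets borel"
        by (auto simp: sets_iff)
      also have "\<dots> \<longleftrightarrow> A \<in> sets (restrict_space borel (space (restrict_space M S)))"
        unfolding * using S space_borel by (subst sets_restrict_space_iff) auto
      finally show "A \<in> sets (restrict_space M S)
          \<longleftrightarrow> A \<in> sets (restrict_space borel (space (restrict_space M S)))" .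
    qed
  qed
qed

end

text \<open>Fuglede's description of modulus zero: one \<open>p\<close>-integrable weight has
  infinite integral over all exceptional curves (see \<open>modulus_eq_0_iff\<close>). Weights can
  be combined, restricted and pulled back without touching curve families.\<close>

definition almost_all_curves ::
  "real \<Rightarrow> 'a::metric_space measure \<Rightarrow> (real \<Rightarrow> real \<Rightarrow> (real \<Rightarrow> 'a) \<Rightarrow> bool) \<Rightarrow> bool" where
  "almost_all_curves p M P \<longleftrightarrow> (\<exists>\<rho>. p_integrable p M \<rho> \<and>
     (\<forall>a b \<gamma>. rectifiable_curve a b \<gamma> \<longrightarrow> \<gamma> ` {a..b} \<subseteq> space M \<longrightarrow>
        line_integral \<rho> (a, b, \<gamma>) < \<infinity> \<longrightarrow> P a b \<gamma>))"

lemma rectifiable_curve_iff: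
  "rectifiable_curve a b \<gamma> \<and> \<gamma> ` {a..b} \<subseteq> S \<longleftrightarrow> (a, b, \<gamma>) \<in> curves S \<and> rectifiable (a, b, \<gamma>)"
  by (auto simp: rectifiable_curve_def curves_def rectifiable_def)

lemma almost_all_curves_mono:
  "almost_all_curves p M P \<Longrightarrow>
    (\<And>a b \<gamma>. rectifiable_curve a b \<gamma> \<Longrightarrow> \<gamma> ` {a..b} \<subseteq> space M \<Longrightarrow> P a b \<gamma> \<Longrightarrow> Q a b \<gamma>) \<Longrightarrow>
    almost_all_curves p M Q"
  unfolding almost_all_curves_def by meson

context borel_subspace
begin

lemma zero_extension:
  fixes \<rho> :: "'a \<Rightarrow> ennreal"
  assumes "\<rho> \<in> borel_measurable M"
  obtains \<rho>' where "\<rho>' \<in> borel_measurable borel" "\<And>x. x \<in> space M \<Longrightarrow> \<rho>' x = \<rho> x"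
    "\<And>x. x \<notin> space M \<Longrightarrow> \<rho>' x = 0"
  using zero_extension_measurable[OF assms]
  by (rule that) auto

lemma line_integral_cmult:
  assumes \<rho>: "\<rho> \<in> borel_measurable M" and c: "rectifiable_curve a b \<gamma>" "\<gamma> ` {a..b} \<subseteq> space M"
  shows "line_integral (\<lambda>x. k * \<rho> x) (a, b, \<gamma>) = k * line_integral \<rho> (a, b, \<gamma>)"
proof -
  interpret rectifiable_curve a b \<gamma> by (rule c)
  obtain \<rho>' where \<rho>' [measurable]: "\<rho>' \<in> borel_measurable borel" "\<And>x. x \<in> space M \<Longrightarrow> \<rho>' x = \<rho> x"
    using zero_extension[OF \<rho>] by metis
  have [measurable]: "(\<lambda>x. \<rho>' (\<gamma> x) * indicator {a..b} x) \<in> borel_measurable borel"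
    by (rule borel_measurable_curve_compose) measurable
  have \<rho>'_eq: "line_integral \<rho>' (a, b, \<gamma>)
      = (\<integral>\<^sup>+ x. \<rho>' (\<gamma> x) * indicator {a..b} x * indicator {a<..b} x \<partial>arc_measure)"
    by (subst line_integral_eq, measurable) (auto intro!: nn_integral_cong split: split_indicator)
  have "line_integral (\<lambda>x. k * \<rho>' x) (a, b, \<gamma>)
      = (\<integral>\<^sup>+ x. k * (\<rho>' (\<gamma> x) * indicator {a..b} x * indicator {a<..b} x) \<partial>arc_measure)"
    by (subst line_integral_eq, measurable) (auto intro!: nn_integral_cong split: split_indicator)
  also have "\<dots> = k * (\<integral>\<^sup>+ x. \<rho>' (\<gamma> x) * indicator {a..b} x * indicator {a<..b} x \<partial>arc_measure)"
    by (rule nn_integral_cmult) measurable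
  finally have "line_integral (\<lambda>x. k * \<rho>' x) (a, b, \<gamma>) = k * line_integral \<rho>' (a, b, \<gamma>)"
    unfolding \<rho>'_eq .
  then show ?thesis
    using line_integral_cong[of \<rho>' \<rho>] line_integral_cong[of "\<lambda>x. k * \<rho>' x" "\<lambda>x. k * \<rho> x"] \<rho>' c(2)
    by (metis (no_types, lifting) subsetD)
qed

text \<open>Scaled to energy at most \<open>(1 / 2) ^ n\<close>, the functions have a
  \<open>p\<close>-integrable supremum, and a finite integral of the supremum makes each integral
  finite.\<close>

lemma almost_all_curves_finite_countable:
  assumes p: "0 < p" and \<rho>: "\<And>n::nat. p_integrable p M (\<rho> n)"
  shows "almost_all_curves p M (\<lambda>a b \<gamma>. \<forall>n. line_integral (\<rho> n) (a, b, \<gamma>) < \<infinity>)"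
proof -
  have [measurable]: "\<rho> n \<in> borel_measurable M" for n
    using \<rho> by (simp add: p_integrable_def)
  have "\<exists>\<delta>>0. ennreal (\<delta> powr p) * (\<integral>\<^sup>+ x. epowr (\<rho> n x) p \<partial>M) \<le> ennreal ((1 / 2) ^ n)" for n
  proof -
    have "(\<integral>\<^sup>+ x. epowr (\<rho> n x) p \<partial>M) < \<infinity>" using \<rho> by (simp add: p_integrable_def)
    from ex_powr_mult_le[OF p this, of "(1 / 2) ^ n"] show ?thesis by (metis half_gt_zero_iff zero_less_one zero_less_power)
  qed
  then obtain \<delta> where \<delta>: "\<And>n. 0 < \<delta> n"
    "\<And>n. ennreal (\<delta> n powr p) * (\<integral>\<^sup>+ x. epowr (\<rho> n x) p \<partial>M) \<le> ennreal ((1 / 2) ^ n)"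
    by metis
  let ?\<rho> = "\<lambda>x. SUP n. ennreal (\<delta> n) * \<rho> n x"
  show ?thesis
    unfolding almost_all_curves_def
  proof (intro exI[of _ ?\<rho>] conjI allI impI)
    show "p_integrable p M ?\<rho>"
    proof (rule p_integrable_SUP[OF p])
      fix n
      have "(\<integral>\<^sup>+ x. epowr (ennreal (\<delta> n) * \<rho> n x) p \<partial>M)
          = ennreal (\<delta> n powr p) * (\<integral>\<^sup>+ x. epowr (\<rho> n x) p \<partial>M)"
        using p \<delta>(1)[of n] by (simp add: epowr_mult epowr_ennreal less_imp_le nn_integral_cmult)
      then show "(\<integral>\<^sup>+ x. epowr (ennreal (\<delta> n) * \<rho> n x) p \<partial>M) \<le> ennreal ((1 / 2) ^ n)"
        using \<delta>(2) by simp
    qed measurable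
    fix a b \<gamma> n
    assume c: "rectifiable_curve a b \<gamma>" "\<gamma> ` {a..b} \<subseteq> space M" and fin: "line_integral ?\<rho> (a, b, \<gamma>) < \<infinity>"
    have "ennreal (\<delta> n) * line_integral (\<rho> n) (a, b, \<gamma>) = line_integral (\<lambda>x. ennreal (\<delta> n) * \<rho> n x) (a, b, \<gamma>)"
      using c by (subst line_integral_cmult) auto
    also have "\<dots> \<le> line_integral ?\<rho> (a, b, \<gamma>)"
      by (rule rectifiable_curve.line_integral_mono[OF c(1)]) (auto intro: SUP_upper)
    finally have "ennreal (\<delta> n) * line_integral (\<rho> n) (a, b, \<gamma>) < \<infinity>"
      using fin by order
    then show "line_integral (\<rho> n) (a, b, \<gamma>) < \<infinity>"
      using \<delta>(1)[of n] by (auto simp: ennreal_mult_less_top less_top)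
  qed
qed

lemma almost_all_curves_countable:
  assumes p: "0 < p" and "\<And>n::nat. almost_all_curves p M (P n)"
  shows "almost_all_curves p M (\<lambda>a b \<gamma>. \<forall>n. P n a b \<gamma>)"
proof -
  have "\<forall>n. \<exists>\<rho>. p_integrable p M \<rho> \<and>
     (\<forall>a b \<gamma>. rectifiable_curve a b \<gamma> \<longrightarrow> \<gamma> ` {a..b} \<subseteq> space M \<longrightarrow>
        line_integral \<rho> (a, b, \<gamma>) < \<infinity> \<longrightarrow> P n a b \<gamma>)"
    using assms(2) unfolding almost_all_curves_def by (rule allI)
  from choice[OF this] obtain \<rho> where \<rho>: "\<And>n. p_integrable p M (\<rho> n)"
    "\<And>n a b \<gamma>. rectifiable_curve a b \<gamma> \<Longrightarrow> \<gamma> ` {a..b} \<subseteq> space M \<Longrightarrow>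
        line_integral (\<rho> n) (a, b, \<gamma>) < \<infinity> \<Longrightarrow> P n a b \<gamma>"
    by metis
  show ?thesis
    by (rule almost_all_curves_mono[OF almost_all_curves_finite_countable[where \<rho> = \<rho>, OF p \<rho>(1)]])
      (simp add: \<rho>(2))
qed

lemma almost_all_curves_conj:
  assumes "0 < p" "almost_all_curves p M P" "almost_all_curves p M Q"
  shows "almost_all_curves p M (\<lambda>a b \<gamma>. P a b \<gamma> \<and> Q a b \<gamma>)"
proof -
  have "almost_all_curves p M (\<lambda>a b \<gamma>. \<forall>n::nat. (if n = 0 then P else Q) a b \<gamma>)"
    using assms by (intro almost_all_curves_countable) auto
  then show ?thesis
    by (rule almost_all_curves_mono) (metis zero_neq_one)
qed

text \<open>The same weight works, since its integral over a subcurve is at most that over the whole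
  curve. Inequalities on all subcurves are what the comparison of measures along a curve
  requires.\<close>

lemma almost_all_curves_subcurves:
  assumes "almost_all_curves p M P"
  shows "almost_all_curves p M (\<lambda>a b \<gamma>. \<forall>s t. a \<le> s \<longrightarrow> s \<le> t \<longrightarrow> t \<le> b \<longrightarrow> P s t \<gamma>)"
proof -
  obtain \<rho> where \<rho>: "p_integrable p M \<rho>" and P: "\<And>a b \<gamma>. rectifiable_curve a b \<gamma> \<Longrightarrow>
      \<gamma> ` {a..b} \<subseteq> space M \<Longrightarrow> line_integral \<rho> (a, b, \<gamma>) < \<infinity> \<Longrightarrow> P a b \<gamma>"
    using assms by (auto simp: almost_all_curves_def)
  obtain \<rho>' where \<rho>': "\<rho>' \<in> borel_measurable borel" "\<And>x. x \<in> space M \<Longrightarrow> \<rho>' x = \<rho> x"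
    using zero_extension \<rho> by (metis p_integrable_def)
  show ?thesis
    unfolding almost_all_curves_def
  proof (intro exI[of _ \<rho>] conjI \<rho> allI impI)
    fix a b \<gamma> s t
    assume c: "rectifiable_curve a b \<gamma>" "\<gamma> ` {a..b} \<subseteq> space M"
      and fin: "line_integral \<rho> (a, b, \<gamma>) < \<infinity>" and st: "a \<le> s" "s \<le> t" "t \<le> b"
    interpret rectifiable_curve a b \<gamma> by (rule c)
    interpret S: rectifiable_curve s t \<gamma> using st by (rule subcurve)
    have sub: "\<gamma> ` {s..t} \<subseteq> space M" using st c(2) by fastforce
    have "line_integral \<rho> (s, t, \<gamma>) = line_integral \<rho>' (s, t, \<gamma>)"
      using sub \<rho>' by (intro S.line_integral_cong) auto
    also have "\<dots> \<le> line_integral \<rho>' (a, b, \<gamma>)"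
      using st \<rho>' by (intro line_integral_subcurve_le)
    also have "\<dots> = line_integral \<rho> (a, b, \<gamma>)"
      using c \<rho>' by (intro line_integral_cong) auto
    finally show "P s t \<gamma>"
      using fin by (intro P S.rectifiable_curve_axioms sub) order
  qed
qed

lemma almost_all_curves_restrict:
  assumes "S \<in> sets borel" and "almost_all_curves p M P"
  shows "almost_all_curves p (restrict_space M S) P"
proof -
  obtain \<rho> where \<rho>: "\<rho> \<in> borel_measurable M" "(\<integral>\<^sup>+ x. epowr (\<rho> x) p \<partial>M) < \<infinity>"
    and P: "\<And>a b \<gamma>. rectifiable_curve a b \<gamma> \<Longrightarrow>
      \<gamma> ` {a..b} \<subseteq> space M \<Longrightarrow> line_integral \<rho> (a, b, \<gamma>) < \<infinity> \<Longrightarrow> P a b \<gamma>"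
    using assms by (auto simp: almost_all_curves_def p_integrable_def)
  have "S \<inter> space M \<in> sets M"
    using assms space_borel by (auto simp: sets_iff)
  then have "(\<integral>\<^sup>+ x. epowr (\<rho> x) p \<partial>restrict_space M S) \<le> (\<integral>\<^sup>+ x. epowr (\<rho> x) p \<partial>M)"
    by (subst nn_integral_restrict_space) (auto intro!: nn_integral_mono split: split_indicator)
  moreover have "\<rho> \<in> borel_measurable (restrict_space M S)"
    using \<rho>(1) by (rule measurable_restrict_space1)
  ultimately show ?thesis
    unfolding almost_all_curves_def p_integrable_def
    using \<rho>(2) P by (intro exI[of _ \<rho>]) (auto simp: space_restrict_space)
qed

text \<open>The weight is extended by zero; on curves inside \<open>S\<close> its integral does not
  change.\<close>

lemma almost_all_curves_in_subset:
  assumes S: "S \<in> sets borel" and "almost_all_curves p (restrict_space M S) P"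
  shows "almost_all_curves p M (\<lambda>a b \<gamma>. \<gamma> ` {a..b} \<subseteq> S \<longrightarrow> P a b \<gamma>)"
proof -
  obtain \<rho> where \<rho>: "\<rho> \<in> borel_measurable (restrict_space M S)"
      "(\<integral>\<^sup>+ x. epowr (\<rho> x) p \<partial>restrict_space M S) < \<infinity>"
    and P: "\<And>a b \<gamma>. rectifiable_curve a b \<gamma> \<Longrightarrow>
      \<gamma> ` {a..b} \<subseteq> space M \<Longrightarrow> \<gamma> ` {a..b} \<subseteq> S \<Longrightarrow> line_integral \<rho> (a, b, \<gamma>) < \<infinity> \<Longrightarrow> P a b \<gamma>"
    using assms by (auto simp: almost_all_curves_def p_integrable_def space_restrict_space)
  have SM: "S \<inter> space M \<in> sets M"
    using S space_borel by (auto simp: sets_iff)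
  let ?\<rho> = "\<lambda>x. \<rho> x * indicator S x"
  have "?\<rho> \<in> borel_measurable M"
    using \<rho>(1) SM by (subst (asm) borel_measurable_restrict_space_iff_ennreal) auto
  moreover have "(\<integral>\<^sup>+ x. epowr (?\<rho> x) p \<partial>M) < \<infinity>"
  proof -
    have "(\<integral>\<^sup>+ x. epowr (?\<rho> x) p \<partial>M) = (\<integral>\<^sup>+ x. epowr (\<rho> x) p * indicator S x \<partial>M)"
      by (rule nn_integral_cong) (auto split: split_indicator)
    then show ?thesis using \<rho>(2) SM by (simp add: nn_integral_restrict_space)
  qed
  moreover have "P a b \<gamma>"
    if c: "rectifiable_curve a b \<gamma>" "\<gamma> ` {a..b} \<subseteq> space M" "\<gamma> ` {a..b} \<subseteq> S" "line_integral ?\<rho> (a, b, \<gamma>) < \<infinity>"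
    for a b \<gamma>
  proof -
    have "line_integral ?\<rho> (a, b, \<gamma>) = line_integral \<rho> (a, b, \<gamma>)"
      using c by (intro rectifiable_curve.line_integral_cong) auto
    with c show ?thesis by (intro P) auto
  qed
  ultimately show ?thesis
    unfolding almost_all_curves_def p_integrable_def by (intro exI[of _ ?\<rho>]) auto
qed

text \<open>If the modulus vanishes, admissible functions of rapidly decreasing energy are scaled by
  \<open>Suc n\<close> and merged by a supremum, whose integral is then at least
  \<open>Suc n\<close> for every \<open>n\<close>. Conversely, arbitrarily small multiples of a
  weight with infinite integrals are admissible.\<close>

lemma modulus_eq_0_iff:
  assumes p: "0 < p" and \<Gamma>: "\<Gamma> \<subseteq> curves (space M)"
  shows "modulus p M \<Gamma> = 0 \<longleftrightarrow>
    (\<exists>\<rho>. p_integrable p M \<rho> \<and> (\<forall>c\<in>\<Gamma>. rectifiable c \<longrightarrow> line_integral \<rho> c = \<infinity>))"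
proof
  assume zero: "modulus p M \<Gamma> = 0"
  \<comment> \<open>The factor anticipates the scaling by \<open>Suc n\<close>.\<close>
  have "\<exists>\<rho>\<in>admissible M \<Gamma>. ennreal (real (Suc n) powr p) * (\<integral>\<^sup>+ x. epowr (\<rho> x) p \<partial>M) \<le> ennreal ((1 / 2) ^ n)" for n
  proof -
    let ?k = "real (Suc n) powr p"
    have k: "0 < ?k" by simp
    then have "(INF \<rho>\<in>admissible M \<Gamma>. \<integral>\<^sup>+ x. epowr (\<rho> x) p \<partial>M) < ennreal ((1 / 2) ^ n / ?k)"
      using zero unfolding modulus_def by (metis divide_pos_pos ennreal_less_zero_iff half_gt_zero_iff zero_less_one zero_less_power)
    then obtain \<rho> where \<rho>: "\<rho> \<in> admissible M \<Gamma>" "(\<integral>\<^sup>+ x. epowr (\<rho> x) p \<partial>M) < ennreal ((1 / 2) ^ n / ?k)"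
      by (auto simp: INF_less_iff)
    have "ennreal ?k * (\<integral>\<^sup>+ x. epowr (\<rho> x) p \<partial>M) \<le> ennreal ?k * ennreal ((1 / 2) ^ n / ?k)"
      using \<rho>(2) by (intro mult_left_mono) auto
    also have "\<dots> = ennreal ((1 / 2) ^ n)"
      using k by (simp flip: ennreal_mult)
    finally show ?thesis using \<rho>(1) by blast
  qed
  then obtain \<rho> where adm: "\<And>n. \<rho> n \<in> admissible M \<Gamma>"
    and \<rho>: "\<And>n. ennreal (real (Suc n) powr p) * (\<integral>\<^sup>+ x. epowr (\<rho> n x) p \<partial>M) \<le> ennreal ((1 / 2) ^ n)"
    by metis
  have [measurable]: "\<rho> n \<in> borel_measurable M" for n
    using adm by (auto simp: admissible_def)
  let ?\<rho> = "\<lambda>x. SUP n. ennreal (real (Suc n)) * \<rho> n x"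
  have "p_integrable p M ?\<rho>"
  proof (rule p_integrable_SUP[OF p])
    fix n
    have "(\<integral>\<^sup>+ x. epowr (ennreal (real (Suc n)) * \<rho> n x) p \<partial>M)
        = ennreal (real (Suc n) powr p) * (\<integral>\<^sup>+ x. epowr (\<rho> n x) p \<partial>M)"
      using p by (simp add: epowr_mult epowr_ennreal nn_integral_cmult del: of_nat_Suc)
    then show "(\<integral>\<^sup>+ x. epowr (ennreal (real (Suc n)) * \<rho> n x) p \<partial>M) \<le> ennreal ((1 / 2) ^ n)"
      using \<rho> by simp
  qed measurable
  moreover have "line_integral ?\<rho> c = \<infinity>" if c: "c \<in> \<Gamma>" "rectifiable c" for c
  proof -
    obtain a b \<gamma> where c_eq: "c = (a, b, \<gamma>)" by (metis surj_pair)
    have rc: "rectifiable_curve a b \<gamma>" "\<gamma> ` {a..b} \<subseteq> space M"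
      using c \<Gamma> rectifiable_curve_iff[of a b \<gamma> "space M"] by (auto simp: c_eq)
    have "of_nat n \<le> line_integral ?\<rho> c" for n
    proof -
      have "1 \<le> line_integral (\<rho> n) (a, b, \<gamma>)"
        using adm[of n] c by (auto simp: admissible_def c_eq)
      then have "ennreal (real (Suc n)) * 1 \<le> ennreal (real (Suc n)) * line_integral (\<rho> n) (a, b, \<gamma>)"
        by (intro mult_left_mono) auto
      also have "\<dots> = line_integral (\<lambda>x. ennreal (real (Suc n)) * \<rho> n x) (a, b, \<gamma>)"
        using rc by (subst line_integral_cmult) auto
      also have "\<dots> \<le> line_integral ?\<rho> (a, b, \<gamma>)"
        by (rule rectifiable_curve.line_integral_mono[OF rc(1)]) (rule SUP_upper, simp)
      finally have "ennreal (real (Suc n)) \<le> line_integral ?\<rho> c" by (simp add: c_eq del: of_nat_Suc)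
      moreover have "of_nat n \<le> ennreal (real (Suc n))"
        by (metis ennreal_leI ennreal_of_nat_eq_real_of_nat le_SucI of_nat_le_iff order_refl)
      ultimately show ?thesis by order
    qed
    then show ?thesis
      by (metis ennreal_Ex_less_of_nat infinity_ennreal_def leD less_top)
  qed
  ultimately show "\<exists>\<rho>. p_integrable p M \<rho> \<and> (\<forall>c\<in>\<Gamma>. rectifiable c \<longrightarrow> line_integral \<rho> c = \<infinity>)"
    by blast
next
  assume "\<exists>\<rho>. p_integrable p M \<rho> \<and> (\<forall>c\<in>\<Gamma>. rectifiable c \<longrightarrow> line_integral \<rho> c = \<infinity>)"
  then obtain \<rho> where [measurable]: "\<rho> \<in> borel_measurable M" and fin: "(\<integral>\<^sup>+ x. epowr (\<rho> x) p \<partial>M) < \<infinity>"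
    and inf: "\<And>c. c \<in> \<Gamma> \<Longrightarrow> rectifiable c \<Longrightarrow> line_integral \<rho> c = \<infinity>"
    by (auto simp: p_integrable_def)
  have "modulus p M \<Gamma> \<le> 0 + ennreal e" if "0 < e" for e
  proof -
    obtain \<delta> where \<delta>: "0 < \<delta>" "ennreal (\<delta> powr p) * (\<integral>\<^sup>+ x. epowr (\<rho> x) p \<partial>M) \<le> ennreal e"
      using ex_powr_mult_le[OF p fin \<open>0 < e\<close>] by blast
    have "(\<lambda>x. ennreal \<delta> * \<rho> x) \<in> admissible M \<Gamma>"
      unfolding admissible_def
    proof (intro CollectI conjI ballI impI)
      fix c assume c: "c \<in> \<Gamma>" "rectifiable c"
      obtain a b \<gamma> where c_eq: "c = (a, b, \<gamma>)" by (metis surj_pair)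
      have rc: "rectifiable_curve a b \<gamma>" "\<gamma> ` {a..b} \<subseteq> space M"
        using c \<Gamma> rectifiable_curve_iff[of a b \<gamma> "space M"] by (auto simp: c_eq)
      show "1 \<le> line_integral (\<lambda>x. ennreal \<delta> * \<rho> x) c"
        using inf[OF c] \<delta>(1) rc unfolding c_eq
        by (subst line_integral_cmult) (auto simp: ennreal_mult_top)
    qed measurable
    then have "modulus p M \<Gamma> \<le> (\<integral>\<^sup>+ x. epowr (ennreal \<delta> * \<rho> x) p \<partial>M)"
      unfolding modulus_def by (rule INF_lower)
    also have "\<dots> = ennreal (\<delta> powr p) * (\<integral>\<^sup>+ x. epowr (\<rho> x) p \<partial>M)"
      using p \<delta>(1) by (simp add: epowr_mult epowr_ennreal less_imp_le nn_integral_cmult)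
    finally show ?thesis using \<delta>(2) by simp
  qed
  then have "modulus p M \<Gamma> \<le> 0" by (rule ennreal_le_epsilon)
  then show "modulus p M \<Gamma> = 0" by simp
qed

text \<open>From here on exceptional families appear only through weights.\<close>

lemma weak_upper_gradient_iff:
  assumes p: "0 < p"
  shows "weak_upper_gradient p M d h g \<longleftrightarrow> g \<in> borel_measurable M \<and>
    almost_all_curves p M (\<lambda>a b \<gamma>. ennreal (d (h (\<gamma> b)) (h (\<gamma> a))) \<le> line_integral g (a, b, \<gamma>))"
proof safe
  assume wug: "weak_upper_gradient p M d h g"
  then show "g \<in> borel_measurable M" by (simp add: weak_upper_gradient_def)
  obtain \<Gamma> where \<Gamma>: "\<Gamma> \<subseteq> curves (space M)" "modulus p M \<Gamma> = 0"
    and "\<forall>c\<in>curves (space M) - \<Gamma>. case c of (a, b, \<gamma>) \<Rightarrow> rectifiable (a, b, \<gamma>) \<longrightarrow>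
       ennreal (d (h (\<gamma> b)) (h (\<gamma> a))) \<le> line_integral g (a, b, \<gamma>)"
    using wug unfolding weak_upper_gradient_def ae_curve_def by blast
  then have ug: "\<And>a b \<gamma>. (a, b, \<gamma>) \<in> curves (space M) - \<Gamma> \<Longrightarrow> rectifiable (a, b, \<gamma>) \<Longrightarrow>
       ennreal (d (h (\<gamma> b)) (h (\<gamma> a))) \<le> line_integral g (a, b, \<gamma>)"
    by fast
  from \<Gamma> obtain \<rho> where \<rho>: "p_integrable p M \<rho>" "\<forall>c\<in>\<Gamma>. rectifiable c \<longrightarrow> line_integral \<rho> c = \<infinity>"
    using modulus_eq_0_iff[OF p \<Gamma>(1)] by blast
  show "almost_all_curves p M (\<lambda>a b \<gamma>. ennreal (d (h (\<gamma> b)) (h (\<gamma> a))) \<le> line_integral g (a, b, \<gamma>))"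
    unfolding almost_all_curves_def
  proof (intro exI[of _ \<rho>] conjI \<rho> allI impI)
    fix a b \<gamma>
    assume "rectifiable_curve a b \<gamma>" "\<gamma> ` {a..b} \<subseteq> space M" and fin: "line_integral \<rho> (a, b, \<gamma>) < \<infinity>"
    then have "(a, b, \<gamma>) \<in> curves (space M)" "rectifiable (a, b, \<gamma>)"
      using rectifiable_curve_iff by blast+
    moreover from this have "(a, b, \<gamma>) \<notin> \<Gamma>" using \<rho>(2) fin by auto
    ultimately show "ennreal (d (h (\<gamma> b)) (h (\<gamma> a))) \<le> line_integral g (a, b, \<gamma>)"
      using ug by blast
  qed
next
  assume g: "g \<in> borel_measurable M"
    and "almost_all_curves p M (\<lambda>a b \<gamma>. ennreal (d (h (\<gamma> b)) (h (\<gamma> a))) \<le> line_integral g (a, b, \<gamma>))"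
  then obtain \<rho> where \<rho>: "p_integrable p M \<rho>"
    and ug: "\<And>a b \<gamma>. rectifiable_curve a b \<gamma> \<Longrightarrow> \<gamma> ` {a..b} \<subseteq> space M \<Longrightarrow>
        line_integral \<rho> (a, b, \<gamma>) < \<infinity> \<Longrightarrow> ennreal (d (h (\<gamma> b)) (h (\<gamma> a))) \<le> line_integral g (a, b, \<gamma>)"
    by (auto simp: almost_all_curves_def)
  define \<Gamma> where "\<Gamma> = {c \<in> curves (space M). rectifiable c \<and> line_integral \<rho> c = \<infinity>}"
  have "modulus p M \<Gamma> = 0"
    using \<rho> by (subst modulus_eq_0_iff[OF p]) (auto simp: \<Gamma>_def)
  moreover have "ennreal (d (h (\<gamma> b)) (h (\<gamma> a))) \<le> line_integral g (a, b, \<gamma>)"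
    if "(a, b, \<gamma>) \<in> curves (space M) - \<Gamma>" "rectifiable (a, b, \<gamma>)" for a b \<gamma>
    using that rectifiable_curve_iff[of a b \<gamma> "space M"]
    by (intro ug) (auto simp: \<Gamma>_def less_top)
  ultimately show "weak_upper_gradient p M d h g"
    unfolding weak_upper_gradient_def ae_curve_def using g
    by (intro conjI exI[of _ \<Gamma>]) (auto simp: \<Gamma>_def)
qed

lemma almost_all_curves_finite:
  assumes "p_integrable p M g"
  shows "almost_all_curves p M (\<lambda>a b \<gamma>. line_integral g (a, b, \<gamma>) < \<infinity>)"
  unfolding almost_all_curves_def using assms by blast

end

section \<open>Minimal weak upper gradients\<close>

lemma (in rectifiable_curve) line_integral_sum:
  assumes "finite I" and f: "\<And>i. i \<in> I \<Longrightarrow> f i \<in> borel_measurable borel"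
  shows "line_integral (\<lambda>x. \<Sum>i\<in>I. f i x) (a, b, \<gamma>) = (\<Sum>i\<in>I. line_integral (f i) (a, b, \<gamma>))"
proof -
  let ?f = "\<lambda>i x. f i (\<gamma> x) * indicator {a..b} x * indicator {a<..b} x"
  have m: "?f i \<in> borel_measurable borel" if "i \<in> I" for i
    using borel_measurable_curve_compose[OF f[OF that]] by measurable
  have eq: "line_integral (f i) (a, b, \<gamma>) = (\<integral>\<^sup>+ x. ?f i x \<partial>arc_measure)" if "i \<in> I" for i
    by (subst line_integral_eq[OF f[OF that]]) (auto intro!: nn_integral_cong split: split_indicator)
  have "line_integral (\<lambda>x. \<Sum>i\<in>I. f i x) (a, b, \<gamma>) = (\<integral>\<^sup>+ x. (\<Sum>i\<in>I. ?f i x) \<partial>arc_measure)"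
    using f by (subst line_integral_eq) (auto intro!: nn_integral_cong split: split_indicator)
  also have "\<dots> = (\<Sum>i\<in>I. \<integral>\<^sup>+ x. ?f i x \<partial>arc_measure)"
    using m by (intro nn_integral_sum) auto
  finally show ?thesis using eq by simp
qed

lemma (in rectifiable_curve) line_integral_INF_decseq:
  fixes f :: "nat \<Rightarrow> 'a \<Rightarrow> ennreal"
  assumes f: "\<And>i. f i \<in> borel_measurable borel" and dec: "\<And>i x. f (Suc i) x \<le> f i x"
    and fin: "line_integral (f 0) (a, b, \<gamma>) < \<infinity>"
  shows "line_integral (\<lambda>x. INF i. f i x) (a, b, \<gamma>) = (INF i. line_integral (f i) (a, b, \<gamma>))"
proof -
  let ?f = "\<lambda>i x. f i (\<gamma> x) * indicator {a..b} x * indicator {a<..b} x"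
  have m: "?f i \<in> borel_measurable borel" for i
    using borel_measurable_curve_compose[OF f] by measurable
  have eq: "line_integral (f i) (a, b, \<gamma>) = (\<integral>\<^sup>+ x. ?f i x \<partial>arc_measure)" for i
    by (subst line_integral_eq[OF f]) (auto intro!: nn_integral_cong split: split_indicator)
  have "line_integral (\<lambda>x. INF i. f i x) (a, b, \<gamma>) = (\<integral>\<^sup>+ x. (INF i. ?f i x) \<partial>arc_measure)"
    using f by (subst line_integral_eq, measurable) (auto intro!: nn_integral_cong split: split_indicator)
  also have "\<dots> = (INF i. \<integral>\<^sup>+ x. ?f i x \<partial>arc_measure)"
  proof (rule nn_integral_monotone_convergence_INF_decseq)
    show "decseq ?f"
      by (intro decseq_SucI le_funI mult_right_mono dec) auto
    show "(\<integral>\<^sup>+ x. ?f 0 x \<partial>arc_measure) < \<infinity>" using fin eq by simp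
  qed (use m in simp)
  finally show ?thesis using eq by simp
qed

definition locally_p_integrable :: "real \<Rightarrow> 'a::topological_space measure \<Rightarrow> ('a \<Rightarrow> ennreal) \<Rightarrow> bool" where
  "locally_p_integrable p M g \<longleftrightarrow> g \<in> borel_measurable M \<and>
     (\<forall>x\<in>space M. \<exists>U. open U \<and> x \<in> U \<and> (\<integral>\<^sup>+ y\<in>U. epowr (g y) p \<partial>M) < \<infinity>)"

lemma p_integrable_imp_locally: "p_integrable p M g \<Longrightarrow> locally_p_integrable p M g"
  unfolding p_integrable_def locally_p_integrable_def
  by (intro conjI ballI exI[of _ UNIV]) auto

lemma locally_p_integrable_mono:
  assumes "locally_p_integrable p M g" "f \<in> borel_measurable M" "0 < p"
    and "\<And>x. x \<in> space M \<Longrightarrow> f x \<le> g x"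
  shows "locally_p_integrable p M f"
proof -
  have "(\<integral>\<^sup>+ y\<in>U. epowr (f y) p \<partial>M) \<le> (\<integral>\<^sup>+ y\<in>U. epowr (g y) p \<partial>M)" for U
    using assms by (intro nn_integral_mono mult_right_mono epowr_mono) auto
  with assms(1,2) show ?thesis
    unfolding locally_p_integrable_def by (meson le_less_trans)
qed

abbreviation curve_ug :: "('z \<Rightarrow> 'z \<Rightarrow> real) \<Rightarrow> ('a::metric_space \<Rightarrow> 'z) \<Rightarrow> ('a \<Rightarrow> ennreal) \<Rightarrow>
    real \<Rightarrow> real \<Rightarrow> (real \<Rightarrow> 'a) \<Rightarrow> bool" where
  "curve_ug d h g a b \<gamma> \<equiv> ennreal (d (h (\<gamma> b)) (h (\<gamma> a))) \<le> line_integral g (a, b, \<gamma>)"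

text \<open>On extended nonnegative numbers the map \<open>x \<mapsto> 1 / (1 + x)\<close> is
  injective, decreasing and bounded, with \<infinity> sent to \<open>0\<close>. It gives the
  optimization for minimal weak upper gradients finite values even for functions that are only
  locally integrable.\<close>

lemma inverse_one_plus_le_iff:
  fixes x y :: ennreal
  shows "inverse (1 + y) \<le> inverse (1 + x) \<longleftrightarrow> x \<le> y"
proof -
  have *: "1 + ennreal r = ennreal (1 + r)" if "0 \<le> r" for r
    using that by simp
  have "inverse (1 + s) \<le> inverse (1 + r) \<longleftrightarrow> r \<le> s" if "0 \<le> r" "0 \<le> s" for r s :: real
    using that by (subst inverse_le_iff_le) auto
  then show ?thesis
    by (cases x; cases y) (auto simp: * inverse_ennreal top_unique simp del: ennreal_plus)
qed

context borel_subspace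
begin

lemma UG_iff:
  "0 < p \<Longrightarrow> g \<in> UG p M d h \<longleftrightarrow> p_integrable p M g \<and> almost_all_curves p M (curve_ug d h g)"
  by (auto simp: UG_def weak_upper_gradient_iff p_integrable_def)

lemma UG_loc_iff:
  "0 < p \<Longrightarrow> g \<in> UG_loc p M d h \<longleftrightarrow>
    locally_p_integrable p M g \<and> almost_all_curves p M (curve_ug d h g)"
  by (auto simp: UG_loc_def weak_upper_gradient_iff locally_p_integrable_def)

lemma UG_subset_UG_loc: "0 < p \<Longrightarrow> UG p M d h \<subseteq> UG_loc p M d h"
  by (auto simp: UG_iff UG_loc_iff p_integrable_imp_locally)

lemma open_Int_space: "open U \<Longrightarrow> U \<inter> space M \<in> sets M"
  using space_borel by (auto simp: sets_iff)

text \<open>By Lindelof, countably many open sets on which \<open>g\<close> has finite energy cover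
  the space. Almost every curve has a finite integral of \<open>g\<close> over each of them, and its
  compact image is covered by finitely many.\<close>

lemma almost_all_curves_finite_local:
  assumes p: "0 < p" and g: "locally_p_integrable p M g"
  shows "almost_all_curves p M (\<lambda>a b \<gamma>. line_integral g (a, b, \<gamma>) < \<infinity>)"
proof -
  have gm: "g \<in> borel_measurable M" using g by (simp add: locally_p_integrable_def)
  define \<F> where "\<F> = {U. open U \<and> (\<integral>\<^sup>+ y\<in>U. epowr (g y) p \<partial>M) < \<infinity>}"
  obtain \<F>' where \<F>': "\<F>' \<subseteq> \<F>" "countable \<F>'" "\<Union>\<F>' = \<Union>\<F>"
    using Lindelof[of \<F>] by (auto simp: \<F>_def)
  \<comment> \<open>Inserting \<open>{}\<close> keeps the enumerated family nonempty.\<close>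
  define U where "U = from_nat_into (insert {} \<F>')"
  have "{} \<in> \<F>" by (simp add: \<F>_def)
  then have U_mem: "U n \<in> \<F>" for n
    using from_nat_into[of "insert {} \<F>'" n] \<F>'(1) by (auto simp: U_def)
  have U_range: "range U = insert {} \<F>'"
    unfolding U_def using \<F>'(2) by (intro range_from_nat_into) auto
  have cover: "space M \<subseteq> (\<Union>n. U n)"
  proof
    fix x assume "x \<in> space M"
    then have "x \<in> \<Union>\<F>" using g by (auto simp: locally_p_integrable_def \<F>_def)
    then have "x \<in> \<Union>\<F>'" using \<F>'(3) by simp
    then show "x \<in> (\<Union>n. U n)" unfolding U_range by auto
  qed
  let ?g = "\<lambda>n x. g x * indicator (U n) x"
  have int: "p_integrable p M (?g n)" for n
  proof -
    have o: "open (U n)" "(\<integral>\<^sup>+ y\<in>U n. epowr (g y) p \<partial>M) < \<infinity>"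
      using U_mem[of n] by (auto simp: \<F>_def)
    have "(\<lambda>x. indicator (U n) x :: ennreal) \<in> borel_measurable M"
      using o(1) by (intro measurable_borel) auto
    then have "?g n \<in> borel_measurable M" using gm by measurable
    moreover have "(\<integral>\<^sup>+ x. epowr (?g n x) p \<partial>M) = (\<integral>\<^sup>+ y\<in>U n. epowr (g y) p \<partial>M)"
      by (rule nn_integral_cong) (auto split: split_indicator)
    ultimately show ?thesis using o(2) by (simp add: p_integrable_def)
  qed
  show ?thesis
  proof (rule almost_all_curves_mono[OF almost_all_curves_finite_countable[where \<rho> = ?g, OF p int]])
    fix a b \<gamma> assume c: "rectifiable_curve a b \<gamma>" "\<gamma> ` {a..b} \<subseteq> space M"
      and fin: "\<forall>n. line_integral (?g n) (a, b, \<gamma>) < \<infinity>"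
    interpret rectifiable_curve a b \<gamma> by (rule c)
    have "compact (\<gamma> ` {a..b})" using cont by (intro compact_continuous_image) auto
    moreover have "open (U n)" for n using U_mem[of n] by (auto simp: \<F>_def)
    moreover have "\<gamma> ` {a..b} \<subseteq> (\<Union>n\<in>UNIV. U n)" using c(2) cover by auto
    ultimately obtain I where I: "finite I" "\<gamma> ` {a..b} \<subseteq> (\<Union>n\<in>I. U n)"
      by (rule compactE_image[where S = "\<gamma> ` {a..b}" and C = UNIV and f = U]) auto
    obtain g' where g': "g' \<in> borel_measurable borel" "\<And>x. x \<in> space M \<Longrightarrow> g' x = g x"
      using zero_extension[OF gm] by metis
    have [measurable]: "U n \<in> sets borel" for n using U_mem[of n] by (auto simp: \<F>_def)
    have "line_integral g (a, b, \<gamma>) \<le> line_integral (\<lambda>x. \<Sum>n\<in>I. g' x * indicator (U n) x) (a, b, \<gamma>)"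
    proof (rule line_integral_mono)
      fix x assume x: "x \<in> \<gamma> ` {a..b}"
      then obtain n where n: "n \<in> I" "x \<in> U n" using I(2) by auto
      have "g x = g' x * indicator (U n) x" using n g'(2) x c(2) by auto
      also have "\<dots> \<le> (\<Sum>n\<in>I. g' x * indicator (U n) x)"
        using n(1) I(1) by (intro member_le_sum) auto
      finally show "g x \<le> (\<Sum>n\<in>I. g' x * indicator (U n) x)" .
    qed
    also have "\<dots> = (\<Sum>n\<in>I. line_integral (\<lambda>x. g' x * indicator (U n) x) (a, b, \<gamma>))"
      using I(1) g'(1)
      by (intro line_integral_sum borel_measurable_times_ennreal borel_measurable_indicator) auto
    also have "\<dots> = (\<Sum>n\<in>I. line_integral (?g n) (a, b, \<gamma>))"
      using g'(2) c(2) by (intro sum.cong refl line_integral_cong) auto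
    also have "\<dots> < \<infinity>"
      using fin I(1) by (simp add: less_top)
    finally show "line_integral g (a, b, \<gamma>) < \<infinity>" .
  qed
qed

lemma UG_loc_almost_all_curves:
  assumes p: "0 < p" and g: "g \<in> UG_loc p M d h"
  shows "almost_all_curves p M (\<lambda>a b \<gamma>. line_integral g (a, b, \<gamma>) < \<infinity> \<and>
    (\<forall>s t. a \<le> s \<longrightarrow> s \<le> t \<longrightarrow> t \<le> b \<longrightarrow> curve_ug d h g s t \<gamma>))"
  using g unfolding UG_loc_iff[OF p]
  by (intro almost_all_curves_conj p almost_all_curves_finite_local almost_all_curves_subcurves) auto

text \<open>On almost every curve the inequality holds with \<open>g\<^sub>2\<close> on all
  subcurves and with \<open>g\<^sub>1\<close> on those inside \<open>U\<close>, so the gluing along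
  curves applies with \<open>A\<close> the part of \<open>U\<close> where \<open>g\<^sub>1\<close>
  is smaller.\<close>

lemma UG_loc_glue_aux:
  assumes p: "0 < p" and d: "Metric_space Z d" and h: "h \<in> space M \<rightarrow> Z" and U: "open U"
    and g2: "g\<^sub>2 \<in> UG_loc p M d h" and g1 [measurable]: "g\<^sub>1 \<in> borel_measurable M"
    and fin1: "almost_all_curves p M (\<lambda>a b \<gamma>. line_integral g\<^sub>1 (a, b, \<gamma>) < \<infinity>)"
    and ug1: "almost_all_curves p M (\<lambda>a b \<gamma>. \<gamma> ` {a..b} \<subseteq> U \<longrightarrow> curve_ug d h g\<^sub>1 a b \<gamma>)"
  shows "(\<lambda>x. if x \<in> U then min (g\<^sub>1 x) (g\<^sub>2 x) else g\<^sub>2 x) \<in> UG_loc p M d h" (is "?g \<in> _")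
proof -
  have g2l: "locally_p_integrable p M g\<^sub>2" and g2m [measurable]: "g\<^sub>2 \<in> borel_measurable M"
    using g2 by (auto simp: UG_loc_iff[OF p] locally_p_integrable_def)
  have [measurable]: "Measurable.pred M (\<lambda>x. x \<in> U)"
    using open_Int_space[OF U] by (simp add: Measurable.pred_def Int_def conj_commute)
  have "locally_p_integrable p M ?g"
    by (rule locally_p_integrable_mono[OF g2l _ p]) auto
  moreover have "almost_all_curves p M (curve_ug d h ?g)"
  proof (rule almost_all_curves_mono[OF almost_all_curves_conj[OF p UG_loc_almost_all_curves[OF p g2]
          almost_all_curves_conj[OF p fin1 almost_all_curves_subcurves[OF ug1]]]])
    fix a b \<gamma>
    assume c: "rectifiable_curve a b \<gamma>" "\<gamma> ` {a..b} \<subseteq> space M"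
      and *: "(line_integral g\<^sub>2 (a, b, \<gamma>) < \<infinity> \<and>
         (\<forall>s t. a \<le> s \<longrightarrow> s \<le> t \<longrightarrow> t \<le> b \<longrightarrow> curve_ug d h g\<^sub>2 s t \<gamma>)) \<and>
        line_integral g\<^sub>1 (a, b, \<gamma>) < \<infinity> \<and>
         (\<forall>s t. a \<le> s \<longrightarrow> s \<le> t \<longrightarrow> t \<le> b \<longrightarrow> \<gamma> ` {s..t} \<subseteq> U \<longrightarrow> curve_ug d h g\<^sub>1 s t \<gamma>)"
    interpret rectifiable_curve a b \<gamma> by (rule c)
    obtain f\<^sub>1 where f1 [measurable]: "f\<^sub>1 \<in> borel_measurable borel" and f1_eq: "\<And>x. x \<in> space M \<Longrightarrow> f\<^sub>1 x = g\<^sub>1 x"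
      using zero_extension[OF g1] by metis
    obtain f\<^sub>2 where f2 [measurable]: "f\<^sub>2 \<in> borel_measurable borel" and f2_eq: "\<And>x. x \<in> space M \<Longrightarrow> f\<^sub>2 x = g\<^sub>2 x"
      using zero_extension[OF g2m] by metis
    have li: "line_integral f\<^sub>1 (s, t, \<gamma>) = line_integral g\<^sub>1 (s, t, \<gamma>)"
      "line_integral f\<^sub>2 (s, t, \<gamma>) = line_integral g\<^sub>2 (s, t, \<gamma>)" if st: "a \<le> s" "s \<le> t" "t \<le> b" for s t
    proof -
      have "\<gamma> ` {s..t} \<subseteq> space M" using c(2) st by fastforce
      then show "line_integral f\<^sub>1 (s, t, \<gamma>) = line_integral g\<^sub>1 (s, t, \<gamma>)"
        "line_integral f\<^sub>2 (s, t, \<gamma>) = line_integral g\<^sub>2 (s, t, \<gamma>)"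
        using f1_eq f2_eq subcurve[OF st] by (auto intro!: rectifiable_curve.line_integral_cong)
    qed
    define A where "A = {x \<in> U. f\<^sub>1 x < f\<^sub>2 x}"
    have "A = U \<inter> {x. f\<^sub>1 x < f\<^sub>2 x}" by (auto simp: A_def)
    moreover have "{x. f\<^sub>1 x < f\<^sub>2 x} \<in> sets borel" by measurable
    ultimately have A: "A \<in> sets borel" using U by auto
    have "ennreal (d (h (\<gamma> b)) (h (\<gamma> a))) \<le> line_integral (\<lambda>x. if x \<in> A then f\<^sub>1 x else f\<^sub>2 x) (a, b, \<gamma>)"
    proof (rule subadditive_le_glued_line_integral[where D = "\<lambda>s t. ennreal (d (h (\<gamma> t)) (h (\<gamma> s)))"
          and U = U])
      fix r s t assume rst: "a \<le> r" "r \<le> s" "s \<le> t" "t \<le> b"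
      then have "h (\<gamma> r) \<in> Z" "h (\<gamma> s) \<in> Z" "h (\<gamma> t) \<in> Z"
        using c(2) h by (auto simp: Pi_iff image_subset_iff)
      then have "d (h (\<gamma> t)) (h (\<gamma> r)) \<le> d (h (\<gamma> t)) (h (\<gamma> s)) + d (h (\<gamma> s)) (h (\<gamma> r))"
        using Metric_space.triangle[OF d] by blast
      then show "ennreal (d (h (\<gamma> t)) (h (\<gamma> r)))
          \<le> ennreal (d (h (\<gamma> s)) (h (\<gamma> r))) + ennreal (d (h (\<gamma> t)) (h (\<gamma> s)))"
        using Metric_space.nonneg[OF d] by (simp add: add.commute ennreal_leI flip: ennreal_plus)
    next
      show "line_integral f\<^sub>1 (a, b, \<gamma>) < \<infinity>" "line_integral f\<^sub>2 (a, b, \<gamma>) < \<infinity>"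
        using * le by (auto simp: li)
      show "A \<subseteq> U" by (auto simp: A_def)
    qed (use * li U A f1 f2 in auto)
    also have "\<dots> = line_integral ?g (a, b, \<gamma>)"
      using c(2) f1_eq f2_eq by (intro line_integral_cong) (auto simp: A_def min_def not_less image_subset_iff)
    finally show "curve_ug d h ?g a b \<gamma>" .
  qed
  ultimately show ?thesis by (simp add: UG_loc_iff[OF p])
qed

lemma UG_loc_min:
  assumes p: "0 < p" and d: "Metric_space Z d" and h: "h \<in> space M \<rightarrow> Z"
    and g: "g\<^sub>1 \<in> UG_loc p M d h" "g\<^sub>2 \<in> UG_loc p M d h"
  shows "(\<lambda>x. min (g\<^sub>1 x) (g\<^sub>2 x)) \<in> UG_loc p M d h"
proof -
  have "(\<lambda>x. if x \<in> UNIV then min (g\<^sub>1 x) (g\<^sub>2 x) else g\<^sub>2 x) \<in> UG_loc p M d h"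
    using g(1)
    by (intro UG_loc_glue_aux[OF p d h _ g(2)] almost_all_curves_finite_local p)
      (auto simp: UG_loc_iff[OF p] locally_p_integrable_def)
  then show ?thesis by simp
qed

lemma UG_loc_restrict:
  assumes p: "0 < p" and S: "S \<in> sets borel" and g: "g \<in> UG_loc p M d h"
  shows "g \<in> UG_loc p (restrict_space M S) d h"
proof -
  interpret R: borel_subspace "restrict_space M S" using S by (rule restrict)
  have SM: "S \<inter> space M \<in> sets M" using S space_borel by (auto simp: sets_iff)
  have "locally_p_integrable p (restrict_space M S) g"
    unfolding locally_p_integrable_def
  proof (intro conjI ballI)
    show "g \<in> borel_measurable (restrict_space M S)"
      using g by (auto simp: UG_loc_iff[OF p] locally_p_integrable_def intro: measurable_restrict_space1)
    fix x assume "x \<in> space (restrict_space M S)"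
    then obtain U where U: "open U" "x \<in> U" "(\<integral>\<^sup>+ y\<in>U. epowr (g y) p \<partial>M) < \<infinity>"
      using g by (auto simp: UG_loc_iff[OF p] locally_p_integrable_def space_restrict_space)
    have "(\<integral>\<^sup>+ y\<in>U. epowr (g y) p \<partial>restrict_space M S) \<le> (\<integral>\<^sup>+ y\<in>U. epowr (g y) p \<partial>M)"
      using SM by (subst nn_integral_restrict_space) (auto intro!: nn_integral_mono split: split_indicator)
    with U show "\<exists>U. open U \<and> x \<in> U \<and> (\<integral>\<^sup>+ y\<in>U. epowr (g y) p \<partial>restrict_space M S) < \<infinity>"
      by (intro exI[of _ U]) auto
  qed
  moreover have "almost_all_curves p (restrict_space M S) (curve_ug d h g)"
    using g by (intro almost_all_curves_restrict S) (simp add: UG_loc_iff[OF p])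
  ultimately show ?thesis by (simp add: R.UG_loc_iff[OF p])
qed

text \<open>Near the boundary of \<open>U\<close> the function \<open>g\<^sub>1\<close> may fail to
  be locally integrable in the larger space. Its minimum with \<open>g\<^sub>2\<close> is still a
  weak upper gradient over \<open>U\<close> and is dominated by \<open>g\<^sub>2\<close>, which
  gives the finiteness required by \<open>UG_loc_glue_aux\<close>.\<close>

lemma UG_loc_glue:
  assumes p: "0 < p" and d: "Metric_space Z d" and h: "h \<in> space M \<rightarrow> Z" and U: "open U"
    and g2: "g\<^sub>2 \<in> UG_loc p M d h" and g1: "g\<^sub>1 \<in> UG_loc p (restrict_space M U) d h"
  shows "(\<lambda>x. if x \<in> U then min (g\<^sub>1 x) (g\<^sub>2 x) else g\<^sub>2 x) \<in> UG_loc p M d h"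
proof -
  have Ub: "U \<in> sets borel" using U by simp
  interpret R: borel_subspace "restrict_space M U" using Ub by (rule restrict)
  have g2m [measurable]: "g\<^sub>2 \<in> borel_measurable M"
    using g2 by (auto simp: UG_loc_iff[OF p] locally_p_integrable_def)
  have Um [measurable]: "Measurable.pred M (\<lambda>x. x \<in> U)"
    using open_Int_space[OF U] by (simp add: Measurable.pred_def Int_def conj_commute)
  let ?m = "\<lambda>x. min (g\<^sub>1 x) (g\<^sub>2 x)"
  let ?g = "\<lambda>x. if x \<in> U then ?m x else g\<^sub>2 x"
  have m: "?m \<in> UG_loc p (restrict_space M U) d h"
    using h by (intro R.UG_loc_min[OF p d] g1 UG_loc_restrict p Ub g2) (auto simp: space_restrict_space)
  then have "?m \<in> borel_measurable (restrict_space M U)"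
    by (auto simp: R.UG_loc_iff[OF p] locally_p_integrable_def)
  then have mU: "(\<lambda>x. ?m x * indicator U x) \<in> borel_measurable M"
    using open_Int_space[OF U] by (subst (asm) borel_measurable_restrict_space_iff_ennreal) auto
  have "(\<lambda>x. if x \<in> U then ?m x * indicator U x else g\<^sub>2 x) \<in> borel_measurable M"
    using mU by measurable
  also have "(\<lambda>x. if x \<in> U then ?m x * indicator U x else g\<^sub>2 x) = ?g" by auto
  finally have gm: "?g \<in> borel_measurable M" .
  have "(\<lambda>x. if x \<in> U then min (?g x) (g\<^sub>2 x) else g\<^sub>2 x) \<in> UG_loc p M d h"
  proof (rule UG_loc_glue_aux[OF p d h U g2 gm])
    show "almost_all_curves p M (\<lambda>a b \<gamma>. line_integral ?g (a, b, \<gamma>) < \<infinity>)"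
      using g2 gm unfolding UG_loc_iff[OF p]
      by (intro almost_all_curves_finite_local p locally_p_integrable_mono[of p M g\<^sub>2 ?g]) auto
    have "almost_all_curves p M (\<lambda>a b \<gamma>. \<gamma> ` {a..b} \<subseteq> U \<longrightarrow> curve_ug d h ?m a b \<gamma>)"
      using m by (intro almost_all_curves_in_subset Ub) (simp add: R.UG_loc_iff[OF p])
    then show "almost_all_curves p M (\<lambda>a b \<gamma>. \<gamma> ` {a..b} \<subseteq> U \<longrightarrow> curve_ug d h ?g a b \<gamma>)"
    proof (rule almost_all_curves_mono, intro impI)
      fix a b \<gamma> assume c: "rectifiable_curve a b \<gamma>" "\<gamma> ` {a..b} \<subseteq> U"
        and ug: "\<gamma> ` {a..b} \<subseteq> U \<longrightarrow> curve_ug d h ?m a b \<gamma>"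
      have "line_integral ?m (a, b, \<gamma>) = line_integral ?g (a, b, \<gamma>)"
        using c by (intro rectifiable_curve.line_integral_cong) auto
      with ug c show "curve_ug d h ?g a b \<gamma>" by simp
    qed
  qed
  then show ?thesis by (simp cong: if_cong)
qed

text \<open>Monotone convergence from above along each curve, where almost every curve has the
  finite integrals that this requires.\<close>

lemma UG_loc_INF_decseq:
  assumes p: "0 < p" and g: "\<And>n::nat. g n \<in> UG_loc p M d h" and dec: "\<And>n x. g (Suc n) x \<le> g n x"
  shows "(\<lambda>x. INF n. g n x) \<in> UG_loc p M d h"
proof -
  have gm [measurable]: "g n \<in> borel_measurable M" for n
    using g by (auto simp: UG_loc_iff[OF p] locally_p_integrable_def)
  have "locally_p_integrable p M (\<lambda>x. INF n. g n x)"
  proof (rule locally_p_integrable_mono[OF _ _ p])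
    show "locally_p_integrable p M (g 0)" using g by (simp add: UG_loc_iff[OF p])
  qed (auto intro: INF_lower)
  moreover have "almost_all_curves p M (curve_ug d h (\<lambda>x. INF n. g n x))"
  proof (rule almost_all_curves_mono[OF almost_all_curves_countable[OF p UG_loc_almost_all_curves[OF p g]]])
    fix a b \<gamma> assume c: "rectifiable_curve a b \<gamma>" "\<gamma> ` {a..b} \<subseteq> space M"
      and *: "\<forall>n. line_integral (g n) (a, b, \<gamma>) < \<infinity> \<and>
        (\<forall>s t. a \<le> s \<longrightarrow> s \<le> t \<longrightarrow> t \<le> b \<longrightarrow> curve_ug d h (g n) s t \<gamma>)"
    interpret rectifiable_curve a b \<gamma> by (rule c)
    let ?g = "\<lambda>n x. g n x * indicator (space M) x"
    have eq: "line_integral (?g n) (a, b, \<gamma>) = line_integral (g n) (a, b, \<gamma>)" for n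
      using c(2) by (intro line_integral_cong) auto
    have "line_integral (\<lambda>x. INF n. g n x) (a, b, \<gamma>) = line_integral (\<lambda>x. INF n. ?g n x) (a, b, \<gamma>)"
      using c(2) by (intro line_integral_cong) auto
    also have "\<dots> = (INF n. line_integral (?g n) (a, b, \<gamma>))"
      using * dec zero_extension_measurable[OF gm] eq
      by (intro line_integral_INF_decseq) (auto intro!: mult_right_mono)
    finally show "curve_ug d h (\<lambda>x. INF n. g n x) a b \<gamma>"
      using * le eq by (auto intro!: INF_greatest)
  qed
  ultimately show ?thesis by (simp add: UG_loc_iff[OF p])
qed

text \<open>
  The minimal weak upper gradient maximizes \<open>\<integral> w / (1 + g)\<close> for a positive integrable weight \<open>w\<close>.
\<close>

lemma ex_is_min_wug:
  assumes p: "0 < p" and d: "Metric_space Z d" and h: "h \<in> space M \<rightarrow> Z" and ne: "UG_loc p M d h \<noteq> {}"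
  shows "\<exists>\<rho>. is_min_wug p M d h \<rho>"
proof -
  have meas [measurable]: "g \<in> borel_measurable M" if "g \<in> UG_loc p M d h" for g
    using that by (auto simp: UG_loc_iff[OF p] locally_p_integrable_def)
  obtain w where w [measurable]: "w \<in> borel_measurable M" and w_int: "integral\<^sup>N M w \<noteq> \<infinity>"
    and w_pos: "\<And>x. x \<in> space M \<Longrightarrow> 0 < w x \<and> w x < \<infinity>"
    using Ex_finite_integrable_function by blast
  define J where "J g = (\<integral>\<^sup>+ x. w x * inverse (1 + g x) \<partial>M)" for g
  have inv_mono: "inverse (1 + y) \<le> inverse (1 + x)" if "x \<le> y" for x y :: ennreal
    using that by (simp add: inverse_one_plus_le_iff)
  have J_mono: "J g' \<le> J g" if "\<And>x. x \<in> space M \<Longrightarrow> g x \<le> g' x" for g g'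
    unfolding J_def by (intro nn_integral_mono mult_left_mono inv_mono that) auto
  have "J g \<le> integral\<^sup>N M w" for g
    unfolding J_def using inv_mono[of 0] by (intro nn_integral_mono) (auto intro: mult_left_le)
  then have J_fin: "J g \<noteq> \<infinity>" for g
    using w_int by (metis infinity_ennreal_def top_unique)
  obtain f where f: "range f \<subseteq> J ` UG_loc p M d h" "Sup (J ` UG_loc p M d h) = (SUP i::nat. f i)"
    using ennreal_Sup_countable_SUP[of "J ` UG_loc p M d h"] ne by auto
  then have "\<forall>n. \<exists>g\<in>UG_loc p M d h. f n = J g" by blast
  then obtain g where g: "\<And>n. g n \<in> UG_loc p M d h" "\<And>n. f n = J (g n)" by metis
  \<comment> \<open>Running minima turn the maximizing sequence into a decreasing one without
    lowering \<open>J\<close>.\<close>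
  define G where "G = rec_nat (g 0) (\<lambda>n G x. min (g (Suc n) x) (G x))"
  have G_Suc: "G (Suc n) x = min (g (Suc n) x) (G n x)" and G_0: "G 0 = g 0" for n x
    by (auto simp: G_def)
  have G: "G n \<in> UG_loc p M d h" for n
  proof (induction n)
    case (Suc n)
    have "G (Suc n) = (\<lambda>x. min (g (Suc n) x) (G n x))" by (rule ext) (rule G_Suc)
    then show ?case using UG_loc_min[OF p d h g(1)[of "Suc n"] Suc] by simp
  qed (simp add: G_0 g)
  have G_le: "G n x \<le> g n x" for n x
    by (cases n) (auto simp: G_Suc G_0)
  define \<rho> where "\<rho> x = (INF n. G n x)" for x
  have \<rho>: "\<rho> \<in> UG_loc p M d h"
    unfolding \<rho>_def[abs_def] by (rule UG_loc_INF_decseq[OF p G]) (simp add: G_Suc)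
  have max: "J g' \<le> J \<rho>" if "g' \<in> UG_loc p M d h" for g'
  proof -
    have "J g' \<le> (SUP i. f i)" unfolding f(2)[symmetric] using that by (intro SUP_upper)
    also have "\<dots> \<le> J \<rho>"
    proof (rule SUP_least)
      fix n
      have "\<rho> x \<le> g n x" for x
        unfolding \<rho>_def using G_le[of n x] by (meson INF_lower UNIV_I order_trans)
      then show "f n \<le> J \<rho>" unfolding g(2) by (intro J_mono)
    qed
    finally show ?thesis .
  qed
  have "AE x in M. \<rho> x \<le> g' x" if g': "g' \<in> UG_loc p M d h" for g'
  proof -
    let ?m = "\<lambda>x. min (g' x) (\<rho> x)"
    have m: "?m \<in> UG_loc p M d h" by (rule UG_loc_min[OF p d h g' \<rho>])
    note [measurable] = meas[OF g'] meas[OF \<rho>]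
    \<comment> \<open>\<open>?m\<close> lies below \<rho> and is again a competitor, so maximality
      of \<open>J \<rho>\<close> makes the two integrals equal, and then the integrands agree almost
      everywhere.\<close>
    have "(\<integral>\<^sup>+ x. w x * inverse (1 + ?m x) - w x * inverse (1 + \<rho> x) \<partial>M) = J ?m - J \<rho>"
      unfolding J_def
    proof (rule nn_integral_diff)
      show "(\<integral>\<^sup>+ x. w x * inverse (1 + \<rho> x) \<partial>M) \<noteq> \<infinity>" using J_fin[of \<rho>] by (simp add: J_def)
      show "AE x in M. w x * inverse (1 + \<rho> x) \<le> w x * inverse (1 + ?m x)"
        by (intro AE_I2 mult_left_mono inv_mono) auto
    qed measurable
    also have "\<dots> = 0" using max[OF m] using J_fin[of ?m] by (simp add: diff_eq_0_iff_ennreal less_top)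
    finally have "AE x in M. w x * inverse (1 + ?m x) - w x * inverse (1 + \<rho> x) = 0"
      by (subst (asm) nn_integral_0_iff_AE) measurable
    with AE_space show ?thesis
    proof eventually_elim
      case (elim x)
      have "w x * inverse (1 + ?m x) = w x * inverse (1 + \<rho> x)"
      proof (rule antisym)
        show "w x * inverse (1 + ?m x) \<le> w x * inverse (1 + \<rho> x)"
          using elim(2) unfolding diff_eq_0_iff_ennreal by blast
        show "w x * inverse (1 + \<rho> x) \<le> w x * inverse (1 + ?m x)"
          by (intro mult_left_mono inv_mono) auto
      qed
      then have "inverse (1 + ?m x) = inverse (1 + \<rho> x)"
        using w_pos[OF elim(1)] by (auto simp: ennreal_mult_cancel_left)
      then have "\<rho> x \<le> ?m x"
        by (metis inverse_one_plus_le_iff order_refl)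
      then show ?case by simp
    qed
  qed
  with \<rho> show ?thesis by (auto simp: is_min_wug_def)
qed

lemma is_min_wug_min_wug:
  assumes "0 < p" "Metric_space Z d" "h \<in> space M \<rightarrow> Z" "UG_loc p M d h \<noteq> {}"
  shows "is_min_wug p M d h (min_wug p M d h)"
  unfolding min_wug_def using ex_is_min_wug[OF assms] by (rule someI_ex)

text \<open>Gluing \<open>g\<close> into \<rho> over \<open>U\<close> gives a competitor on the
  whole space, which cannot beat \<rho>. This locality lets \<rho> be compared with weak upper
  gradients that exist only over a small open set.\<close>

lemma min_wug_le_local:
  assumes p: "0 < p" and d: "Metric_space Z d" and h: "h \<in> space M \<rightarrow> Z" and U: "open U"
    and \<rho>: "is_min_wug p M d h \<rho>" and g: "g \<in> UG_loc p (restrict_space M U) d h"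
  shows "AE x in M. x \<in> U \<longrightarrow> \<rho> x \<le> g x"
proof -
  have "(\<lambda>x. if x \<in> U then min (g x) (\<rho> x) else \<rho> x) \<in> UG_loc p M d h"
    using \<rho> by (intro UG_loc_glue[OF p d h U _ g]) (simp add: is_min_wug_def)
  then have "AE x in M. \<rho> x \<le> (if x \<in> U then min (g x) (\<rho> x) else \<rho> x)"
    using \<rho> by (simp add: is_min_wug_def)
  then show ?thesis by eventually_elim auto
qed

text \<open>Passing to \<open>S\<close> leaves fewer curves to test, so minimal weak upper gradients
  can only decrease.\<close>

lemma min_wug_mono_restrict:
  assumes p: "0 < p" and S: "S \<in> sets borel" and g: "g \<in> UG_loc p M d h"
    and \<rho>: "is_min_wug p (restrict_space M S) d h \<rho>"
  shows "AE x in M. x \<in> S \<longrightarrow> \<rho> x \<le> g x"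
proof -
  have "AE x in restrict_space M S. \<rho> x \<le> g x"
    using \<rho> UG_loc_restrict[OF p S g] by (simp add: is_min_wug_def)
  moreover have "S \<inter> space M \<in> sets M" using S space_borel by (auto simp: sets_iff)
  ultimately show ?thesis by (simp add: AE_restrict_space_iff)
qed

end

section \<open>Essential separability of Borel maps\<close>

text \<open>Codes for Borel sets as well-founded, countably branching trees over a countable base.
  They serve to count: there are at most continuum many Borel sets.\<close>

datatype borel_code = Basic nat | Complement borel_code | Countable_Union "nat \<Rightarrow> borel_code"

primrec code_set :: "(nat \<Rightarrow> 'a set) \<Rightarrow> borel_code \<Rightarrow> 'a set" where
  "code_set G (Basic n) = G n"
| "code_set G (Complement c) = - code_set G c"
| "code_set G (Countable_Union f) = (\<Union>n. code_set G (f n))"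

text \<open>The label of the node reached from the root along a path: \<open>0\<close> and
  \<open>1\<close> mark complements and unions, \<open>n + 2\<close> the basic set with index
  \<open>n\<close>. A complement node has one child, reached by any entry of the path; below a leaf
  the label repeats.\<close>

primrec code_tree :: "borel_code \<Rightarrow> nat list \<Rightarrow> nat" where
  "code_tree (Basic n) = (\<lambda>_. n + 2)"
| "code_tree (Complement c) = (\<lambda>l. case l of [] \<Rightarrow> 0 | _ # l \<Rightarrow> code_tree c l)"
| "code_tree (Countable_Union f) = (\<lambda>l. case l of [] \<Rightarrow> 1 | n # l \<Rightarrow> code_tree (f n) l)"

lemma code_tree_inject: "code_tree c = code_tree c' \<Longrightarrow> c = c'"
proof (induction c arbitrary: c')
  case (Basic n)
  from fun_cong[OF Basic, of "[]"] show ?case by (cases c') auto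
next
  case (Complement c)
  from fun_cong[OF Complement.prems, of "[]"] obtain e where e: "c' = Complement e"
    by (cases c') auto
  have "code_tree c l = code_tree e l" for l
    using fun_cong[OF Complement.prems, of "0 # l"] e by simp
  then show ?case using Complement.IH[of e] e by auto
next
  case (Countable_Union f)
  from fun_cong[OF Countable_Union.prems, of "[]"] obtain e where e: "c' = Countable_Union e"
    by (cases c') auto
  have "code_tree (f n) l = code_tree (e n) l" for n l
    using fun_cong[OF Countable_Union.prems, of "n # l"] e by simp
  then have "f n = e n" for n using Countable_Union.IH[of "f n" "e n"] by auto
  then show ?case using e by auto
qed

lemma sigma_sets_subset_range_code_set:
  assumes "UNIV \<in> range G"
  shows "sigma_sets UNIV (range G) \<subseteq> range (code_set G)"
proof
  fix A assume "A \<in> sigma_sets UNIV (range G)"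
  then show "A \<in> range (code_set G)"
  proof (induction rule: sigma_sets.induct)
    case (Basic a)
    then obtain n where "a = G n" by blast
    then have "a = code_set G (borel_code.Basic n)" by simp
    then show ?case by blast
  next
    case Empty
    \<comment> \<open>The empty set has no code of its own; it is coded as the complement of the
      whole space, which \<open>G\<close> lists.\<close>
    obtain n where "G n = UNIV" using assms by (metis rangeE)
    then have "{} = code_set G (Complement (borel_code.Basic n))" by simp
    then show ?case by blast
  next
    case (Compl a)
    then obtain c where "a = code_set G c" by blast
    then have "UNIV - a = code_set G (Complement c)" by auto
    then show ?case by blast
  next
    case (Union a)
    then have "\<forall>i. \<exists>c. a i = code_set G c" by blast
    then obtain f where "\<And>i. a i = code_set G (f i)" by metis
    then have "\<Union>(range a) = code_set G (Countable_Union f)" by simp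
    then show ?case by blast
  qed
qed

lemma borel_sets_inject_cantor_space:
  "\<exists>f :: 'a::second_countable_topology set \<Rightarrow> nat \<Rightarrow> bool. inj_on f (sets borel)"
proof -
  obtain \<B> :: "'a set set" where \<B>: "countable \<B>" "topological_basis \<B>"
    using ex_countable_basis by blast
  define G where "G = from_nat_into (insert UNIV \<B>)"
  have G: "range G = insert UNIV \<B>"
    unfolding G_def using \<B>(1) by (intro range_from_nat_into) auto
  have "sets borel = sigma_sets UNIV \<B>"
    unfolding borel_eq_countable_basis[OF \<B>] by (rule sets_measure_of) simp
  also have "\<dots> \<subseteq> sigma_sets UNIV (range G)"
    unfolding G by (intro sigma_sets_mono') auto
  also have "\<dots> \<subseteq> range (code_set G)"
    by (rule sigma_sets_subset_range_code_set) (simp add: G)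
  finally have "\<forall>A\<in>sets borel. \<exists>c. code_set G c = A" by blast
  then obtain code where code: "\<And>A. A \<in> sets borel \<Longrightarrow> code_set G (code A) = A" by metis
  \<comment> \<open>The graph of \<open>code_tree (code A)\<close>, enumerated as a 0-1
    sequence.\<close>
  define f where "f A k = (case from_nat k of (l, n) \<Rightarrow> code_tree (code A) l = n)" for A k
  have "inj_on f (sets borel)"
  proof (rule inj_onI)
    fix A B :: "'a set" assume AB: "A \<in> sets borel" "B \<in> sets borel" "f A = f B"
    have "code_tree (code A) l = code_tree (code B) l" for l
      using fun_cong[OF AB(3), of "to_nat (l, code_tree (code A) l)"] by (simp add: f_def)
    then have "code A = code B" by (intro code_tree_inject) auto
    then show "A = B" using code AB(1,2) by metis
  qed
  then show ?thesis by blast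
qed

text \<open>Cantor's theorem: the subsets of Cantor space outnumber its points, and the Borel sets
  inject into the latter.\<close>

lemma no_inj_cantor_subsets_to_borel:
  fixes F :: "(nat \<Rightarrow> bool) set \<Rightarrow> 'a::second_countable_topology set"
  assumes "inj F" "range F \<subseteq> sets borel"
  shows False
proof -
  obtain f :: "'a set \<Rightarrow> nat \<Rightarrow> bool" where "inj_on f (sets borel)"
    using borel_sets_inject_cantor_space by blast
  then have "inj (f \<circ> F)"
    using assms by (metis comp_inj_on inj_on_subset)
  then have "surj (inv (f \<circ> F))" by (rule inj_imp_surj_inv)
  then show False
    using Cantors_theorem[of UNIV] by auto
qed

lemma decseq_compact_Inter_nonempty:
  fixes T :: "nat \<Rightarrow> 'a::t2_space set"
  assumes "decseq T" and compact: "\<And>n. compact (T n)" and ne: "\<And>n. T n \<noteq> {}"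
  shows "(\<Inter>n. T n) \<noteq> {}"
proof
  assume empty: "(\<Inter>n. T n) = {}"
  have "open (- T n)" for n using compact by (simp add: compact_imp_closed open_Compl)
  moreover have "T 0 \<subseteq> (\<Union>n\<in>UNIV. - T n)" using empty by auto
  ultimately obtain I where I: "finite I" "T 0 \<subseteq> (\<Union>n\<in>I. - T n)"
    by (rule compactE_image[OF compact, of UNIV "\<lambda>n. - T n" 0]) auto
  define m where "m = Max (insert 0 I)"
  have "T m \<subseteq> T n" if "n \<in> insert 0 I" for n
    unfolding m_def using I(1) that by (intro decseqD[OF \<open>decseq T\<close>] Max_ge) auto
  then have "T m = {}" using I(2) by blast
  then show False using ne by simp
qed

text \<open>
  If the union had positive measure, then a Cantor scheme of compact sets whose members at each
  level lie over disjoint index sets would give continuum many indices, hence more Borel sets than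
  there are.
\<close>

lemma disjoint_null_union:
  fixes \<nu> :: "'a::polish_space measure" and B :: "'i \<Rightarrow> 'a set"
  assumes fin: "finite_measure \<nu>" and sets [simp]: "sets \<nu> = sets borel"
    and disj: "disjoint_family_on B I"
    and meas: "\<And>S. S \<subseteq> I \<Longrightarrow> (\<Union>i\<in>S. B i) \<in> sets borel"
    and null: "\<And>i. i \<in> I \<Longrightarrow> emeasure \<nu> (B i) = 0"
  shows "emeasure \<nu> (\<Union>i\<in>I. B i) = 0"
proof (rule ccontr)
  assume pos: "emeasure \<nu> (\<Union>i\<in>I. B i) \<noteq> 0"
  interpret finite_measure \<nu> by fact
  \<comment> \<open>Empty members are dropped so that every index has a representative
    point.\<close>
  define J where "J = {i \<in> I. B i \<noteq> {}}"
  define U where "U S = (\<Union>i\<in>S. B i)" for S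
  have UJ: "U J = (\<Union>i\<in>I. B i)" by (auto simp: U_def J_def)
  have U_meas: "S \<subseteq> J \<Longrightarrow> U S \<in> sets borel" for S
    unfolding U_def J_def by (rule meas) auto
  have mem_U: "x \<in> B i \<Longrightarrow> i \<in> J \<Longrightarrow> S \<subseteq> J \<Longrightarrow> x \<in> U S \<longleftrightarrow> i \<in> S" for x i S
  proof
    assume *: "x \<in> B i" "i \<in> J" "S \<subseteq> J" "x \<in> U S"
    then obtain j where j: "j \<in> S" "x \<in> B j" by (auto simp: U_def)
    have "i = j"
      using disj * j unfolding disjoint_family_on_def J_def by (metis (no_types, lifting) IntI empty_iff mem_Collect_eq subsetD)
    with j show "i \<in> S" by simp
  qed (auto simp: U_def)
  have "\<forall>i\<in>J. \<exists>x. x \<in> B i" by (auto simp: J_def)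
  then obtain r where r: "\<And>i. i \<in> J \<Longrightarrow> r i \<in> B i" by metis
  have r_inj: "r i \<noteq> r j" if "i \<in> J" "j \<in> J" "i \<noteq> j" for i j
    using r[OF that(1)] r[OF that(2)] mem_U[of "r i" i "{j}"] that by (auto simp: U_def)
  \<comment> \<open>The representatives are distinct points, so a countable base separates them. If
    no \<open>S\<close> splits \<open>K\<close>, then for each basic set \<open>V\<close> either the
    indices with representative in \<open>V\<close> or the remaining ones contribute only a null set
    to \<open>K\<close>. Removing these countably many null sets leaves a part of \<open>K\<close>
    that lies over a single index, and this part is null as well.\<close>
  have split: "\<exists>S\<subseteq>J. emeasure \<nu> (K \<inter> U S) \<noteq> 0 \<and> emeasure \<nu> (K \<inter> U (J - S)) \<noteq> 0"
    if K: "K \<in> sets borel" "K \<subseteq> U J" "emeasure \<nu> K \<noteq> 0" for K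
  proof (rule ccontr)
    assume neg: "\<not> ?thesis"
    obtain \<B> :: "'a set set" where \<B>: "countable \<B>" "topological_basis \<B>"
      using ex_countable_basis by blast
    define S where "S V = {i \<in> J. r i \<in> V}" for V
    define W where "W V = (if emeasure \<nu> (K \<inter> U (S V)) = 0 then K \<inter> U (S V) else K \<inter> U (J - S V))" for V
    have SJ: "S V \<subseteq> J" for V by (auto simp: S_def)
    have "W V \<in> null_sets \<nu>" for V
    proof -
      have "emeasure \<nu> (K \<inter> U (S V)) = 0 \<or> emeasure \<nu> (K \<inter> U (J - S V)) = 0"
        using neg SJ by blast
      then show ?thesis
        using K(1) U_meas[OF SJ[of V]] U_meas[of "J - S V"] by (auto simp: W_def)
    qed
    then have N: "(\<Union>V\<in>\<B>. W V) \<in> null_sets \<nu>"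
      using \<B>(1) by (intro null_sets_UN')
    then have Kpos: "emeasure \<nu> (K - (\<Union>V\<in>\<B>. W V)) \<noteq> 0"
      using K by (simp add: emeasure_Diff_null_set)
    then have "K - (\<Union>V\<in>\<B>. W V) \<noteq> {}" by force
    then obtain x where x0: "x \<in> K - (\<Union>V\<in>\<B>. W V)" by blast
    then obtain i where "i \<in> J" "x \<in> B i" using K(2) by (auto simp: U_def)
    note x = x0 this
    have "K - (\<Union>V\<in>\<B>. W V) \<subseteq> B i"
    proof
      fix y assume y: "y \<in> K - (\<Union>V\<in>\<B>. W V)"
      then obtain j where j: "j \<in> J" "y \<in> B j" using K(2) by (auto simp: U_def)
      \<comment> \<open>Otherwise some basic set separates the representatives, and the null set
        removed for it contains \<open>x\<close> or \<open>y\<close>.\<close>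
      have "i = j"
      proof (rule ccontr)
        assume "i \<noteq> j"
        then have "r i \<noteq> r j" using r_inj x(2) j(1) by blast
        then obtain V' where "open V'" "r i \<in> V'" "r j \<notin> V'" using t1_space by blast
        then obtain V where V: "V \<in> \<B>" "r i \<in> V" "r j \<notin> V"
          using topological_basisE[OF \<B>(2)] by (metis subsetD)
        then have "x \<in> U (S V)" "y \<in> U (J - S V)"
          using x j mem_U[of x i "S V"] mem_U[of y j "J - S V"] by (auto simp: S_def)
        then have "x \<in> W V \<or> y \<in> W V" using x y by (auto simp: W_def)
        then show False using x y V(1) by blast
      qed
      then show "y \<in> B i" using j by simp
    qed
    moreover have "B i \<in> sets borel" using meas[of "{i}"] x(2) by (auto simp: J_def)
    ultimately have "emeasure \<nu> (K - (\<Union>V\<in>\<B>. W V)) \<le> emeasure \<nu> (B i)"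
      by (intro emeasure_mono) auto
    then show False using Kpos null[of i] x(2) by (auto simp: J_def)
  qed
  have inner: "\<exists>K. compact K \<and> K \<subseteq> A \<and> emeasure \<nu> K \<noteq> 0"
    if A: "A \<in> sets borel" "emeasure \<nu> A \<noteq> 0" for A
  proof (rule ccontr)
    assume "\<not> ?thesis"
    then have "emeasure \<nu> K \<le> 0" if "K \<in> {K. K \<subseteq> A \<and> compact K}" for K
      using that by auto
    then have "(SUP K\<in>{K. K \<subseteq> A \<and> compact K}. emeasure \<nu> K) \<le> 0" by (rule SUP_least)
    then have "emeasure \<nu> A \<le> 0"
      using inner_regular[OF sets _ A(1)] by simp
    then show False using A(2) by simp
  qed
  define P where "P K \<longleftrightarrow> compact K \<and> K \<subseteq> U J \<and> emeasure \<nu> K \<noteq> 0" for K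
  have "\<exists>S L. S \<subseteq> J \<and> (\<forall>b. P (L b) \<and> L b \<subseteq> K \<inter> U (if b then S else J - S))" if "P K" for K
  proof -
    have K: "K \<in> sets borel" "K \<subseteq> U J" "emeasure \<nu> K \<noteq> 0"
      using that by (auto simp: P_def borel_compact)
    obtain S where S: "S \<subseteq> J" "emeasure \<nu> (K \<inter> U S) \<noteq> 0" "emeasure \<nu> (K \<inter> U (J - S)) \<noteq> 0"
      using split[OF K] by blast
    obtain K1 where K1: "compact K1" "K1 \<subseteq> K \<inter> U S" "emeasure \<nu> K1 \<noteq> 0"
      using inner[OF _ S(2)] K(1) U_meas[OF S(1)] by blast
    obtain K2 where K2: "compact K2" "K2 \<subseteq> K \<inter> U (J - S)" "emeasure \<nu> K2 \<noteq> 0"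
      using inner[OF _ S(3)] K(1) U_meas[of "J - S"] by blast
    show ?thesis
      using S(1) K1 K2 K(2) by (intro exI[of _ S] exI[of _ "\<lambda>b. if b then K1 else K2"]) (auto simp: P_def)
  qed
  then obtain S L where SL: "\<And>K. P K \<Longrightarrow> S K \<subseteq> J" "\<And>K b. P K \<Longrightarrow> P (L K b)"
    "\<And>K b. P K \<Longrightarrow> L K b \<subseteq> K \<inter> U (if b then S K else J - S K)"
    by metis
  obtain K0 where K0: "P K0"
    using inner[of "U J"] U_meas[of J] pos UJ by (auto simp: P_def)
  \<comment> \<open>The branch of the Cantor scheme along \<sigma>; at each level the bit chooses
    the side of the split.\<close>
  define T where "T \<sigma> = rec_nat K0 (\<lambda>n K. L K (\<sigma> n))" for \<sigma> :: "nat \<Rightarrow> bool"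
  have T_0: "T \<sigma> 0 = K0" and T_Suc: "T \<sigma> (Suc n) = L (T \<sigma> n) (\<sigma> n)" for \<sigma> n
    by (auto simp: T_def)
  have PT: "P (T \<sigma> n)" for \<sigma> n
    by (induction n) (auto simp: T_0 T_Suc K0 SL(2))
  have T_dec: "decseq (T \<sigma>)" for \<sigma>
    using SL(3)[OF PT] by (intro decseq_SucI) (auto simp: T_Suc)
  have "(\<Inter>n. T \<sigma> n) \<noteq> {}" for \<sigma>
    using PT[of \<sigma>] unfolding P_def by (intro decseq_compact_Inter_nonempty T_dec) (blast, metis emeasure_empty)
  then have "\<forall>\<sigma>. \<exists>x. \<forall>n. x \<in> T \<sigma> n" by blast
  then obtain x where x: "\<And>\<sigma> n. x \<sigma> \<in> T \<sigma> n" by metis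
  have "\<forall>\<sigma>. \<exists>i\<in>J. x \<sigma> \<in> B i" using x[of _ 0] K0 by (force simp: T_0 P_def U_def)
  then obtain i where i: "\<And>\<sigma>. i \<sigma> \<in> J" "\<And>\<sigma>. x \<sigma> \<in> B (i \<sigma>)" by metis
  have i_inj: "i \<sigma> \<noteq> i \<tau>" if "\<sigma> \<noteq> \<tau>" for \<sigma> \<tau>
  proof -
    \<comment> \<open>At the first bit where the branches differ, the compact sets still agree, and
      they are then split over disjoint index sets.\<close>
    define n where "n = (LEAST n. \<sigma> n \<noteq> \<tau> n)"
    have "\<exists>n. \<sigma> n \<noteq> \<tau> n" using that by blast
    then have n: "\<sigma> n \<noteq> \<tau> n" unfolding n_def by (rule LeastI_ex)
    have "m < n \<Longrightarrow> \<sigma> m = \<tau> m" for m unfolding n_def using not_less_Least by blast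
    then have "m \<le> n \<Longrightarrow> T \<sigma> m = T \<tau> m" for m
      by (induction m) (auto simp: T_0 T_Suc)
    then have T_eq: "T \<sigma> n = T \<tau> n" by simp
    let ?S = "S (T \<sigma> n)"
    have S: "?S \<subseteq> J" by (rule SL(1)[OF PT])
    have "x \<sigma> \<in> U (if \<sigma> n then ?S else J - ?S)" "x \<tau> \<in> U (if \<tau> n then ?S else J - ?S)"
      using SL(3)[OF PT[of \<sigma> n], of "\<sigma> n"] SL(3)[OF PT[of \<sigma> n], of "\<tau> n"]
        x[of \<sigma> "Suc n"] x[of \<tau> "Suc n"] by (auto simp: T_Suc T_eq)
    then have "i \<sigma> \<in> (if \<sigma> n then ?S else J - ?S)" "i \<tau> \<in> (if \<tau> n then ?S else J - ?S)"
      using mem_U[OF i(2) i(1), of "if \<sigma> n then ?S else J - ?S" \<sigma>]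
        mem_U[OF i(2) i(1), of "if \<tau> n then ?S else J - ?S" \<tau>] S by auto
    then show ?thesis using n by (auto split: if_splits)
  qed
  have sub: "i ` A \<subseteq> J" for A using i(1) by auto
  \<comment> \<open>\<open>A\<close> is recovered from the union: the point
    \<open>x \<sigma>\<close> lies in it exactly if \<open>\<sigma> \<in> A\<close>.\<close>
  have "inj (\<lambda>A. U (i ` A))"
  proof (rule injI)
    fix A A' assume eq: "U (i ` A) = U (i ` A')"
    have "\<sigma> \<in> A \<longleftrightarrow> x \<sigma> \<in> U (i ` A)" for \<sigma> A
      using mem_U[OF i(2) i(1) sub, of \<sigma> A] i_inj by (metis image_eqI image_iff)
    then show "A = A'" using eq by blast
  qed
  moreover have "range (\<lambda>A. U (i ` A)) \<subseteq> sets borel" using U_meas[OF sub] by auto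
  ultimately show False by (rule no_inj_cantor_subsets_to_borel)
qed

text \<open>Sending a point to the index of its member pushes \<nu> forward to a finite measure on a
  discrete space, which has only countably many atoms. This map is measurable because arbitrary
  unions of members are Borel; the value \<open>None\<close> collects the points outside all
  members.\<close>

lemma countable_positive_disjoint:
  fixes \<nu> :: "'a::topological_space measure" and B :: "'i \<Rightarrow> 'a set"
  assumes "finite_measure \<nu>" and sets [simp]: "sets \<nu> = sets borel"
    and disj: "disjoint_family_on B UNIV"
    and meas: "\<And>S. (\<Union>i\<in>S. B i) \<in> sets borel"
  shows "countable {i. emeasure \<nu> (B i) \<noteq> 0}"
proof -
  interpret finite_measure \<nu> by fact
  have [simp]: "space \<nu> = UNIV" using sets_eq_imp_space_eq[OF sets] by simp
  define q where "q x = (if \<exists>i. x \<in> B i then Some (THE i. x \<in> B i) else None)" for x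
  have q: "q x = Some i \<longleftrightarrow> x \<in> B i" for x i
  proof -
    have "(THE i. x \<in> B i) = i" if "x \<in> B i" for i
      using that disj by (intro the_equality) (auto simp: disjoint_family_on_def)
    then show ?thesis by (auto simp: q_def)
  qed
  have "q \<in> measurable \<nu> (count_space UNIV)"
  proof (rule measurableI)
    fix A :: "'i option set"
    have "q -` A = (\<Union>i\<in>{i. Some i \<in> A}. B i) \<union> (if None \<in> A then - (\<Union>i\<in>UNIV. B i) else {})"
    proof (rule set_eqI)
      fix x
      have "q x = None \<longleftrightarrow> x \<notin> (\<Union>i\<in>UNIV. B i)" by (auto simp: q_def)
      then show "x \<in> q -` A \<longleftrightarrow>
          x \<in> (\<Union>i\<in>{i. Some i \<in> A}. B i) \<union> (if None \<in> A then - (\<Union>i\<in>UNIV. B i) else {})"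
      proof (cases "q x")
        case (Some j)
        then have "x \<in> B i \<longleftrightarrow> i = j" for i using q[of x i] by auto
        with Some show ?thesis by auto
      qed auto
    qed
    moreover have "- (\<Union>i\<in>UNIV. B i) \<in> sets borel" using meas by (rule borel_comp)
    ultimately show "q -` A \<inter> space \<nu> \<in> sets \<nu>"
      using meas[of "{i. Some i \<in> A}"] by (simp del: Compl_UN)
  qed simp
  note [measurable] = this
  interpret D: finite_measure "distr \<nu> (count_space UNIV) q"
    by (rule finite_measure_distr) measurable
  have "countable {y. measure (distr \<nu> (count_space UNIV) q) {y} \<noteq> 0}"
    by (rule D.countable_support)
  moreover have "Some ` {i. emeasure \<nu> (B i) \<noteq> 0} \<subseteq> {y. measure (distr \<nu> (count_space UNIV) q) {y} \<noteq> 0}"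
  proof clarify
    fix i assume "emeasure \<nu> (B i) \<noteq> 0" and "measure (distr \<nu> (count_space UNIV) q) {Some i} = 0"
    moreover have "q -` {Some i} = B i" using q by auto
    ultimately show False by (simp add: D.emeasure_eq_measure[symmetric] measure_distr emeasure_eq_measure)
  qed
  ultimately have "countable (Some ` {i. emeasure \<nu> (B i) \<noteq> 0})" by (rule countable_subset[rotated])
  then show ?thesis by (simp add: countable_image_inj_eq)
qed

section \<open>Separability and disjoint open families in metric spaces\<close>

lemma (in Metric_space) separable_space_if_countable_nets:
  assumes T: "T \<subseteq> M" and net: "\<And>n::nat. \<exists>C. countable C \<and> T \<subseteq> (\<Union>z\<in>C. mball z (1 / real (Suc n)))"
  shows "separable_space (subtopology mtopology T)"
proof -
  obtain C where C: "\<And>n. countable (C n)" "\<And>n. T \<subseteq> (\<Union>z\<in>C n. mball z (1 / real (Suc n)))"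
    using net by metis
  \<comment> \<open>Centres may lie outside \<open>T\<close>, so each is replaced by a point of
    \<open>T\<close> in its ball, at the price of doubling the radius. The intersection with
    \<open>T\<close> in the set \<open>D\<close> below discards the arbitrary choices made for balls
    that miss \<open>T\<close>.\<close>
  define y where "y n z = (SOME y. y \<in> T \<inter> mball z (1 / real (Suc n)))" for n z
  have y: "y n z \<in> T \<inter> mball z (1 / real (Suc n))" if "x \<in> T \<inter> mball z (1 / real (Suc n))" for n z x
    unfolding y_def using that by (rule someI)
  define D where "D = (\<Union>n. y n ` C n) \<inter> T"
  have "T \<subseteq> mtopology closure_of D"
  proof
    fix x assume x: "x \<in> T"
    have "\<exists>v\<in>D. v \<in> mball x e" if "0 < e" for e
    proof -
      obtain n where n: "1 / real (Suc n) < e / 2" using nat_approx_posE[of "e / 2"] \<open>0 < e\<close> by auto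
      obtain z where z: "z \<in> C n" "x \<in> mball z (1 / real (Suc n))" using C(2)[of n] x by blast
      then have yz: "y n z \<in> T \<inter> mball z (1 / real (Suc n))" using x by (intro y) auto
      have "d x (y n z) \<le> d x z + d z (y n z)"
        using z yz x T by (intro triangle) auto
      also have "\<dots> < e / 2 + e / 2"
        using z yz n by (intro add_strict_mono) (auto simp: commute)
      finally have "y n z \<in> mball x e" using x yz T by auto
      moreover have "y n z \<in> D" using z yz by (auto simp: D_def)
      ultimately show ?thesis by blast
    qed
    then show "x \<in> mtopology closure_of D" using x T by (auto simp: metric_closure_of)
  qed
  then have "subtopology mtopology T closure_of D = topspace (subtopology mtopology T)"
    using T by (auto simp: closure_of_subtopology_open D_def)
  moreover have "countable D" using C(1) unfolding D_def by (intro countable_Int1 countable_UN) auto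
  moreover have "D \<subseteq> topspace (subtopology mtopology T)" using T by (auto simp: D_def)
  ultimately show ?thesis unfolding separable_space_def by blast
qed

text \<open>
  As in Stone's theorem on paracompactness: well-order the centres of the \<open>\<epsilon>\<close>-balls, assign each point
  to the first ball containing it, and thicken the resulting pieces where this leaves them disjoint.
\<close>

lemma (in Metric_space) ex_disjoint_open_cover_sequence:
  assumes "0 < \<epsilon>"
  shows "\<exists>U :: nat \<Rightarrow> 'a \<Rightarrow> 'a set. (\<forall>n z. openin mtopology (U n z) \<and> U n z \<subseteq> mball z \<epsilon>) \<and>
    (\<forall>n. disjoint_family_on (U n) UNIV) \<and> M \<subseteq> (\<Union>n z. U n z)"
proof -
  obtain r :: "'a rel" where r: "Well_order r" "Field r = UNIV"
    using well_order_on[of "UNIV :: 'a set"] by (auto dest: well_order_on_Well_order)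
  have wf: "wf (r - Id)" and tot: "total r"
    using r by (auto simp: well_order_on_def linear_order_on_def)
  have "\<exists>z. c \<in> mball z \<epsilon> \<and> (\<forall>z'. (z', z) \<in> r - Id \<longrightarrow> c \<notin> mball z' \<epsilon>)" if "c \<in> M" for c
  proof -
    have "c \<in> {z. c \<in> mball z \<epsilon>}" using that \<open>0 < \<epsilon>\<close> by auto
    from wfE_min[OF wf this] obtain z where "z \<in> {z. c \<in> mball z \<epsilon>}"
      "\<And>y. (y, z) \<in> r - Id \<Longrightarrow> y \<notin> {z. c \<in> mball z \<epsilon>}" by metis
    then show ?thesis by auto
  qed
  then obtain \<phi> where \<phi>: "\<And>c. c \<in> M \<Longrightarrow> c \<in> mball (\<phi> c) \<epsilon>"
    "\<And>c z'. c \<in> M \<Longrightarrow> (z', \<phi> c) \<in> r - Id \<Longrightarrow> c \<notin> mball z' \<epsilon>"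
    by metis
  define \<delta> where "\<delta> n = 1 / real (Suc n)" for n
  have \<delta>: "0 < \<delta> n" for n by (simp add: \<delta>_def)
  \<comment> \<open>The margin \<open>2 * \<delta> n\<close> separates the pieces: two centres whose
    balls of radius \<open>\<delta> n\<close> meet are closer than that, so a centre assigned to the
    later ball would already lie in the earlier one.\<close>
  define A where "A n z = {c \<in> M. \<phi> c = z \<and> mball c (2 * \<delta> n) \<subseteq> mball z \<epsilon>}" for n z
  define U where "U n z = (\<Union>c\<in>A n z. mball c (\<delta> n))" for n z
  have "openin mtopology (U n z)" for n z
    unfolding U_def by (intro openin_Union) auto
  moreover have "U n z \<subseteq> mball z \<epsilon>" for n z
  proof -
    have "mball c (\<delta> n) \<subseteq> mball c (2 * \<delta> n)" for c using \<delta>[of n] by (intro mball_subset_concentric) auto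
    then show ?thesis unfolding U_def A_def by blast
  qed
  moreover have "disjoint_family_on (U n) UNIV" for n
  proof -
    have *: False if z: "(z', z) \<in> r - Id" and y: "y \<in> U n z" "y \<in> U n z'" for y z z'
    proof -
      obtain c c' where c: "c \<in> M" "\<phi> c = z" "y \<in> mball c (\<delta> n)"
        and c': "c' \<in> M" "mball c' (2 * \<delta> n) \<subseteq> mball z' \<epsilon>" "y \<in> mball c' (\<delta> n)"
        using y by (auto simp: U_def A_def)
      have "d c' c \<le> d c' y + d y c" using c c' by (intro triangle) auto
      also have "\<dots> < 2 * \<delta> n" using c(3) c'(3) by (simp add: commute)
      finally have "c \<in> mball z' \<epsilon>" using c(1) c'(1,2) by (auto simp: subset_iff)
      with \<phi>(2)[OF c(1), of z'] z c(2) show False by blast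
    qed
    show ?thesis
      unfolding disjoint_family_on_def
    proof (intro ballI impI, rule ccontr)
      fix z z' :: 'a assume "z \<noteq> z'" "U n z \<inter> U n z' \<noteq> {}"
      moreover from this tot have "(z, z') \<in> r - Id \<or> (z', z) \<in> r - Id"
        by (auto simp: total_on_def)
      ultimately show False using * by blast
    qed
  qed
  moreover have "M \<subseteq> (\<Union>n z. U n z)"
  proof
    fix c assume c: "c \<in> M"
    have "openin mtopology (mball (\<phi> c) \<epsilon>)" by simp
    then obtain e where e: "0 < e" "mball c e \<subseteq> mball (\<phi> c) \<epsilon>"
      using \<phi>(1)[OF c] unfolding openin_mtopology by blast
    obtain n where "\<delta> n < e / 2" using nat_approx_posE[of "e / 2"] e(1) by (auto simp: \<delta>_def)
    then have "mball c (2 * \<delta> n) \<subseteq> mball (\<phi> c) \<epsilon>"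
      using e(2) mball_subset_concentric[of "2 * \<delta> n" e c] by auto
    then have "c \<in> U n (\<phi> c)"
      using c \<delta>[of n] by (auto simp: U_def A_def intro!: exI[of _ c])
    then show "c \<in> (\<Union>n z. U n z)" by blast
  qed
  ultimately show ?thesis by blast
qed

text \<open>At each scale the target is covered by countably many disjoint families of small open
  sets. Their preimages form disjoint families all of whose unions are Borel, so all but countably
  many members are null, and the null ones have a null union. Off a null set, countably many small
  balls therefore contain all values.\<close>

lemma (in borel_subspace) borel_map_essentially_separable:
  assumes d: "Metric_space Z d" and h: "h \<in> space M \<rightarrow> Z"
    and meas: "\<And>U. openin (Metric_space.mtopology Z d) U \<Longrightarrow> h -` U \<inter> space M \<in> sets M"
  shows "\<exists>N\<in>null_sets M. separable_space (subtopology (Metric_space.mtopology Z d) (h ` (space M - N)))"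
proof -
  interpret Z: Metric_space Z d by (rule d)
  obtain w where w [measurable]: "w \<in> borel_measurable M" and w_int: "integral\<^sup>N M w \<noteq> \<infinity>"
    and w_pos: "\<And>x. x \<in> space M \<Longrightarrow> 0 < w x \<and> w x < \<infinity>"
    using Ex_finite_integrable_function by blast
  have id [measurable]: "(\<lambda>x. x) \<in> measurable M borel"
    by (rule measurable_borel) simp
  \<comment> \<open>A finite Borel measure on the whole type with the same null sets inside
    \<open>space M\<close>. Finiteness gives inner regularity and the countability of positive
    members.\<close>
  define \<nu> where "\<nu> = distr (density M w) borel (\<lambda>x. x)"
  have [simp]: "sets \<nu> = sets borel" by (simp add: \<nu>_def)
  have \<nu>: "emeasure \<nu> A = (\<integral>\<^sup>+ x\<in>A. w x \<partial>M)" if "A \<in> sets borel" "A \<subseteq> space M" for A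
    using that sets_iff[of A] unfolding \<nu>_def
    by (subst emeasure_distr) (auto simp: emeasure_density)
  have fin: "finite_measure \<nu>"
  proof (rule finite_measureI)
    have "emeasure \<nu> (space \<nu>) = emeasure (density M w) (space M)"
      unfolding \<nu>_def by (subst emeasure_distr) auto
    also have "\<dots> = integral\<^sup>N M w" by (subst emeasure_density) (auto intro!: nn_integral_cong)
    finally show "emeasure \<nu> (space \<nu>) \<noteq> \<infinity>" using w_int by simp
  qed
  have null: "A \<in> null_sets M" if A: "A \<in> sets borel" "A \<subseteq> space M" "emeasure \<nu> A = 0" for A
  proof -
    have AM: "A \<in> sets M" using A by (simp add: sets_iff)
    have "(\<integral>\<^sup>+ x\<in>A. w x \<partial>M) = 0" using A(3) \<nu>[OF A(1,2)] by simp
    then have "AE x in M. w x * indicator A x = 0"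
      using AM by (subst (asm) nn_integral_0_iff_AE) auto
    then have "AE x in M. x \<notin> A"
      using AE_space by eventually_elim (use w_pos in \<open>force split: split_indicator_asm\<close>)
    then show ?thesis using AM by (simp add: AE_iff_null_sets)
  qed
  have "\<exists>N\<in>null_sets M. \<exists>C. countable C \<and> h ` (space M - N) \<subseteq> (\<Union>z\<in>C. Z.mball z (1 / real (Suc m)))" for m :: nat
  proof -
    obtain U where U: "\<And>n z. openin Z.mtopology (U n z)" "\<And>n z. U n z \<subseteq> Z.mball z (1 / real (Suc m))"
      "\<And>n::nat. disjoint_family_on (U n) UNIV" "Z \<subseteq> (\<Union>n z. U n z)"
      using Z.ex_disjoint_open_cover_sequence[of "1 / real (Suc m)"] by auto
    define B where "B n z = h -` U n z \<inter> space M" for n z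
    have B_meas: "(\<Union>z\<in>S. B n z) \<in> sets borel" for n S
    proof -
      have "openin Z.mtopology (\<Union>z\<in>S. U n z)" using U(1) by (intro openin_Union) auto
      from meas[OF this] have "h -` (\<Union>z\<in>S. U n z) \<inter> space M \<in> sets borel" by (simp add: sets_iff)
      moreover have "h -` (\<Union>z\<in>S. U n z) \<inter> space M = (\<Union>z\<in>S. B n z)" by (auto simp: B_def)
      ultimately show ?thesis by simp
    qed
    have B_disj: "disjoint_family_on (B n) S" for n S
      using U(3)[of n] by (auto simp: disjoint_family_on_def B_def)
    define N where "N n = (\<Union>z\<in>{z. emeasure \<nu> (B n z) = 0}. B n z)" for n
    have "N n \<in> null_sets M" for n
    proof (rule null)
      show "emeasure \<nu> (N n) = 0"
        unfolding N_def by (rule disjoint_null_union[OF fin _ B_disj B_meas]) auto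
    qed (auto simp: N_def B_meas, auto simp: B_def)
    then have "(\<Union>n. N n) \<in> null_sets M" by auto
    moreover have "countable (\<Union>n. {z. emeasure \<nu> (B n z) \<noteq> 0})"
      using countable_positive_disjoint[OF fin _ B_disj B_meas] by auto
    moreover have "h ` (space M - (\<Union>n. N n))
        \<subseteq> (\<Union>z\<in>(\<Union>n. {z. emeasure \<nu> (B n z) \<noteq> 0}). Z.mball z (1 / real (Suc m)))"
    proof clarify
      fix x assume x: "x \<in> space M" "x \<notin> (\<Union>n. N n)"
      then obtain n z where nz: "h x \<in> U n z" using h U(4) by blast
      then have "x \<in> B n z" using x by (auto simp: B_def)
      then have "emeasure \<nu> (B n z) \<noteq> 0" using x by (auto simp: N_def)
      then show "h x \<in> (\<Union>z\<in>(\<Union>n. {z. emeasure \<nu> (B n z) \<noteq> 0}). Z.mball z (1 / real (Suc m)))"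
        using nz U(2)[of n z] by blast
    qed
    ultimately show ?thesis by blast
  qed
  then obtain N C where N: "\<And>m::nat. N m \<in> null_sets M" and C: "\<And>m. countable (C m)"
    "\<And>m. h ` (space M - N m) \<subseteq> (\<Union>z\<in>C m. Z.mball z (1 / real (Suc m)))"
    by metis
  have "(\<Union>m. N m) \<in> null_sets M" using N by auto
  moreover have "separable_space (subtopology Z.mtopology (h ` (space M - (\<Union>m. N m))))"
  proof (rule Z.separable_space_if_countable_nets)
    show "h ` (space M - (\<Union>m. N m)) \<subseteq> Z" using h by auto
    fix m
    have "h ` (space M - (\<Union>m. N m)) \<subseteq> h ` (space M - N m)" by auto
    then show "\<exists>C. countable C \<and> h ` (space M - (\<Union>m. N m)) \<subseteq> (\<Union>z\<in>C. Z.mball z (1 / real (Suc m)))"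
      using C(1)[of m] order_trans[OF _ C(2)[of m]] by (intro exI[of _ "C m"] conjI)
  qed
  ultimately show ?thesis by blast
qed

section \<open>Upper gradients from approximate upper gradients\<close>

lemma powr_midpoint_gap_decreasing:
  fixes p s t :: real
  assumes p: "1 < p" and st: "0 \<le> s" "s < t" "t \<le> 1"
  shows "(1 + t powr p) / 2 - ((1 + t) / 2) powr p < (1 + s powr p) / 2 - ((1 + s) / 2) powr p"
proof (rule DERIV_neg_imp_decreasing_open[OF st(2)])
  fix x assume x: "s < x" "x < t"
  then have "0 < x" "x < 1" using st by auto
  have "((\<lambda>x. (1 + x powr p) / 2 - ((1 + x) / 2) powr p) has_real_derivative
      p * x powr (p - 1) / 2 - p * ((1 + x) / 2) powr (p - 1) / 2) (at x)"
    using \<open>0 < x\<close> by (auto intro!: derivative_eq_intros simp: field_simps)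
  moreover have "x powr (p - 1) < ((1 + x) / 2) powr (p - 1)"
    using \<open>0 < x\<close> \<open>x < 1\<close> p by (intro powr_less_mono2) auto
  then have "p * x powr (p - 1) / 2 - p * ((1 + x) / 2) powr (p - 1) / 2 < 0"
    using p by simp
  ultimately show "\<exists>y. ((\<lambda>x. (1 + x powr p) / 2 - ((1 + x) / 2) powr p) has_real_derivative y) (at x) \<and> y < 0"
    by blast
next
  show "continuous_on {s..t} (\<lambda>x. (1 + x powr p) / 2 - ((1 + x) / 2) powr p)"
    using p st by (intro continuous_intros continuous_on_powr') auto
qed

text \<open>Rearranged, the increase of the \<open>p\<close>-th power is at most
  \<open>\<eta> * (a powr p + b powr p)\<close> plus \<open>C\<close> times the midpoint gap
  \<open>(a powr p + b powr p) / 2 - ((a + b) / 2) powr p\<close>. If \<open>a\<close> and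
  \<open>b\<close> are nearly equal, the first term suffices; otherwise the gap is bounded below.
  Homogeneity reduces to the case where the larger number is \<open>1\<close>. The midpoint term
  stays on the left because infinite values cannot be subtracted later.\<close>

lemma powr_uniformly_convex:
  fixes p \<eta> :: real
  assumes p: "1 < p" and \<eta>: "0 < \<eta>"
  shows "\<exists>C\<ge>0. \<forall>a\<ge>0. \<forall>b\<ge>0. max 0 (b powr p - a powr p) + C * ((a + b) / 2) powr p
    \<le> (\<eta> + C / 2) * (a powr p + b powr p)"
proof -
  let ?D = "\<lambda>t. (1 + t powr p) / 2 - ((1 + t) / 2) powr p"
  \<comment> \<open>For \<open>t\<^sub>0 \<le> t\<close> the difference \<open>1 - t powr p\<close>
    is at most \<eta>. Below \<open>t\<^sub>0\<close> the gap is at least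
    \<open>?D t\<^sub>0\<close>, and \<open>C\<close> is the reciprocal of this value.\<close>
  define t\<^sub>0 where "t\<^sub>0 = (max 0 (1 - \<eta>)) powr (1 / p)"
  have t0: "0 \<le> t\<^sub>0" "t\<^sub>0 powr p = max 0 (1 - \<eta>)" using p by (auto simp: t\<^sub>0_def powr_powr)
  have "t\<^sub>0 < 1"
  proof (rule ccontr)
    assume "\<not> t\<^sub>0 < 1"
    then have "1 \<le> t\<^sub>0 powr p" using p by (intro ge_one_powr_ge_zero) auto
    then show False using t0(2) \<eta> by (auto simp: max_def split: if_splits)
  qed
  then have D0: "0 < ?D t\<^sub>0" using powr_midpoint_gap_decreasing[OF p t0(1), of 1] by simp
  have D_nonneg: "0 \<le> ?D t" if "0 \<le> t" "t \<le> 1" for t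
    using powr_midpoint_gap_decreasing[OF p that(1), of 1] that by (cases "t = 1") auto
  define C where "C = 1 / ?D t\<^sub>0"
  have C: "0 \<le> C" "C * ?D t\<^sub>0 = 1" using D0 by (auto simp: C_def)
  have key: "1 - t powr p \<le> \<eta> * (1 + t powr p) + C * ?D t" if t: "0 \<le> t" "t \<le> 1" for t
  proof (cases "t\<^sub>0 \<le> t")
    case True
    then have "max 0 (1 - \<eta>) \<le> t powr p" using t0 p by (metis less_le_trans powr_mono2 zero_less_one less_imp_le)
    then have "1 - t powr p \<le> \<eta> * 1" by simp
    also have "\<dots> \<le> \<eta> * (1 + t powr p)" using \<eta> by (intro mult_left_mono) auto
    also have "\<dots> \<le> \<dots> + C * ?D t" using C D_nonneg[OF t] by simp
    finally show ?thesis .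
  next
    case False
    then have "?D t\<^sub>0 \<le> ?D t" using powr_midpoint_gap_decreasing[OF p t(1), of t\<^sub>0] \<open>t\<^sub>0 < 1\<close> by auto
    then have "1 \<le> C * ?D t" using C mult_left_mono[of "?D t\<^sub>0" "?D t" C] by simp
    moreover have "0 \<le> \<eta> * (1 + t powr p)" using \<eta> by simp
    moreover have "0 \<le> t powr p" by simp
    ultimately show ?thesis by linarith
  qed
  have homog: "(s * x) powr p = s powr p * x powr p" if "0 \<le> s" "0 \<le> x" for s x
    using that by (simp add: powr_mult)
  have "max 0 (b powr p - a powr p) + C * ((a + b) / 2) powr p \<le> (\<eta> + C / 2) * (a powr p + b powr p)"
    if ab: "0 \<le> a" "0 \<le> b" for a b
  proof -
    consider "b = 0" "a = 0" | "0 < b" "a \<le> b" | "0 < a" "b < a" using ab by linarith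
    then show ?thesis
    proof cases
      case 1
      then show ?thesis using p by simp
    next
      case 2
      define t where "t = a / b"
      have t: "0 \<le> t" "t \<le> 1" "a = b * t" using 2 ab by (auto simp: t_def)
      have mid: "(a + b) / 2 = b * ((1 + t) / 2)" using t(3) by (simp add: algebra_simps)
      have e: "((a + b) / 2) powr p = b powr p * ((1 + t) / 2) powr p" "a powr p = b powr p * t powr p"
        unfolding mid using t(1) 2(1) homog[of b "(1 + t) / 2"] homog[of b t] by (simp_all add: t(3))
      have "a powr p \<le> b powr p" using 2 ab p by (intro powr_mono2) auto
      then have "max 0 (b powr p - a powr p) + C * ((a + b) / 2) powr p
          = b powr p * ((1 - t powr p) + C * ((1 + t) / 2) powr p)"
        unfolding e by (simp add: algebra_simps)
      also have "\<dots> \<le> b powr p * ((\<eta> + C / 2) * (t powr p + 1))"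
        using key[OF t(1,2)] by (intro mult_left_mono) (auto simp: field_simps)
      also have "\<dots> = (\<eta> + C / 2) * (a powr p + b powr p)"
        unfolding e by (simp add: algebra_simps)
      finally show ?thesis .
    next
      case 3
      define t where "t = b / a"
      have t: "0 \<le> t" "t \<le> 1" "b = a * t" using 3 ab by (auto simp: t_def)
      have mid: "(a + b) / 2 = a * ((1 + t) / 2)" using t(3) by (simp add: algebra_simps)
      have e: "((a + b) / 2) powr p = a powr p * ((1 + t) / 2) powr p" "b powr p = a powr p * t powr p"
        unfolding mid using t(1) 3(1) homog[of a "(1 + t) / 2"] homog[of a t] by (simp_all add: t(3))
      have "b powr p \<le> a powr p" using 3 ab p by (intro powr_mono2) auto
      then have "max 0 (b powr p - a powr p) + C * ((a + b) / 2) powr p = a powr p * (C * ((1 + t) / 2) powr p)"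
        unfolding e(1) by (simp add: algebra_simps)
      also have "\<dots> \<le> a powr p * (C * ((1 + t powr p) / 2))"
        using D_nonneg[OF t(1,2)] C(1) by (intro mult_left_mono) auto
      also have "\<dots> \<le> a powr p * ((\<eta> + C / 2) * (1 + t powr p))"
        using \<eta> by (intro mult_left_mono) (auto simp: field_simps)
      also have "\<dots> = (\<eta> + C / 2) * (a powr p + b powr p)"
        unfolding e by (simp add: algebra_simps)
      finally show ?thesis .
    qed
  qed
  with C(1) show ?thesis by blast
qed

text \<open>Truncated subtraction is the positive part. For infinite arguments the right-hand side
  is infinite because \<open>\<eta> + C / 2\<close> is positive.\<close>

lemma epowr_uniformly_convex:
  fixes p \<eta> :: real
  assumes p: "1 < p" and \<eta>: "0 < \<eta>"
  shows "\<exists>C\<ge>0. \<forall>x y. (epowr y p - epowr x p) + ennreal C * epowr (ennreal (1 / 2) * (x + y)) p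
    \<le> ennreal (\<eta> + C / 2) * (epowr x p + epowr y p)"
proof -
  obtain C where C: "0 \<le> C" "\<And>a b. 0 \<le> a \<Longrightarrow> 0 \<le> b \<Longrightarrow>
      max 0 (b powr p - a powr p) + C * ((a + b) / 2) powr p \<le> (\<eta> + C / 2) * (a powr p + b powr p)"
    using powr_uniformly_convex[OF p \<eta>] by blast
  have "(epowr y p - epowr x p) + ennreal C * epowr (ennreal (1 / 2) * (x + y)) p
    \<le> ennreal (\<eta> + C / 2) * (epowr x p + epowr y p)" for x y
  proof (cases "x = top \<or> y = top")
    case True
    have "ennreal (\<eta> + C / 2) \<noteq> 0" using \<eta> C(1) by (simp add: add_pos_nonneg)
    with True show ?thesis by (auto simp: ennreal_mult_top)
  next
    case False
    then obtain a b where ab: "x = ennreal a" "y = ennreal b" "0 \<le> a" "0 \<le> b"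
      by (metis ennreal_cases)
    have mid: "ennreal (1 / 2) * (x + y) = ennreal ((a + b) / 2)"
      using ab by (simp del: ennreal_half flip: ennreal_plus ennreal_mult)
    have "epowr y p - epowr x p = ennreal (max 0 (b powr p - a powr p))"
      using ab by (simp add: epowr_ennreal ennreal_minus max_def ennreal_neg)
    moreover have "ennreal C * epowr (ennreal (1 / 2) * (x + y)) p = ennreal (C * ((a + b) / 2) powr p)"
      unfolding mid using ab C(1) by (simp add: epowr_ennreal ennreal_mult)
    moreover have "ennreal (\<eta> + C / 2) * (epowr x p + epowr y p)
        = ennreal ((\<eta> + C / 2) * (a powr p + b powr p))"
      using ab C(1) \<eta> by (simp add: epowr_ennreal ennreal_mult)
    ultimately show ?thesis
      using C(2)[OF ab(3,4)] C(1) by (simp flip: ennreal_plus add: ennreal_leI)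
  qed
  with C(1) show ?thesis by blast
qed

lemma ennreal_half_mult_two: "ennreal (1 / 2) * (x + x) = x"
proof (cases x)
  case (real r)
  then show ?thesis by (simp del: ennreal_half flip: ennreal_plus ennreal_mult)
qed (simp add: ennreal_mult_top)

section \<open>Exact upper gradients of almost minimal energy\<close>

context borel_subspace
begin

lemma line_integral_scaled_add:
  assumes f: "f \<in> borel_measurable M" "g \<in> borel_measurable M"
    and c: "rectifiable_curve a b \<gamma>" "\<gamma> ` {a..b} \<subseteq> space M"
  shows "line_integral (\<lambda>x. k * (f x + g x)) (a, b, \<gamma>)
    = k * (line_integral f (a, b, \<gamma>) + line_integral g (a, b, \<gamma>))"
proof -
  interpret rectifiable_curve a b \<gamma> by (rule c)
  obtain f' where f': "f' \<in> borel_measurable borel" "\<And>x. x \<in> space M \<Longrightarrow> f' x = f x"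
    using zero_extension[OF f(1)] by metis
  obtain g' where g': "g' \<in> borel_measurable borel" "\<And>x. x \<in> space M \<Longrightarrow> g' x = g x"
    using zero_extension[OF f(2)] by metis
  have "line_integral (\<lambda>x. f x + g x) (a, b, \<gamma>)
      = line_integral (\<lambda>x. \<Sum>i\<in>(UNIV::bool set). (if i then f' else g') x) (a, b, \<gamma>)"
    using c(2) f' g' by (intro line_integral_cong) (auto simp: UNIV_bool add.commute)
  also have "\<dots> = (\<Sum>i\<in>(UNIV::bool set). line_integral (if i then f' else g') (a, b, \<gamma>))"
    using f' g' by (intro line_integral_sum) auto
  also have "\<dots> = line_integral f' (a, b, \<gamma>) + line_integral g' (a, b, \<gamma>)"
    by (simp add: UNIV_bool add.commute)
  also have "\<dots> = line_integral f (a, b, \<gamma>) + line_integral g (a, b, \<gamma>)"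
    using c(2) f'(2) g'(2) by (intro arg_cong2[where f = "(+)"] line_integral_cong) auto
  finally show ?thesis
    using f c by (subst line_integral_cmult) auto
qed

text \<open>
  The sets \<open>S n\<close> of approximate upper gradients are convex and decreasing, so almost minimizers of
  the energy in \<open>S n\<close> are almost Cauchy by uniform convexity. The supremum of a fast subsequence
  is an upper gradient of almost minimal energy.
\<close>

lemma ex_upper_gradient_if_approximate:
  fixes D :: "real \<Rightarrow> real \<Rightarrow> (real \<Rightarrow> 'a) \<Rightarrow> ennreal"
  assumes p: "1 < p" and \<alpha>: "0 \<le> \<alpha>" and \<epsilon>: "0 < \<epsilon>"
    and approx: "\<And>e. 0 < e \<Longrightarrow> \<exists>g\<in>borel_measurable M. (\<integral>\<^sup>+ x. epowr (g x) p \<partial>M) \<le> ennreal (\<alpha> + e) \<and>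
      (\<forall>a b \<gamma>. rectifiable_curve a b \<gamma> \<longrightarrow> \<gamma> ` {a..b} \<subseteq> space M \<longrightarrow>
        D a b \<gamma> \<le> line_integral g (a, b, \<gamma>) + ennreal e)"
  shows "\<exists>h\<in>borel_measurable M. (\<integral>\<^sup>+ x. epowr (h x) p \<partial>M) \<le> ennreal (\<alpha> + \<epsilon>) \<and>
    (\<forall>a b \<gamma>. rectifiable_curve a b \<gamma> \<longrightarrow> \<gamma> ` {a..b} \<subseteq> space M \<longrightarrow> D a b \<gamma> \<le> line_integral h (a, b, \<gamma>))"
proof -
  have p_pos: "0 < p" using p by simp
  define I where "I f = (\<integral>\<^sup>+ x. epowr (f x) p \<partial>M)" for f :: "'a \<Rightarrow> ennreal"
  define S where "S n = {f \<in> borel_measurable M. \<forall>a b \<gamma>. rectifiable_curve a b \<gamma> \<longrightarrow> \<gamma> ` {a..b} \<subseteq> space M \<longrightarrow>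
      D a b \<gamma> \<le> line_integral f (a, b, \<gamma>) + ennreal ((1 / 2) ^ n)}" for n
  have S_meas [measurable]: "f \<in> S n \<Longrightarrow> f \<in> borel_measurable M" for f n
    by (simp add: S_def)
  have S_dec: "S k \<subseteq> S n" if "n \<le> k" for n k
  proof -
    have "ennreal ((1 / 2) ^ k) \<le> ennreal ((1 / 2) ^ n)"
      using that by (intro ennreal_leI power_decreasing) auto
    then show ?thesis
      unfolding S_def by (blast intro: order_trans add_left_mono)
  qed
  \<comment> \<open>Averaging preserves the additive error, so the midpoint of two members competes
    in the infimum over the same set.\<close>
  have S_mid: "(\<lambda>x. ennreal (1 / 2) * (f x + g x)) \<in> S n" if fg: "f \<in> S n" "g \<in> S n" for f g n
    unfolding S_def
  proof (intro CollectI conjI allI impI)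
    show "(\<lambda>x. ennreal (1 / 2) * (f x + g x)) \<in> borel_measurable M"
      using fg by measurable
    fix a b \<gamma> assume c: "rectifiable_curve a b \<gamma>" "\<gamma> ` {a..b} \<subseteq> space M"
    let ?e = "ennreal ((1 / 2) ^ n)"
    have Df: "D a b \<gamma> \<le> line_integral f (a, b, \<gamma>) + ?e" and Dg: "D a b \<gamma> \<le> line_integral g (a, b, \<gamma>) + ?e"
      using fg c unfolding S_def by blast+
    have "D a b \<gamma> = ennreal (1 / 2) * (D a b \<gamma> + D a b \<gamma>)"
      by (simp only: ennreal_half_mult_two)
    also have "\<dots> \<le> ennreal (1 / 2) *
        ((line_integral f (a, b, \<gamma>) + ?e) + (line_integral g (a, b, \<gamma>) + ?e))"
      using add_mono[OF Df Dg] by (rule mult_left_mono) simp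
    also have "\<dots> = ennreal (1 / 2) * (line_integral f (a, b, \<gamma>) + line_integral g (a, b, \<gamma>))
        + ennreal (1 / 2) * (?e + ?e)"
      by (simp only: distrib_left ac_simps)
    also have "\<dots> = line_integral (\<lambda>x. ennreal (1 / 2) * (f x + g x)) (a, b, \<gamma>) + ?e"
      using fg c by (simp only: ennreal_half_mult_two line_integral_scaled_add[OF S_meas S_meas c])
    finally show "D a b \<gamma> \<le> line_integral (\<lambda>x. ennreal (1 / 2) * (f x + g x)) (a, b, \<gamma>) + ?e" .
  qed
  define \<mu> where "\<mu> n = (INF f\<in>S n. I f)" for n
  have \<mu>_le: "\<mu> n \<le> ennreal \<alpha>" for n
  proof (rule ennreal_le_epsilon)
    fix e :: real assume "0 < e"
    define e' where "e' = min e ((1 / 2) ^ n)"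
    have "0 < e'" using \<open>0 < e\<close> by (simp add: e'_def)
    from approx[OF this] obtain g where g: "g \<in> borel_measurable M" "I g \<le> ennreal (\<alpha> + e')"
      "\<And>a b \<gamma>. rectifiable_curve a b \<gamma> \<Longrightarrow> \<gamma> ` {a..b} \<subseteq> space M \<Longrightarrow>
        D a b \<gamma> \<le> line_integral g (a, b, \<gamma>) + ennreal e'"
      unfolding I_def by blast
    have "ennreal e' \<le> ennreal ((1 / 2) ^ n)" by (intro ennreal_leI) (simp add: e'_def)
    then have "g \<in> S n" unfolding S_def using g(1,3) by (blast intro: order_trans add_left_mono)
    then have "\<mu> n \<le> I g" unfolding \<mu>_def by (rule INF_lower)
    also have "\<dots> \<le> ennreal (\<alpha> + e')" by (rule g(2))
    also have "\<dots> \<le> ennreal \<alpha> + ennreal e"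
      using \<alpha> \<open>0 < e\<close> by (simp add: e'_def flip: ennreal_plus)
    finally show "\<mu> n \<le> ennreal \<alpha> + ennreal e" .
  qed
  define m where "m n = enn2real (\<mu> n)" for n
  have \<mu>_eq: "\<mu> n = ennreal (m n)" for n
  proof -
    have "\<mu> n < top" using \<mu>_le[of n] ennreal_less_top by (rule le_less_trans)
    then show ?thesis by (simp add: m_def)
  qed
  have m: "0 \<le> m n" "m n \<le> \<alpha>" for n
    using \<mu>_le[of n] \<alpha> by (auto simp: m_def enn2real_leI)
  have m_mono: "m n \<le> m k" if "n \<le> k" for n k
  proof -
    have "\<mu> n \<le> \<mu> k" unfolding \<mu>_def using S_dec[OF that] by (intro INF_superset_mono) auto
    then show ?thesis using m by (simp add: \<mu>_eq)
  qed
  have "\<exists>f\<in>S n. I f < ennreal (m n + (1 / 2) ^ n)" for n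
  proof -
    have "\<mu> n < ennreal (m n + (1 / 2) ^ n)"
      using m(1)[of n] by (simp add: \<mu>_eq ennreal_less_iff)
    then show ?thesis by (simp add: \<mu>_def INF_less_iff)
  qed
  then obtain f where f: "\<And>n. f n \<in> S n" "\<And>n. I (f n) < ennreal (m n + (1 / 2) ^ n)"
    by metis
  have fm [measurable]: "f n \<in> borel_measurable M" for n using f(1) by (rule S_meas)
  \<comment> \<open>Only increases of the energy density are measured, because these are what a
    supremum adds.\<close>
  define \<Delta> where "\<Delta> n k = (\<integral>\<^sup>+ x. epowr (f k x) p - epowr (f n x) p \<partial>M)" for n k
  obtain l where l: "m \<longlonglongrightarrow> l" "\<And>n. m n \<le> l"
    using incseq_convergent[of m \<alpha>] m(2) m_mono by (auto simp: incseq_def)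
  have l0: "0 \<le> l" using m(1)[of 0] l(2)[of 0] by linarith
  have cauchy: "\<exists>N. \<forall>n\<ge>N. \<forall>k\<ge>n. \<Delta> n k \<le> ennreal \<tau>" if "0 < \<tau>" for \<tau>
  proof -
    \<comment> \<open>This splits the tolerance: \<open>2 * \<eta> * (l + 1)\<close> uses one half
      of \<tau>, and the term with \<open>C\<close> fits into the other half once \<open>m n\<close>
      is close to \<open>l\<close>.\<close>
    define \<eta> where "\<eta> = \<tau> / (4 * (l + 1))"
    have \<eta>: "0 < \<eta>" "2 * \<eta> * (l + 1) = \<tau> / 2" using \<open>0 < \<tau>\<close> l0 by (auto simp: \<eta>_def field_simps)
    obtain C where C: "0 \<le> C" "\<And>x y. (epowr y p - epowr x p) + ennreal C * epowr (ennreal (1 / 2) * (x + y)) p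
        \<le> ennreal (\<eta> + C / 2) * (epowr x p + epowr y p)"
      using epowr_uniformly_convex[OF p \<eta>(1)] by blast
    have "(\<lambda>n. C * (l - m n + (1 / 2) ^ n)) \<longlonglongrightarrow> C * (l - l + 0)"
      by (intro tendsto_intros l(1) LIMSEQ_realpow_zero) auto
    then have "\<forall>\<^sub>F n in sequentially. C * (l - m n + (1 / 2) ^ n) < \<tau> / 2"
      using \<open>0 < \<tau>\<close> by (intro order_tendstoD(2)) auto
    then obtain N where N: "\<And>n. N \<le> n \<Longrightarrow> C * (l - m n + (1 / 2) ^ n) < \<tau> / 2"
      by (auto simp: eventually_sequentially)
    have "\<Delta> n k \<le> ennreal \<tau>" if nk: "N \<le> n" "n \<le> k" for n k
    proof -
      let ?mid = "\<lambda>x. ennreal (1 / 2) * (f n x + f k x)"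
      \<comment> \<open>The midpoint lies in \<open>S n\<close>, so its energy is at least
        \<open>m n\<close>; convexity then leaves no room for a large
        \<open>\<Delta> n k\<close>.\<close>
      have "\<mu> n \<le> I ?mid"
        unfolding \<mu>_def using f(1) S_dec[OF nk(2)] by (intro INF_lower S_mid) auto
      then have "\<Delta> n k + ennreal C * ennreal (m n) \<le> \<Delta> n k + ennreal C * I ?mid"
        by (intro add_left_mono mult_left_mono) (auto simp: \<mu>_eq)
      also have "\<dots> = (\<integral>\<^sup>+ x. (epowr (f k x) p - epowr (f n x) p) + ennreal C * epowr (?mid x) p \<partial>M)"
        unfolding \<Delta>_def I_def by (simp add: nn_integral_add nn_integral_cmult)
      also have "\<dots> \<le> (\<integral>\<^sup>+ x. ennreal (\<eta> + C / 2) * (epowr (f n x) p + epowr (f k x) p) \<partial>M)"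
        by (intro nn_integral_mono C(2))
      also have "\<dots> = ennreal (\<eta> + C / 2) * (I (f n) + I (f k))"
        unfolding I_def by (simp add: nn_integral_add nn_integral_cmult)
      also have "\<dots> \<le> ennreal (\<eta> + C / 2) * (ennreal (l + (1 / 2) ^ n) + ennreal (l + (1 / 2) ^ n))"
      proof (intro mult_left_mono add_mono)
        have "m n + (1 / 2) ^ n \<le> l + (1 / 2) ^ n" using l(2) by simp
        then show "I (f n) \<le> ennreal (l + (1 / 2) ^ n)"
          using f(2)[of n] by (meson ennreal_leI less_imp_le order_trans)
        have "m k + (1 / 2) ^ k \<le> l + (1 / 2) ^ n"
          using l(2) nk(2) by (intro add_mono power_decreasing) auto
        then show "I (f k) \<le> ennreal (l + (1 / 2) ^ n)"
          using f(2)[of k] by (meson ennreal_leI less_imp_le order_trans)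
      qed auto
      also have "\<dots> = ennreal ((\<eta> + C / 2) * (2 * (l + (1 / 2) ^ n)))"
        using l0 \<eta>(1) C(1) by (simp flip: ennreal_plus ennreal_mult)
      finally have le: "\<Delta> n k + ennreal C * ennreal (m n) \<le> ennreal ((\<eta> + C / 2) * (2 * (l + (1 / 2) ^ n)))" .
      then have "\<Delta> n k < top" by (auto simp: less_top[symmetric] top_unique)
      then obtain \<delta> where \<delta>: "\<Delta> n k = ennreal \<delta>" "0 \<le> \<delta>" by (cases "\<Delta> n k") auto
      have "\<delta> + C * m n \<le> (\<eta> + C / 2) * (2 * (l + (1 / 2) ^ n))"
        using le \<delta> C(1) m(1)[of n] \<eta>(1) l0 by (simp flip: ennreal_mult ennreal_plus)
      then have "\<delta> \<le> 2 * \<eta> * (l + (1 / 2) ^ n) + C * (l - m n + (1 / 2) ^ n)"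
        by (simp add: algebra_simps)
      also have "2 * \<eta> * (l + (1 / 2) ^ n) \<le> 2 * \<eta> * (l + 1)"
        using \<eta>(1) by (intro mult_left_mono add_left_mono power_le_one) auto
      finally have "\<delta> \<le> \<tau>" using N[OF nk(1)] \<eta>(2) by linarith
      then show ?thesis by (simp add: \<delta> ennreal_leI)
    qed
    then show ?thesis by blast
  qed
  have "\<forall>j. \<exists>N. \<forall>n\<ge>N. \<forall>k\<ge>n. \<Delta> n k \<le> ennreal (\<epsilon> / 4 * (1 / 2) ^ j)"
    using \<epsilon> by (intro allI cauchy) simp
  then obtain N where N: "\<And>j n k. N j \<le> n \<Longrightarrow> n \<le> k \<Longrightarrow> \<Delta> n k \<le> ennreal (\<epsilon> / 4 * (1 / 2) ^ j)"
    by metis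
  obtain n\<^sub>0 where n0: "(1 / 2) ^ n\<^sub>0 < \<epsilon> / 2" using real_arch_pow_inv[of "\<epsilon> / 2" "1 / 2"] \<epsilon> by auto
  \<comment> \<open>The start is late enough for the first function to exceed \<alpha> by at most
    \<open>\<epsilon> / 2\<close>; the increases along the subsequence sum to at most the other
    half.\<close>
  define r where "r = rec_nat (max n\<^sub>0 (N 0)) (\<lambda>j k. max (N (Suc j)) (Suc k))"
  have r_0: "r 0 = max n\<^sub>0 (N 0)" and r_Suc: "r (Suc j) = max (N (Suc j)) (Suc (r j))" for j
    by (auto simp: r_def)
  have r_N: "N j \<le> r j" for j by (cases j) (auto simp: r_0 r_Suc)
  have r_ge: "j \<le> r j" for j
  proof (induction j)
    case (Suc j)
    then show ?case by (simp add: r_Suc)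
  qed simp
  define h where "h x = (SUP j. f (r j) x)" for x
  have hm: "h \<in> borel_measurable M" unfolding h_def by measurable
  have "I h \<le> ennreal (\<alpha> + \<epsilon>)"
  proof -
    let ?F = "\<lambda>j x. epowr (f (r j) x) p"
    \<comment> \<open>Telescoping with truncated differences bounds every member, and hence the
      supremum, by the first density plus all increases.\<close>
    have F_le: "?F j x \<le> ?F 0 x + (\<Sum>i<j. ?F (Suc i) x - ?F i x)" for j x
    proof (induction j)
      case (Suc j)
      have "?F (Suc j) x \<le> ?F j x + (?F (Suc j) x - ?F j x)"
        by (simp add: add_diff_self_ennreal not_le less_imp_le)
      also have "\<dots> \<le> ?F 0 x + (\<Sum>i<j. ?F (Suc i) x - ?F i x) + (?F (Suc j) x - ?F j x)"
        by (intro add_right_mono Suc)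
      finally show ?case by (simp add: add.assoc)
    qed simp
    have "I h = (\<integral>\<^sup>+ x. (SUP j. ?F j x) \<partial>M)"
      unfolding I_def h_def using p_pos by (simp add: epowr_SUP)
    also have "\<dots> \<le> (\<integral>\<^sup>+ x. ?F 0 x + (\<Sum>i. ?F (Suc i) x - ?F i x) \<partial>M)"
    proof (intro nn_integral_mono SUP_least)
      fix x j
      have "?F j x \<le> ?F 0 x + (\<Sum>i<j. ?F (Suc i) x - ?F i x)" by (rule F_le)
      also have "\<dots> \<le> ?F 0 x + (\<Sum>i. ?F (Suc i) x - ?F i x)"
        by (intro add_left_mono sum_le_suminf) auto
      finally show "?F j x \<le> ?F 0 x + (\<Sum>i. ?F (Suc i) x - ?F i x)" .
    qed
    also have "\<dots> = I (f (r 0)) + (\<Sum>i. \<Delta> (r i) (r (Suc i)))"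
      unfolding I_def \<Delta>_def by (subst nn_integral_add, measurable) (simp add: nn_integral_suminf)
    also have "\<dots> \<le> ennreal (\<alpha> + \<epsilon> / 2) + (\<Sum>i. ennreal (\<epsilon> / 4 * (1 / 2) ^ i))"
    proof (intro add_mono suminf_le)
      have "(1 / 2 :: real) ^ r 0 \<le> (1 / 2) ^ n\<^sub>0" by (intro power_decreasing) (auto simp: r_0)
      then have "m (r 0) + (1 / 2) ^ r 0 \<le> \<alpha> + \<epsilon> / 2" using m(2)[of "r 0"] n0 by linarith
      then show "I (f (r 0)) \<le> ennreal (\<alpha> + \<epsilon> / 2)"
        using f(2)[of "r 0"] by (meson ennreal_leI less_imp_le order_trans)
      fix i show "\<Delta> (r i) (r (Suc i)) \<le> ennreal (\<epsilon> / 4 * (1 / 2) ^ i)"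
        by (rule N[OF r_N]) (simp add: r_Suc)
    qed auto
    also have "(\<Sum>i. ennreal (\<epsilon> / 4 * (1 / 2) ^ i)) = ennreal (\<epsilon> / 4 * 2)"
      using \<epsilon> sums_mult[OF geometric_sums[of "1 / 2 :: real"], of "\<epsilon> / 4"]
      by (intro suminf_ennreal_eq) auto
    also have "ennreal (\<alpha> + \<epsilon> / 2) + ennreal (\<epsilon> / 4 * 2) = ennreal (\<alpha> + \<epsilon>)"
      using \<alpha> \<epsilon> by (simp flip: ennreal_plus)
    finally show ?thesis .
  qed
  moreover have "D a b \<gamma> \<le> line_integral h (a, b, \<gamma>)"
    if c: "rectifiable_curve a b \<gamma>" "\<gamma> ` {a..b} \<subseteq> space M" for a b \<gamma>
  proof (rule ennreal_le_epsilon)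
    fix e :: real assume "0 < e"
    then obtain j where j: "(1 / 2) ^ j < e" using real_arch_pow_inv[of e "1 / 2"] by auto
    have "D a b \<gamma> \<le> line_integral (f (r j)) (a, b, \<gamma>) + ennreal ((1 / 2) ^ r j)"
      using f(1)[of "r j"] c unfolding S_def by blast
    also have "\<dots> \<le> line_integral h (a, b, \<gamma>) + ennreal e"
    proof (intro add_mono ennreal_leI)
      show "line_integral (f (r j)) (a, b, \<gamma>) \<le> line_integral h (a, b, \<gamma>)"
        unfolding h_def by (rule rectifiable_curve.line_integral_mono[OF c(1)]) (auto intro: SUP_upper)
      have "(1 / 2 :: real) ^ r j \<le> (1 / 2) ^ j" using r_ge by (intro power_decreasing) auto
      then show "(1 / 2) ^ r j \<le> e" using j by linarith
    qed
    finally show "D a b \<gamma> \<le> line_integral h (a, b, \<gamma>) + ennreal e" .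
  qed
  ultimately show ?thesis using hm unfolding I_def by blast
qed

end

text \<open>The curve is cut at points whose images have distance \<open>n * \<delta>\<close> from
  the initial image. The ends of each piece then have images at least \<delta> apart, so the piece
  contributes at least \<open>1\<close>; the last incomplete step accounts for the error
  \<delta>.\<close>

lemma (in rectifiable_curve) dist_image_le_line_integral:
  fixes \<phi> :: "'a \<Rightarrow> 'b::metric_space"
  assumes \<phi>: "continuous_on UNIV \<phi>" and \<rho>: "\<rho> \<in> borel_measurable borel" and \<delta>: "0 < \<delta>"
    and adm: "\<And>s t. a \<le> s \<Longrightarrow> s \<le> t \<Longrightarrow> t \<le> b \<Longrightarrow> \<delta> \<le> dist (\<phi> (\<gamma> s)) (\<phi> (\<gamma> t)) \<Longrightarrow>
      1 \<le> line_integral \<rho> (s, t, \<gamma>)"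
  shows "ennreal (dist (\<phi> (\<gamma> a)) (\<phi> (\<gamma> b))) \<le> ennreal \<delta> * line_integral \<rho> (a, b, \<gamma>) + ennreal \<delta>"
proof -
  let ?f = "\<lambda>t. dist (\<phi> (\<gamma> a)) (\<phi> (\<gamma> t))"
  have cont_f: "continuous_on {a..b} ?f"
    using continuous_on_compose[OF cont continuous_on_subset[OF \<phi>]] by (intro continuous_intros) (simp add: o_def)
  have *: "a \<le> t \<Longrightarrow> t \<le> b \<Longrightarrow> real n * \<delta> \<le> ?f t \<Longrightarrow> of_nat n \<le> line_integral \<rho> (a, t, \<gamma>)" for n t
  proof (induction n arbitrary: t)
    case (Suc n)
    have "real n * \<delta> \<le> real (Suc n) * \<delta>" using \<delta> by (intro mult_right_mono) auto
    then have "real n * \<delta> \<le> ?f t" using Suc.prems(3) by linarith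
    then have "\<exists>s\<ge>a. s \<le> t \<and> ?f s = real n * \<delta>"
      using Suc.prems \<delta> by (intro IVT' continuous_on_subset[OF cont_f]) auto
    then obtain s where s: "a \<le> s" "s \<le> t" "?f s = real n * \<delta>" by auto
    interpret T: rectifiable_curve a t \<gamma> using Suc.prems by (intro subcurve) auto
    have "\<delta> \<le> dist (\<phi> (\<gamma> s)) (\<phi> (\<gamma> t))"
      using Suc.prems(3) s(3) dist_triangle[of "\<phi> (\<gamma> a)" "\<phi> (\<gamma> t)" "\<phi> (\<gamma> s)"] by (simp add: algebra_simps)
    then have "of_nat n + 1 \<le> line_integral \<rho> (a, s, \<gamma>) + line_integral \<rho> (s, t, \<gamma>)"
      using s Suc.prems by (intro add_mono Suc.IH adm) auto
    also have "\<dots> = line_integral \<rho> (a, t, \<gamma>)"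
      using T.line_integral_add[OF \<rho> s(1,2)] by simp
    finally show ?case by (simp add: add.commute)
  qed simp
  define n where "n = nat \<lfloor>?f b / \<delta>\<rfloor>"
  have "real n \<le> ?f b / \<delta>" "?f b / \<delta> < real n + 1"
    using \<delta> by (auto simp: n_def)
  then have n: "real n * \<delta> \<le> ?f b" "?f b \<le> \<delta> * real n + \<delta>"
    using \<delta> by (auto simp: field_simps)
  have "ennreal (?f b) \<le> ennreal (\<delta> * real n + \<delta>)" using n(2) by (rule ennreal_leI)
  also have "\<dots> = ennreal \<delta> * of_nat n + ennreal \<delta>"
    using \<delta> by (simp add: ennreal_mult ennreal_of_nat_eq_real_of_nat)
  also have "\<dots> \<le> ennreal \<delta> * line_integral \<rho> (a, b, \<gamma>) + ennreal \<delta>"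
    using *[OF le order_refl n(1)] by (intro add_right_mono mult_left_mono) auto
  finally show ?thesis .
qed

section \<open>Maps of bounded outer dilatation\<close>

lemma metric_measure_space_borel_subspace:
  fixes M :: "'a::polish_space measure"
  assumes M: "metric_measure_space M"
  shows "borel_subspace M" and "space M = UNIV"
proof -
  have sets: "sets M = sets borel" and fin: "\<And>B. B \<in> sets M \<Longrightarrow> bounded B \<Longrightarrow> emeasure M B < \<infinity>"
    using M by (auto simp: metric_measure_space_def)
  show sp: "space M = UNIV" using sets_eq_imp_space_eq[OF sets] by simp
  interpret sigma_finite_measure M
  proof
    have "x \<in> \<Union>(range (\<lambda>n. ball undefined (real n)))" for x :: 'a
    proof -
      obtain n :: nat where "dist undefined x < real n" using reals_Archimedean2 by blast
      then show ?thesis by auto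
    qed
    then show "\<exists>A. countable A \<and> A \<subseteq> sets M \<and> \<Union>A = space M \<and> (\<forall>a\<in>A. emeasure M a \<noteq> \<infinity>)"
      using fin by (intro exI[of _ "range (\<lambda>n. ball undefined (real n))"]) (auto simp: sp sets less_top)
  qed
  show "borel_subspace M"
    by unfold_locales (auto simp: sp sets sets_restrict_space)
qed

locale dilatation_setting = X: borel_subspace \<mu>\<^sub>X + Y: borel_subspace \<mu>\<^sub>Y
  for \<mu>\<^sub>X :: "'a::polish_space measure" and \<mu>\<^sub>Y :: "'b::polish_space measure" +
  fixes \<phi> :: "'a \<Rightarrow> 'b" and p K :: real
  assumes space_X [simp]: "space \<mu>\<^sub>X = UNIV" and space_Y [simp]: "space \<mu>\<^sub>Y = UNIV"
    and finite_on_bounded: "\<And>B. B \<in> sets borel \<Longrightarrow> bounded B \<Longrightarrow> emeasure \<mu>\<^sub>Y B < \<infinity>"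
    and cont_\<phi>: "continuous_on UNIV \<phi>" and p: "1 < p" and K: "0 \<le> K"
begin

lemma sets_X [simp, measurable_cong]: "sets \<mu>\<^sub>X = sets borel"
  using X.sets_eq by (simp add: sets_restrict_space)

lemma sets_Y [simp, measurable_cong]: "sets \<mu>\<^sub>Y = sets borel"
  using Y.sets_eq by (simp add: sets_restrict_space)

lemma borel_measurable_X [simp]: "borel_measurable \<mu>\<^sub>X = borel_measurable borel"
  by (rule measurable_cong_sets) simp_all

lemma borel_measurable_Y [simp]: "borel_measurable \<mu>\<^sub>Y = borel_measurable borel"
  by (rule measurable_cong_sets) simp_all

lemma p_pos: "0 < p"
  using p by simp

lemma measurable_\<phi> [measurable]: "\<phi> \<in> borel_measurable borel"
  using cont_\<phi> by (simp add: borel_measurable_continuous_onI)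

lemma vimage_borel: "\<Omega> \<in> sets borel \<Longrightarrow> \<phi> -` \<Omega> \<in> sets borel"
  using measurable_sets[OF measurable_\<phi>] by simp

lemma vimage_open: "open V \<Longrightarrow> open (\<phi> -` V)"
  using cont_\<phi> by (simp add: open_vimage)

definition preimage_measure :: "'b set \<Rightarrow> 'a measure" where
  "preimage_measure \<Omega> = restrict_space \<mu>\<^sub>X (\<phi> -` \<Omega>)"

lemma space_preimage_measure [simp]: "space (preimage_measure \<Omega>) = \<phi> -` \<Omega>"
  by (simp add: preimage_measure_def space_restrict_space)

lemma borel_subspace_preimage: "\<Omega> \<in> sets borel \<Longrightarrow> borel_subspace (preimage_measure \<Omega>)"
  unfolding preimage_measure_def by (intro X.restrict vimage_borel)

lemma nn_integral_preimage:
  "\<Omega> \<in> sets borel \<Longrightarrow> (\<integral>\<^sup>+ x. f x \<partial>preimage_measure \<Omega>) = (\<integral>\<^sup>+ x. f x * indicator \<Omega> (\<phi> x) \<partial>\<mu>\<^sub>X)"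
  unfolding preimage_measure_def
  by (subst nn_integral_restrict_space) (auto simp: vimage_borel intro!: nn_integral_cong split: split_indicator)

lemma AE_preimage:
  "\<Omega> \<in> sets borel \<Longrightarrow> (AE x in preimage_measure \<Omega>. P x) \<longleftrightarrow> (AE x in \<mu>\<^sub>X. \<phi> x \<in> \<Omega> \<longrightarrow> P x)"
  unfolding preimage_measure_def by (subst AE_restrict_space_iff) (auto simp: vimage_borel)

lemma restrict_preimage:
  assumes "\<Omega> \<in> sets borel" "V \<in> sets borel" "V \<subseteq> \<Omega>"
  shows "restrict_space (preimage_measure \<Omega>) (\<phi> -` V) = preimage_measure V"
proof -
  have "\<phi> -` \<Omega> \<inter> \<phi> -` V = \<phi> -` V" using assms(3) by auto
  then show ?thesis
    using assms(1,2) by (simp add: preimage_measure_def restrict_restrict_space vimage_borel)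
qed

text \<open>Equivalently, the image under \<phi> of the measure with density
  \<open>epowr (\<rho> x) p\<close> is at most \<open>K\<close> times \<open>\<mu>\<^sub>Y\<close>.
  In this form the bound extends from sets to nonnegative functions.\<close>

definition energy_bound :: "('a \<Rightarrow> ennreal) \<Rightarrow> bool" where
  "energy_bound \<rho> \<longleftrightarrow> (\<forall>E\<in>sets borel.
     (\<integral>\<^sup>+ x. indicator E (\<phi> x) * epowr (\<rho> x) p \<partial>\<mu>\<^sub>X) \<le> ennreal K * emeasure \<mu>\<^sub>Y E)"

lemma energy_bound_nn_integral:
  assumes bound: "energy_bound \<rho>" and [measurable]: "\<rho> \<in> borel_measurable borel" "f \<in> borel_measurable borel"
  shows "(\<integral>\<^sup>+ x. f (\<phi> x) * epowr (\<rho> x) p \<partial>\<mu>\<^sub>X) \<le> ennreal K * (\<integral>\<^sup>+ y. f y \<partial>\<mu>\<^sub>Y)"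
proof -
  let ?\<nu> = "distr (density \<mu>\<^sub>X (\<lambda>x. epowr (\<rho> x) p)) borel \<phi>" and ?\<mu> = "density \<mu>\<^sub>Y (\<lambda>_. ennreal K)"
  have "?\<nu> \<le> ?\<mu>"
    unfolding le_measure_iff
  proof (simp add: le_fun_def, rule allI)
    fix E
    show "emeasure ?\<nu> E \<le> emeasure ?\<mu> E"
    proof (cases "E \<in> sets borel")
      case True
      then have "emeasure ?\<nu> E = (\<integral>\<^sup>+ x. indicator E (\<phi> x) * epowr (\<rho> x) p \<partial>\<mu>\<^sub>X)"
        by (subst emeasure_distr)
          (auto simp: emeasure_density vimage_borel ac_simps split: split_indicator intro!: nn_integral_cong)
      also have "\<dots> \<le> emeasure ?\<mu> E"
        using bound True by (simp add: energy_bound_def emeasure_density_const)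
      finally show ?thesis .
    qed (simp add: emeasure_notin_sets)
  qed
  then have "(\<integral>\<^sup>+ y. f y \<partial>?\<nu>) \<le> (\<integral>\<^sup>+ y. f y \<partial>?\<mu>)"
    by (intro nn_integral_mono_measure) auto
  then show ?thesis
    by (simp add: nn_integral_distr nn_integral_density nn_integral_cmult ac_simps)
qed

text \<open>The exceptional family depends on \<open>g\<close> alone and not on \<rho>, so one
  weight serves all functions on \<open>Y\<close> simultaneously.\<close>

lemma almost_all_curves_line_integral_image:
  assumes g: "g \<in> UG_loc p \<mu>\<^sub>X dist \<phi>"
  shows "almost_all_curves p \<mu>\<^sub>X (\<lambda>a b \<gamma>. rectifiable_curve a b (\<phi> \<circ> \<gamma>) \<and>
    (\<forall>\<rho>\<in>borel_measurable borel. line_integral \<rho> (a, b, \<phi> \<circ> \<gamma>) \<le> line_integral (\<lambda>x. \<rho> (\<phi> x) * g x) (a, b, \<gamma>)))"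
proof (rule almost_all_curves_mono[OF X.UG_loc_almost_all_curves[OF p_pos g]])
  fix a b \<gamma> assume c: "rectifiable_curve a b \<gamma>"
    and *: "line_integral g (a, b, \<gamma>) < \<infinity> \<and>
      (\<forall>s t. a \<le> s \<longrightarrow> s \<le> t \<longrightarrow> t \<le> b \<longrightarrow> curve_ug dist \<phi> g s t \<gamma>)"
  interpret rectifiable_curve a b \<gamma> by (rule c)
  have gm: "g \<in> borel_measurable borel"
    using g by (auto simp: UG_loc_def weak_upper_gradient_def)
  have fin: "line_integral g (a, b, \<gamma>) < \<infinity>" using * by simp
  have ug: "ennreal (dist (\<phi> (\<gamma> s)) (\<phi> (\<gamma> t))) \<le> line_integral g (s, t, \<gamma>)"
    if "a \<le> s" "s \<le> t" "t \<le> b" for s t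
    using * that by (simp add: dist_commute)
  show "rectifiable_curve a b (\<phi> \<circ> \<gamma>) \<and>
    (\<forall>\<rho>\<in>borel_measurable borel. line_integral \<rho> (a, b, \<phi> \<circ> \<gamma>) \<le> line_integral (\<lambda>x. \<rho> (\<phi> x) * g x) (a, b, \<gamma>))"
    using rectifiable_image[OF cont_\<phi> gm fin ug] line_integral_image_le[OF cont_\<phi> gm fin ug] by blast
qed

text \<open>For \<rho> admissible on the image family, \<open>\<rho> (\<phi> x) * g x\<close> has
  integral at least \<open>1\<close> over every curve obeying the chain rule, and the energy bound
  controls its energy by that of \<rho>.\<close>

lemma outer_dilatation_le_if_energy_bound:
  assumes g: "g \<in> UG_loc p \<mu>\<^sub>X dist \<phi>" and bound: "energy_bound g"
  shows "outer_dilatation_le p \<mu>\<^sub>X \<mu>\<^sub>Y \<phi> K"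
  unfolding outer_dilatation_le_def
  disj_imp
proof (intro allI impI)
  fix \<Gamma> :: "'a curve set" assume \<Gamma>: "\<Gamma> \<subseteq> curves (space \<mu>\<^sub>X)"
    and finite: "modulus p \<mu>\<^sub>Y (curve_map \<phi> ` \<Gamma>) \<noteq> \<infinity>"
  have gm [measurable]: "g \<in> borel_measurable borel"
    using g by (auto simp: UG_loc_def weak_upper_gradient_def)
  obtain \<tau> where \<tau> [measurable]: "\<tau> \<in> borel_measurable borel" and \<tau>_fin: "(\<integral>\<^sup>+ x. epowr (\<tau> x) p \<partial>\<mu>\<^sub>X) < \<infinity>"
    and chain: "\<And>a b \<gamma> \<rho>. rectifiable_curve a b \<gamma> \<Longrightarrow> line_integral \<tau> (a, b, \<gamma>) < \<infinity> \<Longrightarrow>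
      rectifiable_curve a b (\<phi> \<circ> \<gamma>) \<and> (\<rho> \<in> borel_measurable borel \<longrightarrow>
        line_integral \<rho> (a, b, \<phi> \<circ> \<gamma>) \<le> line_integral (\<lambda>x. \<rho> (\<phi> x) * g x) (a, b, \<gamma>))"
    using almost_all_curves_line_integral_image[OF g] by (auto simp: almost_all_curves_def p_integrable_def)
  have mod_le: "modulus p \<mu>\<^sub>X \<Gamma> \<le> ennreal K * (\<integral>\<^sup>+ y. epowr (\<rho> y) p \<partial>\<mu>\<^sub>Y)"
    if \<rho>: "\<rho> \<in> admissible \<mu>\<^sub>Y (curve_map \<phi> ` \<Gamma>)" for \<rho>
  proof (rule ennreal_le_epsilon)
    fix e :: real assume "0 < e"
    have \<rho>m [measurable]: "\<rho> \<in> borel_measurable borel" using \<rho> by (auto simp: admissible_def)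
    obtain \<delta> where \<delta>: "0 < \<delta>" "ennreal (\<delta> powr p) * (\<integral>\<^sup>+ x. epowr (\<tau> x) p \<partial>\<mu>\<^sub>X) \<le> ennreal e"
      using ex_powr_mult_le[OF p_pos \<tau>_fin \<open>0 < e\<close>] by blast
    \<comment> \<open>The second function has infinite integral over the curves where the chain rule
      may fail and adds energy at most \<open>e\<close>.\<close>
    let ?\<sigma> = "\<lambda>x. max (\<rho> (\<phi> x) * g x) (ennreal \<delta> * \<tau> x)"
    have "?\<sigma> \<in> admissible \<mu>\<^sub>X \<Gamma>"
      unfolding admissible_def
    proof (intro CollectI conjI ballI impI)
      fix c assume c: "c \<in> \<Gamma>" "rectifiable c"
      obtain a b \<gamma> where c_eq: "c = (a, b, \<gamma>)" by (metis surj_pair)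
      have rc: "rectifiable_curve a b \<gamma>" "\<gamma> ` {a..b} \<subseteq> UNIV"
        using c \<Gamma> rectifiable_curve_iff[of a b \<gamma> UNIV] by (auto simp: c_eq)
      show "1 \<le> line_integral ?\<sigma> c"
      proof (cases "line_integral \<tau> (a, b, \<gamma>) < \<infinity>")
        case True
        have img: "rectifiable_curve a b (\<phi> \<circ> \<gamma>)" using chain[OF rc(1) True] by blast
        have "1 \<le> line_integral \<rho> (curve_map \<phi> c)"
          using \<rho> c(1) img rectifiable_curve_iff[of a b "\<phi> \<circ> \<gamma>" UNIV]
          by (auto simp: admissible_def c_eq curve_map_def)
        also have "\<dots> \<le> line_integral (\<lambda>x. \<rho> (\<phi> x) * g x) (a, b, \<gamma>)"
          using chain[OF rc(1) True, of \<rho>] by (simp add: c_eq curve_map_def)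
        also have "\<dots> \<le> line_integral ?\<sigma> c"
          unfolding c_eq by (rule rectifiable_curve.line_integral_mono[OF rc(1)]) simp
        finally show ?thesis .
      next
        case False
        then have "line_integral \<tau> (a, b, \<gamma>) = top" by (simp add: not_less top_unique)
        then have "line_integral (\<lambda>x. ennreal \<delta> * \<tau> x) (a, b, \<gamma>) = \<infinity>"
          using rc \<delta>(1) by (subst X.line_integral_cmult) (auto simp: ennreal_mult_top)
        moreover have "line_integral (\<lambda>x. ennreal \<delta> * \<tau> x) (a, b, \<gamma>) \<le> line_integral ?\<sigma> c"
          unfolding c_eq by (rule rectifiable_curve.line_integral_mono[OF rc(1)]) simp
        ultimately show ?thesis by (auto simp: top_unique)
      qed
    qed measurable
    then have "modulus p \<mu>\<^sub>X \<Gamma> \<le> (\<integral>\<^sup>+ x. epowr (?\<sigma> x) p \<partial>\<mu>\<^sub>X)"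
      unfolding modulus_def by (rule INF_lower)
    also have "\<dots> \<le> (\<integral>\<^sup>+ x. epowr (\<rho> (\<phi> x)) p * epowr (g x) p + ennreal (\<delta> powr p) * epowr (\<tau> x) p \<partial>\<mu>\<^sub>X)"
      using p_pos \<delta>(1) by (intro nn_integral_mono) (auto simp: max_def epowr_mult epowr_ennreal less_imp_le)
    also have "\<dots> = (\<integral>\<^sup>+ x. epowr (\<rho> (\<phi> x)) p * epowr (g x) p \<partial>\<mu>\<^sub>X)
        + ennreal (\<delta> powr p) * (\<integral>\<^sup>+ x. epowr (\<tau> x) p \<partial>\<mu>\<^sub>X)"
      by (simp add: nn_integral_add nn_integral_cmult)
    also have "\<dots> \<le> ennreal K * (\<integral>\<^sup>+ y. epowr (\<rho> y) p \<partial>\<mu>\<^sub>Y) + ennreal e"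
      by (intro add_mono \<delta>(2) energy_bound_nn_integral[OF bound gm, of "\<lambda>y. epowr (\<rho> y) p"]) measurable
    finally show "modulus p \<mu>\<^sub>X \<Gamma> \<le> ennreal K * (\<integral>\<^sup>+ y. epowr (\<rho> y) p \<partial>\<mu>\<^sub>Y) + ennreal e" .
  qed
  let ?m = "modulus p \<mu>\<^sub>Y (curve_map \<phi> ` \<Gamma>)"
  show "modulus p \<mu>\<^sub>X \<Gamma> \<le> ennreal K * ?m"
  proof (rule ennreal_le_epsilon)
    fix e :: real assume "0 < e"
    \<comment> \<open>Dividing by \<open>K + 1\<close> covers \<open>K = 0\<close>.\<close>
    then have "0 < e / (K + 1)" using K by simp
    then have "?m < ?m + ennreal (e / (K + 1))"
      using finite by (simp add: ennreal_add_left_cancel_less less_top)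
    then obtain \<rho> where \<rho>: "\<rho> \<in> admissible \<mu>\<^sub>Y (curve_map \<phi> ` \<Gamma>)"
      "(\<integral>\<^sup>+ y. epowr (\<rho> y) p \<partial>\<mu>\<^sub>Y) < ?m + ennreal (e / (K + 1))"
      unfolding modulus_def[of p \<mu>\<^sub>Y] by (auto simp: INF_less_iff)
    have "modulus p \<mu>\<^sub>X \<Gamma> \<le> ennreal K * (\<integral>\<^sup>+ y. epowr (\<rho> y) p \<partial>\<mu>\<^sub>Y)" by (rule mod_le[OF \<rho>(1)])
    also have "\<dots> \<le> ennreal K * (?m + ennreal (e / (K + 1)))"
      using \<rho>(2) by (intro mult_left_mono) auto
    also have "\<dots> = ennreal K * ?m + ennreal (K * (e / (K + 1)))"
      using K \<open>0 < e\<close> by (simp add: distrib_left ennreal_mult[symmetric])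
    also have "\<dots> \<le> ennreal K * ?m + ennreal e"
      using K \<open>0 < e\<close> by (intro add_left_mono ennreal_leI) (simp add: divide_simps mult_le_cancel_right)
    finally show "modulus p \<mu>\<^sub>X \<Gamma> \<le> ennreal K * ?m + ennreal e" .
  qed
qed

text \<open>Scaling an almost optimal function by \<delta> cancels the factor
  \<open>(1 / \<delta>) powr p\<close> in the modulus, so the approximants have energy at most
  \<open>K * v + \<delta>\<close> and error \<delta>. This is the hypothesis of
  \<open>ex_upper_gradient_if_approximate\<close> with \<open>K * v\<close> as limiting
  energy.\<close>

lemma ex_UG_if_outer_dilatation_le:
  assumes dil: "outer_dilatation_le p \<mu>\<^sub>X \<mu>\<^sub>Y \<phi> K" and V: "open V" "emeasure \<mu>\<^sub>Y V < \<infinity>" and \<epsilon>: "0 < \<epsilon>"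
  shows "\<exists>h\<in>UG p (preimage_measure V) dist \<phi>.
    (\<integral>\<^sup>+ x. epowr (h x) p \<partial>preimage_measure V) \<le> ennreal K * emeasure \<mu>\<^sub>Y V + ennreal \<epsilon>"
proof -
  have Vb [measurable]: "V \<in> sets borel" using V(1) by simp
  interpret P: borel_subspace "preimage_measure V" by (rule borel_subspace_preimage[OF Vb])
  obtain v where v: "emeasure \<mu>\<^sub>Y V = ennreal v" "0 \<le> v" using V(2) by (cases "emeasure \<mu>\<^sub>Y V") auto
  have "\<exists>h\<in>borel_measurable (preimage_measure V). (\<integral>\<^sup>+ x. epowr (h x) p \<partial>preimage_measure V) \<le> ennreal (K * v + \<epsilon>) \<and>
    (\<forall>a b \<gamma>. rectifiable_curve a b \<gamma> \<longrightarrow> \<gamma> ` {a..b} \<subseteq> space (preimage_measure V) \<longrightarrow>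
      ennreal (dist (\<phi> (\<gamma> b)) (\<phi> (\<gamma> a))) \<le> line_integral h (a, b, \<gamma>))"
  proof (rule P.ex_upper_gradient_if_approximate[OF p _ \<epsilon>])
    show "0 \<le> K * v" using K v by simp
    fix \<delta> :: real assume \<delta>: "0 < \<delta>"
    define \<Gamma> where "\<Gamma> = {(a, b, \<gamma>) \<in> curves (\<phi> -` V). \<delta> \<le> dist (\<phi> (\<gamma> a)) (\<phi> (\<gamma> b))}"
    have \<Gamma>: "\<Gamma> \<subseteq> curves (space \<mu>\<^sub>X)" by (auto simp: \<Gamma>_def curves_def)
    \<comment> \<open>Admissible because each image curve stays in \<open>V\<close> and has length
      at least \<delta>.\<close>
    let ?\<rho> = "\<lambda>y. ennreal (1 / \<delta>) * indicator V y"
    have "?\<rho> \<in> admissible \<mu>\<^sub>Y (curve_map \<phi> ` \<Gamma>)"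
      unfolding admissible_def
    proof (intro CollectI conjI ballI impI)
      fix c assume c: "c \<in> curve_map \<phi> ` \<Gamma>" "rectifiable c"
      then obtain a b \<gamma> where \<gamma>: "(a, b, \<gamma>) \<in> \<Gamma>" "c = (a, b, \<phi> \<circ> \<gamma>)" by (auto simp: curve_map_def)
      then have ab: "a \<le> b" "continuous_on {a..b} \<gamma>" "\<gamma> ` {a..b} \<subseteq> \<phi> -` V" "\<delta> \<le> dist (\<phi> (\<gamma> a)) (\<phi> (\<gamma> b))"
        by (auto simp: \<Gamma>_def curves_def)
      have "continuous_on {a..b} (\<phi> \<circ> \<gamma>)"
        using continuous_on_compose[OF ab(2) continuous_on_subset[OF cont_\<phi>]] by simp
      then have rc: "rectifiable_curve a b (\<phi> \<circ> \<gamma>)"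
        using ab(1) c(2) \<gamma>(2) by unfold_locales (auto simp: rectifiable_def)
      interpret C: rectifiable_curve a b "\<phi> \<circ> \<gamma>" by (rule rc)
      have "1 = ennreal (1 / \<delta>) * ennreal \<delta>" using \<delta> by (simp flip: ennreal_mult)
      also have "\<dots> \<le> ennreal (1 / \<delta>) * curve_length (a, b, \<phi> \<circ> \<gamma>)"
      proof (rule mult_left_mono)
        have "ennreal \<delta> \<le> ennreal (dist (\<phi> (\<gamma> a)) (\<phi> (\<gamma> b)))" using ab(4) by (rule ennreal_leI)
        also have "\<dots> \<le> curve_length (a, b, \<phi> \<circ> \<gamma>)" using dist_le_curve_length[OF ab(1), of "\<phi> \<circ> \<gamma>"] by simp
        finally show "ennreal \<delta> \<le> curve_length (a, b, \<phi> \<circ> \<gamma>)" .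
      qed simp
      also have "\<dots> = line_integral (\<lambda>y. ennreal (1 / \<delta>) * 1) (a, b, \<phi> \<circ> \<gamma>)"
        by (subst Y.line_integral_cmult[OF _ rc]) (auto simp: C.line_integral_const)
      also have "\<dots> \<le> line_integral ?\<rho> c"
        unfolding \<gamma>(2) using ab(3) by (intro C.line_integral_mono mult_left_mono) auto
      finally show "1 \<le> line_integral ?\<rho> c" .
    qed measurable
    then have "modulus p \<mu>\<^sub>Y (curve_map \<phi> ` \<Gamma>) \<le> (\<integral>\<^sup>+ y. epowr (?\<rho> y) p \<partial>\<mu>\<^sub>Y)"
      unfolding modulus_def by (rule INF_lower)
    also have "\<dots> = (\<integral>\<^sup>+ y. ennreal ((1 / \<delta>) powr p) * indicator V y \<partial>\<mu>\<^sub>Y)"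
      using p_pos \<delta> by (intro nn_integral_cong) (auto simp: epowr_ennreal split: split_indicator)
    also have "\<dots> = ennreal ((1 / \<delta>) powr p * v)"
      using v by (simp add: nn_integral_cmult_indicator ennreal_mult)
    finally have modY: "modulus p \<mu>\<^sub>Y (curve_map \<phi> ` \<Gamma>) \<le> ennreal ((1 / \<delta>) powr p * v)" .
    then have "modulus p \<mu>\<^sub>X \<Gamma> \<le> ennreal K * modulus p \<mu>\<^sub>Y (curve_map \<phi> ` \<Gamma>)"
      using dil \<Gamma> by (auto simp: outer_dilatation_le_def top_unique)
    also have "\<dots> \<le> ennreal K * ennreal ((1 / \<delta>) powr p * v)"
      using modY by (rule mult_left_mono) simp
    \<comment> \<open>The added \<delta> makes the inequality strict, so that an admissible function
      below this value exists even if \<open>K * v = 0\<close>.\<close>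
    also have "\<dots> < ennreal ((1 / \<delta>) powr p * (K * v + \<delta>))"
      using K v \<delta> by (simp add: ennreal_less_iff algebra_simps flip: ennreal_mult)
    finally obtain \<rho> where \<rho>: "\<rho> \<in> admissible \<mu>\<^sub>X \<Gamma>"
      "(\<integral>\<^sup>+ x. epowr (\<rho> x) p \<partial>\<mu>\<^sub>X) < ennreal ((1 / \<delta>) powr p * (K * v + \<delta>))"
      unfolding modulus_def by (auto simp: INF_less_iff)
    have \<rho>m [measurable]: "\<rho> \<in> borel_measurable borel" using \<rho>(1) by (auto simp: admissible_def)
    let ?g = "\<lambda>x. ennreal \<delta> * \<rho> x"
    have "?g \<in> borel_measurable (preimage_measure V)"
      by (rule P.measurable_borel) measurable
    moreover have "(\<integral>\<^sup>+ x. epowr (?g x) p \<partial>preimage_measure V) \<le> ennreal (K * v + \<delta>)"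
    proof -
      have "(\<integral>\<^sup>+ x. epowr (?g x) p \<partial>preimage_measure V) \<le> (\<integral>\<^sup>+ x. epowr (?g x) p \<partial>\<mu>\<^sub>X)"
        by (subst nn_integral_preimage) (auto intro!: nn_integral_mono split: split_indicator)
      also have "\<dots> = ennreal (\<delta> powr p) * (\<integral>\<^sup>+ x. epowr (\<rho> x) p \<partial>\<mu>\<^sub>X)"
        using p_pos \<delta> by (simp add: epowr_mult epowr_ennreal less_imp_le nn_integral_cmult)
      also have "\<dots> \<le> ennreal (\<delta> powr p) * ennreal ((1 / \<delta>) powr p * (K * v + \<delta>))"
        using \<rho>(2) by (intro mult_left_mono) auto
      also have "\<dots> = ennreal (\<delta> powr p * ((1 / \<delta>) powr p * (K * v + \<delta>)))"
        by (simp add: ennreal_mult')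
      also have "\<delta> powr p * ((1 / \<delta>) powr p * (K * v + \<delta>)) = K * v + \<delta>"
        using \<delta> by (simp add: powr_divide)
      finally show ?thesis .
    qed
    moreover have "ennreal (dist (\<phi> (\<gamma> b)) (\<phi> (\<gamma> a))) \<le> line_integral ?g (a, b, \<gamma>) + ennreal \<delta>"
      if c: "rectifiable_curve a b \<gamma>" "\<gamma> ` {a..b} \<subseteq> space (preimage_measure V)" for a b \<gamma>
    proof -
      interpret C: rectifiable_curve a b \<gamma> by (rule c(1))
      have "ennreal (dist (\<phi> (\<gamma> a)) (\<phi> (\<gamma> b))) \<le> ennreal \<delta> * line_integral \<rho> (a, b, \<gamma>) + ennreal \<delta>"
      proof (rule C.dist_image_le_line_integral[OF cont_\<phi> \<rho>m \<delta>])
        fix s t assume st: "a \<le> s" "s \<le> t" "t \<le> b" "\<delta> \<le> dist (\<phi> (\<gamma> s)) (\<phi> (\<gamma> t))"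
        have "\<gamma> ` {s..t} \<subseteq> \<gamma> ` {a..b}" using st by (intro image_mono) auto
        then have sub: "\<gamma> ` {s..t} \<subseteq> \<phi> -` V" using c(2) by simp
        then have "(s, t, \<gamma>) \<in> curves (\<phi> -` V)" "rectifiable (s, t, \<gamma>)"
          using C.subcurve[OF st(1-3)] rectifiable_curve_iff by blast+
        then show "1 \<le> line_integral \<rho> (s, t, \<gamma>)"
          using \<rho>(1) st(4) by (auto simp: admissible_def \<Gamma>_def)
      qed
      then show ?thesis
        using c by (subst X.line_integral_cmult) (auto simp: dist_commute)
    qed
    ultimately show "\<exists>g\<in>borel_measurable (preimage_measure V).
        (\<integral>\<^sup>+ x. epowr (g x) p \<partial>preimage_measure V) \<le> ennreal (K * v + \<delta>) \<and>
        (\<forall>a b \<gamma>. rectifiable_curve a b \<gamma> \<longrightarrow> \<gamma> ` {a..b} \<subseteq> space (preimage_measure V) \<longrightarrow>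
          ennreal (dist (\<phi> (\<gamma> b)) (\<phi> (\<gamma> a))) \<le> line_integral g (a, b, \<gamma>) + ennreal \<delta>)"
      by (intro bexI[of _ ?g] conjI allI impI)
  qed
  then obtain h where h: "h \<in> borel_measurable (preimage_measure V)"
    "(\<integral>\<^sup>+ x. epowr (h x) p \<partial>preimage_measure V) \<le> ennreal (K * v + \<epsilon>)"
    "\<And>a b \<gamma>. rectifiable_curve a b \<gamma> \<Longrightarrow> \<gamma> ` {a..b} \<subseteq> space (preimage_measure V) \<Longrightarrow> curve_ug dist \<phi> h a b \<gamma>"
    by blast
  have int: "p_integrable p (preimage_measure V) h"
    using h(1,2) by (auto simp: p_integrable_def intro: le_less_trans)
  moreover have "almost_all_curves p (preimage_measure V) (curve_ug dist \<phi> h)"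
    by (rule almost_all_curves_mono[OF P.almost_all_curves_finite[OF int]]) (rule h(3))
  ultimately have "h \<in> UG p (preimage_measure V) dist \<phi>" by (simp add: P.UG_iff[OF p_pos])
  moreover have "ennreal (K * v + \<epsilon>) = ennreal K * emeasure \<mu>\<^sub>Y V + ennreal \<epsilon>"
    using K v \<epsilon> by (simp add: ennreal_mult)
  ultimately show ?thesis using h(2) by auto
qed

section \<open>The energy bound: from subsets of the target to the whole space\<close>

lemma Metric_space_dist: "Metric_space UNIV (dist :: 'z::metric_space \<Rightarrow> 'z \<Rightarrow> real)"
  by (rule Met_TC.Metric_space_axioms)

lemma measurable_map_\<phi>: "measurable_map \<mu>\<^sub>X UNIV dist \<phi>"
  unfolding measurable_map_def
proof (intro conjI allI impI)
  have *: "\<phi> -` U \<inter> space \<mu>\<^sub>X \<in> sets \<mu>\<^sub>X" if "openin (Metric_space.mtopology UNIV dist) U" for U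
    using that by (simp add: vimage_open)
  then show "\<And>U. openin (Metric_space.mtopology UNIV dist) U \<Longrightarrow> \<phi> -` U \<inter> space \<mu>\<^sub>X \<in> sets \<mu>\<^sub>X" .
  show "\<exists>N\<in>null_sets \<mu>\<^sub>X.
      separable_space (subtopology (Metric_space.mtopology UNIV dist) (\<phi> ` (space \<mu>\<^sub>X - N)))"
    by (rule X.borel_map_essentially_separable[OF Metric_space_dist _ *]) auto
qed simp

text \<open>Minimal weak upper gradients over the sets \<open>\<Omega> n\<close> increase with
  \<open>n\<close>, so monotone convergence passes the bound to their supremum. The supremum is an
  upper gradient along almost every curve because compactness puts each curve over a single
  \<open>\<Omega> n\<close>, and it is locally integrable because \<open>\<Omega> n\<close> has
  finite measure. Asking the interiors to cover makes both open and closed balls eligible.\<close>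

lemma energy_bound_if_exhaustion:
  fixes \<Omega> :: "nat \<Rightarrow> 'b set"
  assumes \<Omega>: "\<And>n. \<Omega> n \<in> sets borel" "incseq \<Omega>" "(\<Union>n. interior (\<Omega> n)) = UNIV"
    and fin: "\<And>n. emeasure \<mu>\<^sub>Y (\<Omega> n) < \<infinity>"
    and ne: "\<And>n. UG_loc p (preimage_measure (\<Omega> n)) dist \<phi> \<noteq> {}"
    and bound: "\<And>n E. E \<in> sets borel \<Longrightarrow>
      (\<integral>\<^sup>+ x. indicator E (\<phi> x) * epowr (min_wug p (preimage_measure (\<Omega> n)) dist \<phi> x) p \<partial>preimage_measure (\<Omega> n))
        \<le> ennreal K * emeasure \<mu>\<^sub>Y E"
  shows "\<phi> \<in> Dir_loc p \<mu>\<^sub>X UNIV dist \<and> energy_bound (min_wug p \<mu>\<^sub>X dist \<phi>)"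
proof -
  let ?M = "\<lambda>n. preimage_measure (\<Omega> n)"
  have sub: "borel_subspace (?M n)" for n by (rule borel_subspace_preimage[OF \<Omega>(1)])
  define \<rho> where "\<rho> n = min_wug p (?M n) dist \<phi>" for n
  have \<rho>: "is_min_wug p (?M n) dist \<phi> (\<rho> n)" for n
    unfolding \<rho>_def by (rule borel_subspace.is_min_wug_min_wug[OF sub p_pos Metric_space_dist _ ne]) auto
  then have \<rho>_UG: "\<rho> n \<in> UG_loc p (?M n) dist \<phi>" for n by (simp add: is_min_wug_def)
  define \<rho>' where "\<rho>' n x = \<rho> n x * indicator (\<phi> -` \<Omega> n) x" for n x
  have \<rho>'m [measurable]: "\<rho>' n \<in> borel_measurable borel" for n
    using borel_subspace.zero_extension_measurable[OF sub, of "\<rho> n" n] \<rho>_UG[of n]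
    by (auto simp: \<rho>'_def[abs_def] UG_loc_def weak_upper_gradient_def)
  have "AE x in \<mu>\<^sub>X. \<rho>' n x \<le> \<rho>' (Suc n) x" for n
  proof -
    have inc: "\<Omega> n \<subseteq> \<Omega> (Suc n)" using \<Omega>(2) by (simp add: incseq_SucD)
    have "AE x in ?M (Suc n). x \<in> \<phi> -` \<Omega> n \<longrightarrow> \<rho> n x \<le> \<rho> (Suc n) x"
    proof (rule borel_subspace.min_wug_mono_restrict[OF sub p_pos vimage_borel[OF \<Omega>(1)] \<rho>_UG])
      show "is_min_wug p (restrict_space (?M (Suc n)) (\<phi> -` \<Omega> n)) dist \<phi> (\<rho> n)"
        using \<rho> by (simp add: restrict_preimage[OF \<Omega>(1) \<Omega>(1) inc])
    qed
    then have "AE x in \<mu>\<^sub>X. \<phi> x \<in> \<Omega> (Suc n) \<longrightarrow> x \<in> \<phi> -` \<Omega> n \<longrightarrow> \<rho> n x \<le> \<rho> (Suc n) x"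
      by (simp add: AE_preimage[OF \<Omega>(1)])
    then show ?thesis
      by eventually_elim (use inc in \<open>auto simp: \<rho>'_def split: split_indicator\<close>)
  qed
  note mono = this
  define g where "g x = (SUP n. \<rho>' n x)" for x
  have gm [measurable]: "g \<in> borel_measurable borel" unfolding g_def by measurable
  have g_bound: "energy_bound g"
    unfolding energy_bound_def
  proof
    fix E :: "'b set" assume E [measurable]: "E \<in> sets borel"
    have "(\<integral>\<^sup>+ x. indicator E (\<phi> x) * epowr (g x) p \<partial>\<mu>\<^sub>X)
        = (\<integral>\<^sup>+ x. (SUP n. indicator E (\<phi> x) * epowr (\<rho>' n x) p) \<partial>\<mu>\<^sub>X)"
      unfolding g_def using p_pos by (simp add: epowr_SUP SUP_mult_left_ennreal)
    also have "\<dots> = (SUP n. \<integral>\<^sup>+ x. indicator E (\<phi> x) * epowr (\<rho>' n x) p \<partial>\<mu>\<^sub>X)"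
    proof (rule nn_integral_monotone_convergence_SUP_AE)
      fix n show "AE x in \<mu>\<^sub>X. indicator E (\<phi> x) * epowr (\<rho>' n x) p \<le> indicator E (\<phi> x) * epowr (\<rho>' (Suc n) x) p"
        using mono[of n] by eventually_elim (intro mult_left_mono epowr_mono p_pos, auto)
    qed measurable
    also have "\<dots> \<le> ennreal K * emeasure \<mu>\<^sub>Y E"
    proof (rule SUP_least)
      fix n
      have "(\<integral>\<^sup>+ x. indicator E (\<phi> x) * epowr (\<rho>' n x) p \<partial>\<mu>\<^sub>X)
          = (\<integral>\<^sup>+ x. indicator E (\<phi> x) * epowr (\<rho> n x) p \<partial>?M n)"
        by (subst nn_integral_preimage[OF \<Omega>(1)])
          (auto intro!: nn_integral_cong simp: \<rho>'_def split: split_indicator)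
      also have "\<dots> \<le> ennreal K * emeasure \<mu>\<^sub>Y E" unfolding \<rho>_def by (rule bound[OF E])
      finally show "(\<integral>\<^sup>+ x. indicator E (\<phi> x) * epowr (\<rho>' n x) p \<partial>\<mu>\<^sub>X) \<le> ennreal K * emeasure \<mu>\<^sub>Y E" .
    qed
    finally show "(\<integral>\<^sup>+ x. indicator E (\<phi> x) * epowr (g x) p \<partial>\<mu>\<^sub>X) \<le> ennreal K * emeasure \<mu>\<^sub>Y E" .
  qed
  have "locally_p_integrable p \<mu>\<^sub>X g"
    unfolding locally_p_integrable_def
  proof (intro conjI ballI)
    fix x
    obtain n where n: "\<phi> x \<in> interior (\<Omega> n)" using \<Omega>(3) by blast
    have "(\<integral>\<^sup>+ y\<in>\<phi> -` interior (\<Omega> n). epowr (g y) p \<partial>\<mu>\<^sub>X) \<le> (\<integral>\<^sup>+ y. indicator (\<Omega> n) (\<phi> y) * epowr (g y) p \<partial>\<mu>\<^sub>X)"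
      using interior_subset[of "\<Omega> n"] by (intro nn_integral_mono) (auto split: split_indicator)
    also have "\<dots> \<le> ennreal K * emeasure \<mu>\<^sub>Y (\<Omega> n)" using g_bound \<Omega>(1) by (simp add: energy_bound_def)
    also have "\<dots> < \<infinity>" using fin[of n] by (simp add: ennreal_mult_less_top)
    finally show "\<exists>U. open U \<and> x \<in> U \<and> (\<integral>\<^sup>+ y\<in>U. epowr (g y) p \<partial>\<mu>\<^sub>X) < \<infinity>"
      using n by (intro exI[of _ "\<phi> -` interior (\<Omega> n)"]) (auto simp: vimage_open)
  qed measurable
  moreover have "almost_all_curves p \<mu>\<^sub>X (curve_ug dist \<phi> g)"
  proof (rule almost_all_curves_mono)
    have "almost_all_curves p \<mu>\<^sub>X (\<lambda>a b \<gamma>. \<gamma> ` {a..b} \<subseteq> \<phi> -` \<Omega> n \<longrightarrow> curve_ug dist \<phi> (\<rho> n) a b \<gamma>)" for n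
      using \<rho>_UG[of n] borel_subspace.UG_loc_iff[OF sub p_pos]
      by (intro X.almost_all_curves_in_subset vimage_borel \<Omega>(1)) (auto simp: preimage_measure_def)
    then show "almost_all_curves p \<mu>\<^sub>X (\<lambda>a b \<gamma>. \<forall>n. \<gamma> ` {a..b} \<subseteq> \<phi> -` \<Omega> n \<longrightarrow> curve_ug dist \<phi> (\<rho> n) a b \<gamma>)"
      by (intro X.almost_all_curves_countable p_pos)
    fix a b \<gamma> assume c: "rectifiable_curve a b \<gamma>"
      and ug: "\<forall>n. \<gamma> ` {a..b} \<subseteq> \<phi> -` \<Omega> n \<longrightarrow> curve_ug dist \<phi> (\<rho> n) a b \<gamma>"
    interpret rectifiable_curve a b \<gamma> by (rule c)
    have "compact (\<gamma> ` {a..b})" by (intro compact_continuous_image rectifiable_curve.cont[OF c]) simp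
    moreover have "open (\<phi> -` interior (\<Omega> n))" for n by (simp add: vimage_open)
    moreover have "\<gamma> ` {a..b} \<subseteq> (\<Union>n\<in>UNIV. \<phi> -` interior (\<Omega> n))" using \<Omega>(3) by blast
    ultimately obtain I where I: "finite I" "\<gamma> ` {a..b} \<subseteq> (\<Union>n\<in>I. \<phi> -` interior (\<Omega> n))"
      by (rule compactE_image[where S = "\<gamma> ` {a..b}" and C = UNIV and f = "\<lambda>n. \<phi> -` interior (\<Omega> n)"]) auto
    \<comment> \<open>The sets increase, so the largest index of the finite subcover captures the
      whole curve.\<close>
    define n where "n = Max (insert 0 I)"
    have "interior (\<Omega> i) \<subseteq> \<Omega> n" if "i \<in> I" for i
    proof -
      have "i \<le> n" using that I(1) by (simp add: n_def)
      then show ?thesis using interior_subset incseqD[OF \<Omega>(2)] by blast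
    qed
    then have n: "\<gamma> ` {a..b} \<subseteq> \<phi> -` \<Omega> n" using I(2) by blast
    then have "curve_ug dist \<phi> (\<rho> n) a b \<gamma>" using ug by blast
    also have "line_integral (\<rho> n) (a, b, \<gamma>) \<le> line_integral g (a, b, \<gamma>)"
    proof (rule line_integral_mono)
      fix x assume "x \<in> \<gamma> ` {a..b}"
      then have "\<rho> n x = \<rho>' n x" using n by (auto simp: \<rho>'_def)
      also have "\<dots> \<le> g x" unfolding g_def by (rule SUP_upper) simp
      finally show "\<rho> n x \<le> g x" .
    qed
    finally show "curve_ug dist \<phi> g a b \<gamma>" .
  qed
  ultimately have g_UG: "g \<in> UG_loc p \<mu>\<^sub>X dist \<phi>" by (simp add: X.UG_loc_iff[OF p_pos])
  then have "is_min_wug p \<mu>\<^sub>X dist \<phi> (min_wug p \<mu>\<^sub>X dist \<phi>)"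
    by (intro X.is_min_wug_min_wug[OF p_pos Metric_space_dist]) auto
  then have min_le: "AE x in \<mu>\<^sub>X. min_wug p \<mu>\<^sub>X dist \<phi> x \<le> g x" using g_UG by (simp add: is_min_wug_def)
  have "(\<integral>\<^sup>+ x. indicator E (\<phi> x) * epowr (min_wug p \<mu>\<^sub>X dist \<phi> x) p \<partial>\<mu>\<^sub>X) \<le> ennreal K * emeasure \<mu>\<^sub>Y E"
    if E: "E \<in> sets borel" for E
  proof -
    have "(\<integral>\<^sup>+ x. indicator E (\<phi> x) * epowr (min_wug p \<mu>\<^sub>X dist \<phi> x) p \<partial>\<mu>\<^sub>X)
        \<le> (\<integral>\<^sup>+ x. indicator E (\<phi> x) * epowr (g x) p \<partial>\<mu>\<^sub>X)"
      by (rule nn_integral_mono_AE) (use min_le in \<open>eventually_elim, intro mult_left_mono epowr_mono p_pos, auto\<close>)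
    also have "\<dots> \<le> ennreal K * emeasure \<mu>\<^sub>Y E" using g_bound E by (simp add: energy_bound_def)
    finally show ?thesis .
  qed
  then show ?thesis
    using measurable_map_\<phi> g_UG by (auto simp: Dir_loc_def energy_bound_def)
qed

text \<open>Within a ball, \<open>E\<close> is enclosed in an open set \<open>V\<close> of nearly
  the same measure. Locality bounds the minimal weak upper gradient over \<open>V\<close> by a
  competitor whose energy is about \<open>K\<close> times the measure of \<open>V\<close>, and this
  bounds the energy over \<open>E\<close>.\<close>

lemma energy_bound_if_outer_dilatation_le:
  assumes dil: "outer_dilatation_le p \<mu>\<^sub>X \<mu>\<^sub>Y \<phi> K"
  shows "\<phi> \<in> Dir_loc p \<mu>\<^sub>X UNIV dist \<and> energy_bound (min_wug p \<mu>\<^sub>X dist \<phi>)"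
proof (rule energy_bound_if_exhaustion[where \<Omega> = "\<lambda>n. ball undefined (real n)"])
  let ?\<Omega> = "\<lambda>n. ball (undefined :: 'b) (real n)"
  show "?\<Omega> n \<in> sets borel" for n by simp
  show "incseq ?\<Omega>" by (auto simp: incseq_def)
  show "(\<Union>n. interior (?\<Omega> n)) = UNIV" by (auto simp: interior_open reals_Archimedean2)
  show fin: "emeasure \<mu>\<^sub>Y (?\<Omega> n) < \<infinity>" for n by (rule finite_on_bounded) auto
  fix n
  interpret M: borel_subspace "preimage_measure (?\<Omega> n)" by (rule borel_subspace_preimage) simp
  obtain h\<^sub>0 where "h\<^sub>0 \<in> UG p (preimage_measure (?\<Omega> n)) dist \<phi>"
    using ex_UG_if_outer_dilatation_le[OF dil open_ball fin zero_less_one] by blast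
  from subsetD[OF M.UG_subset_UG_loc[OF p_pos] this]
  show ne: "UG_loc p (preimage_measure (?\<Omega> n)) dist \<phi> \<noteq> {}"
    by blast
  let ?\<rho> = "min_wug p (preimage_measure (?\<Omega> n)) dist \<phi>"
  have \<rho>: "is_min_wug p (preimage_measure (?\<Omega> n)) dist \<phi> ?\<rho>"
    by (rule M.is_min_wug_min_wug[OF p_pos Metric_space_dist _ ne]) auto
  fix E :: "'b set" assume E [measurable]: "E \<in> sets borel"
  show "(\<integral>\<^sup>+ x. indicator E (\<phi> x) * epowr (?\<rho> x) p \<partial>preimage_measure (?\<Omega> n)) \<le> ennreal K * emeasure \<mu>\<^sub>Y E"
  proof (rule ennreal_le_epsilon)
    fix e :: real assume "0 < e"
    \<comment> \<open>One error enters through the measure of \<open>V\<close>, multiplied by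
      \<open>K\<close>, and one through the energy of \<open>h\<close>.\<close>
    define e' where "e' = e / (K + 1)"
    have e': "0 < e'" "(K + 1) * e' = e" using \<open>0 < e\<close> K by (auto simp: e'_def)
    \<comment> \<open>Cut down to the ball to obtain a finite measure, as the outer regularity rule
      asks.\<close>
    define \<nu> where "\<nu> = density \<mu>\<^sub>Y (indicator (?\<Omega> n))"
    have \<nu>: "emeasure \<nu> A = emeasure \<mu>\<^sub>Y (A \<inter> ?\<Omega> n)" if "A \<in> sets borel" for A
    proof -
      have "emeasure \<nu> A = (\<integral>\<^sup>+ y\<in>A. indicator (?\<Omega> n) y \<partial>\<mu>\<^sub>Y)"
        unfolding \<nu>_def using that
        by (subst emeasure_density) (simp_all add: borel_measurable_indicator)
      also have "\<dots> = (\<integral>\<^sup>+ y. indicator (A \<inter> ?\<Omega> n) y \<partial>\<mu>\<^sub>Y)"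
        by (rule nn_integral_cong) (auto split: split_indicator)
      also have "\<dots> = emeasure \<mu>\<^sub>Y (A \<inter> ?\<Omega> n)"
        using that by (intro nn_integral_indicator) auto
      finally show ?thesis .
    qed
    have \<nu>_sets: "sets \<nu> = sets borel" by (simp add: \<nu>_def)
    have \<nu>_fin: "emeasure \<nu> (space \<nu>) \<noteq> \<infinity>" using \<nu>[of UNIV] fin[of n] by (simp add: \<nu>_def)
    have "emeasure \<nu> E \<noteq> \<infinity>"
      using \<nu>_fin emeasure_space[of \<nu> E] by (metis infinity_ennreal_def top_unique)
    then have "emeasure \<nu> E < emeasure \<nu> E + ennreal e'"
      using e'(1) by (simp add: less_top)
    then have "(INF U\<in>{U. E \<subseteq> U \<and> open U}. emeasure \<nu> U) < emeasure \<nu> E + ennreal e'"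
      using outer_regular[OF \<nu>_sets \<nu>_fin E] by simp
    then obtain U where U: "E \<subseteq> U" "open U" "emeasure \<nu> U < emeasure \<nu> E + ennreal e'"
      by (auto simp: INF_less_iff)
    define V where "V = U \<inter> ?\<Omega> n"
    have V: "open V" "V \<in> sets borel" "V \<subseteq> ?\<Omega> n" using U(2) by (auto simp: V_def)
    have "emeasure \<mu>\<^sub>Y V = emeasure \<nu> U" using U(2) by (simp add: V_def \<nu>)
    also have "\<dots> \<le> emeasure \<nu> E + ennreal e'" using U(3) by simp
    also have "emeasure \<nu> E \<le> emeasure \<mu>\<^sub>Y E" by (simp add: \<nu> emeasure_mono)
    finally have \<mu>V: "emeasure \<mu>\<^sub>Y V \<le> emeasure \<mu>\<^sub>Y E + ennreal e'" by (simp add: add_right_mono)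
    have "emeasure \<mu>\<^sub>Y V \<le> emeasure \<mu>\<^sub>Y (?\<Omega> n)" using V by (intro emeasure_mono) auto
    then have V_fin: "emeasure \<mu>\<^sub>Y V < \<infinity>" using fin[of n] by order
    obtain h where h: "h \<in> UG p (preimage_measure V) dist \<phi>"
      "(\<integral>\<^sup>+ x. epowr (h x) p \<partial>preimage_measure V) \<le> ennreal K * emeasure \<mu>\<^sub>Y V + ennreal e'"
      using ex_UG_if_outer_dilatation_le[OF dil V(1) V_fin e'(1)] by blast
    have "h \<in> UG_loc p (restrict_space (preimage_measure (?\<Omega> n)) (\<phi> -` V)) dist \<phi>"
      using subsetD[OF borel_subspace.UG_subset_UG_loc[OF borel_subspace_preimage[OF V(2)] p_pos] h(1)]
      by (simp add: restrict_preimage[OF _ V(2,3)])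
    from M.min_wug_le_local[OF p_pos Metric_space_dist _ vimage_open[OF V(1)] \<rho> this]
    have "AE x in \<mu>\<^sub>X. \<phi> x \<in> ?\<Omega> n \<longrightarrow> \<phi> x \<in> V \<longrightarrow> ?\<rho> x \<le> h x"
      by (simp add: AE_preimage)
    then have le: "AE x in \<mu>\<^sub>X. indicator E (\<phi> x) * epowr (?\<rho> x) p * indicator (?\<Omega> n) (\<phi> x)
        \<le> epowr (h x) p * indicator V (\<phi> x)"
    proof eventually_elim
      case (elim x)
      show ?case
      proof (cases "\<phi> x \<in> E \<and> \<phi> x \<in> ?\<Omega> n")
        case True
        then have "\<phi> x \<in> V" using U(1) by (auto simp: V_def)
        then show ?thesis using True elim by (auto intro: epowr_mono[OF p_pos])
      qed (auto split: split_indicator)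
    qed
    have "(\<integral>\<^sup>+ x. indicator E (\<phi> x) * epowr (?\<rho> x) p \<partial>preimage_measure (?\<Omega> n))
        \<le> (\<integral>\<^sup>+ x. epowr (h x) p \<partial>preimage_measure V)"
      by (subst nn_integral_preimage, simp, subst nn_integral_preimage[OF V(2)]) (rule nn_integral_mono_AE[OF le])
    also have "\<dots> \<le> ennreal K * (emeasure \<mu>\<^sub>Y E + ennreal e') + ennreal e'"
      using \<mu>V by (intro order_trans[OF h(2)] add_right_mono mult_left_mono) auto
    also have "\<dots> = ennreal K * emeasure \<mu>\<^sub>Y E + ennreal (K * e' + e')"
      using K e'(1) by (simp add: distrib_left ennreal_mult add.assoc)
    also have "K * e' + e' = e" using e'(2) by (simp add: algebra_simps)
    finally show "(\<integral>\<^sup>+ x. indicator E (\<phi> x) * epowr (?\<rho> x) p \<partial>preimage_measure (?\<Omega> n))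
        \<le> ennreal K * emeasure \<mu>\<^sub>Y E + ennreal e" .
  qed
qed

text \<open>With \<rho> the minimal weak upper gradient of \<open>h\<close>, the product
  \<open>\<rho> (\<phi> x) * g x\<close> is a weak upper gradient of \<open>h \<circ> \<phi>\<close>
  by the chain rule, and integrating it against weights is covered by the energy bound. The curves
  whose images are exceptional for \<open>h\<close> are handled by pulling back their weight in the
  same way.\<close>

lemma pullback_property_if_energy_bound:
  fixes Z :: "'z set" and d :: "'z \<Rightarrow> 'z \<Rightarrow> real"
  assumes g: "g \<in> UG_loc p \<mu>\<^sub>X dist \<phi>" and bound: "energy_bound g"
    and \<Omega>: "\<Omega> \<in> sets borel" and d: "Metric_space Z d"
  shows "pullback_property p \<mu>\<^sub>X \<mu>\<^sub>Y \<phi> K \<Omega> Z d"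
proof -
  let ?M = "preimage_measure \<Omega>" and ?N = "restrict_space \<mu>\<^sub>Y \<Omega>"
  interpret M: borel_subspace ?M by (rule borel_subspace_preimage[OF \<Omega>])
  interpret N: borel_subspace ?N by (rule Y.restrict[OF \<Omega>])
  have N_space [simp]: "space ?N = \<Omega>" by (simp add: space_restrict_space)
  have N_int: "(\<integral>\<^sup>+ y. f y \<partial>?N) = (\<integral>\<^sup>+ y. f y * indicator \<Omega> y \<partial>\<mu>\<^sub>Y)" for f
    using \<Omega> by (subst nn_integral_restrict_space) auto
  have gm [measurable]: "g \<in> borel_measurable borel"
    using g by (auto simp: UG_loc_def weak_upper_gradient_def)
  have "h \<circ> \<phi> \<in> Dir p ?M Z d \<and> (\<forall>f :: 'b \<Rightarrow> ennreal.
      (\<lambda>y. f y * epowr (min_wug p ?N d h y) p) \<in> borel_measurable ?N \<and>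
      (\<integral>\<^sup>+ y. f y * epowr (min_wug p ?N d h y) p \<partial>?N) < \<infinity> \<longrightarrow>
      (\<integral>\<^sup>+ x. f (\<phi> x) * epowr (min_wug p ?M d (h \<circ> \<phi>) x) p \<partial>?M)
        \<le> ennreal K * (\<integral>\<^sup>+ y. f y * epowr (min_wug p ?N d h y) p \<partial>?N))"
    if h: "h \<in> Dir p ?N Z d" for h
  proof -
    have hZ: "h \<in> \<Omega> \<rightarrow> Z" and h_meas: "\<And>U. openin (Metric_space.mtopology Z d) U \<Longrightarrow> h -` U \<inter> \<Omega> \<in> sets ?N"
      using h by (auto simp: Dir_def measurable_map_def)
    obtain g\<^sub>0 where g0: "g\<^sub>0 \<in> UG p ?N d h" using h by (auto simp: Dir_def)
    let ?\<rho> = "min_wug p ?N d h"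
    note g0_loc = subsetD[OF N.UG_subset_UG_loc[OF p_pos] g0]
    then have "UG_loc p ?N d h \<noteq> {}" by blast
    then have "is_min_wug p ?N d h ?\<rho>"
      using hZ by (intro N.is_min_wug_min_wug[OF p_pos d]) simp_all
    then have \<rho>_UG: "?\<rho> \<in> UG_loc p ?N d h" and \<rho>_le: "AE y in ?N. ?\<rho> y \<le> g\<^sub>0 y"
      using g0_loc unfolding is_min_wug_def by blast+
    have \<rho>m: "?\<rho> \<in> borel_measurable ?N" using \<rho>_UG by (auto simp: UG_loc_def weak_upper_gradient_def)
    \<comment> \<open>Minimality is among locally integrable functions; comparison with
      \<open>g\<^sub>0\<close> gives global integrability.\<close>
    have "(\<integral>\<^sup>+ y. epowr (?\<rho> y) p \<partial>?N) \<le> (\<integral>\<^sup>+ y. epowr (g\<^sub>0 y) p \<partial>?N)"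
      by (rule nn_integral_mono_AE) (use \<rho>_le in \<open>eventually_elim, intro epowr_mono p_pos\<close>)
    then have \<rho>_int: "p_integrable p ?N ?\<rho>"
      using g0 \<rho>m by (auto simp: N.UG_iff[OF p_pos] p_integrable_def)
    \<comment> \<open>Used both for the minimal weak upper gradient and for the weight of the
      exceptional curves of \<open>h\<close>.\<close>
    have pull_int: "p_integrable p ?M (\<lambda>x. \<tau> (\<phi> x) * g x)" if \<tau>: "p_integrable p ?N \<tau>" for \<tau>
    proof -
      have \<tau>m: "(\<lambda>y. \<tau> y * indicator \<Omega> y) \<in> borel_measurable borel"
        using N.zero_extension_measurable[of \<tau>] \<tau> by (simp add: p_integrable_def)
      have [measurable]: "(\<lambda>y. \<tau> y * indicator \<Omega> y) \<in> borel_measurable borel" by (rule \<tau>m)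
      have "(\<lambda>x. \<tau> (\<phi> x) * indicator \<Omega> (\<phi> x) * g x) \<in> borel_measurable ?M"
        by (rule M.measurable_borel) (use measurable_compose[OF measurable_\<phi> \<tau>m] in measurable)
      then have "(\<lambda>x. \<tau> (\<phi> x) * g x) \<in> borel_measurable ?M"
        by (rule measurable_cong[THEN iffD1, rotated]) simp
      moreover have "(\<integral>\<^sup>+ x. epowr (\<tau> (\<phi> x) * g x) p \<partial>?M) < \<infinity>"
      proof -
        have "(\<integral>\<^sup>+ x. epowr (\<tau> (\<phi> x) * g x) p \<partial>?M)
          = (\<integral>\<^sup>+ x. epowr (\<tau> (\<phi> x) * indicator \<Omega> (\<phi> x)) p * epowr (g x) p \<partial>\<mu>\<^sub>X)"
        using p_pos by (subst nn_integral_preimage[OF \<Omega>])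
          (auto intro!: nn_integral_cong simp: epowr_mult split: split_indicator)
      then have "(\<integral>\<^sup>+ x. epowr (\<tau> (\<phi> x) * g x) p \<partial>?M)
          \<le> ennreal K * (\<integral>\<^sup>+ y. epowr (\<tau> y * indicator \<Omega> y) p \<partial>\<mu>\<^sub>Y)"
        using energy_bound_nn_integral[OF bound gm, of "\<lambda>y. epowr (\<tau> y * indicator \<Omega> y) p"] by simp
      also have "(\<integral>\<^sup>+ y. epowr (\<tau> y * indicator \<Omega> y) p \<partial>\<mu>\<^sub>Y) = (\<integral>\<^sup>+ y. epowr (\<tau> y) p \<partial>?N)"
        unfolding N_int by (auto intro!: nn_integral_cong split: split_indicator)
      also have "ennreal K * (\<integral>\<^sup>+ y. epowr (\<tau> y) p \<partial>?N) < \<infinity>"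
        using \<tau> by (simp add: p_integrable_def ennreal_mult_less_top)
      finally show ?thesis .
      qed
      ultimately show ?thesis by (simp add: p_integrable_def)
    qed
    let ?\<sigma> = "\<lambda>x. ?\<rho> (\<phi> x) * g x"
    obtain \<tau> where \<tau>: "p_integrable p ?N \<tau>" and ug: "\<And>a b \<gamma>. rectifiable_curve a b \<gamma> \<Longrightarrow>
        \<gamma> ` {a..b} \<subseteq> \<Omega> \<Longrightarrow> line_integral \<tau> (a, b, \<gamma>) < \<infinity> \<Longrightarrow> curve_ug d h ?\<rho> a b \<gamma>"
      using \<rho>_UG by (auto simp: N.UG_loc_iff[OF p_pos] almost_all_curves_def)
    have "almost_all_curves p ?M (curve_ug d (h \<circ> \<phi>) ?\<sigma>)"
    proof (rule almost_all_curves_mono[OF M.almost_all_curves_conj[OF p_pos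
            M.almost_all_curves_finite[OF pull_int[OF \<tau>]]
            X.almost_all_curves_restrict[OF vimage_borel[OF \<Omega>]
              almost_all_curves_line_integral_image[OF g], folded preimage_measure_def]]])
      fix a b \<gamma> assume c: "rectifiable_curve a b \<gamma>" "\<gamma> ` {a..b} \<subseteq> space ?M"
        and *: "line_integral (\<lambda>x. \<tau> (\<phi> x) * g x) (a, b, \<gamma>) < \<infinity> \<and> rectifiable_curve a b (\<phi> \<circ> \<gamma>) \<and>
          (\<forall>\<rho>\<in>borel_measurable borel. line_integral \<rho> (a, b, \<phi> \<circ> \<gamma>) \<le> line_integral (\<lambda>x. \<rho> (\<phi> x) * g x) (a, b, \<gamma>))"
      interpret C: rectifiable_curve a b \<gamma> by (rule c)
      interpret I: rectifiable_curve a b "\<phi> \<circ> \<gamma>" using * by simp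
      have img: "(\<phi> \<circ> \<gamma>) ` {a..b} \<subseteq> \<Omega>" using c(2) by auto
      have chain: "line_integral f (a, b, \<phi> \<circ> \<gamma>) \<le> line_integral (\<lambda>x. f (\<phi> x) * g x) (a, b, \<gamma>)"
        if f: "f \<in> borel_measurable ?N" for f
      proof -
        let ?f = "\<lambda>y. f y * indicator \<Omega> y"
        have "?f \<in> borel_measurable borel" using N.zero_extension_measurable[OF f] by simp
        then have "line_integral ?f (a, b, \<phi> \<circ> \<gamma>) \<le> line_integral (\<lambda>x. ?f (\<phi> x) * g x) (a, b, \<gamma>)"
          using * by blast
        also have "line_integral ?f (a, b, \<phi> \<circ> \<gamma>) = line_integral f (a, b, \<phi> \<circ> \<gamma>)"
          using img by (intro I.line_integral_cong) auto
        also have "line_integral (\<lambda>x. ?f (\<phi> x) * g x) (a, b, \<gamma>) = line_integral (\<lambda>x. f (\<phi> x) * g x) (a, b, \<gamma>)"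
          using c(2) by (intro C.line_integral_cong) auto
        finally show ?thesis .
      qed
      \<comment> \<open>A finite integral of the pulled back weight means that the image curve is
        not exceptional for \<open>h\<close>.\<close>
      have "line_integral \<tau> (a, b, \<phi> \<circ> \<gamma>) < \<infinity>"
        using chain[of \<tau>] \<tau> * by (auto simp: p_integrable_def intro: le_less_trans)
      from ug[OF I.rectifiable_curve_axioms img this] chain[OF \<rho>m]
      show "curve_ug d (h \<circ> \<phi>) ?\<sigma> a b \<gamma>" by simp
    qed
    then have \<sigma>_UG: "?\<sigma> \<in> UG p ?M d (h \<circ> \<phi>)"
      using pull_int[OF \<rho>_int] by (simp add: M.UG_iff[OF p_pos])
    have hZ': "h \<circ> \<phi> \<in> space ?M \<rightarrow> Z" using hZ by auto
    have meas': "(h \<circ> \<phi>) -` U \<inter> space ?M \<in> sets ?M" if "openin (Metric_space.mtopology Z d) U" for U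
    proof -
      have "h -` U \<inter> \<Omega> \<in> sets borel" using h_meas[OF that] N.sets_iff by simp
      then have "\<phi> -` (h -` U \<inter> \<Omega>) \<in> sets borel" by (rule vimage_borel)
      moreover have "(h \<circ> \<phi>) -` U \<inter> space ?M = \<phi> -` (h -` U \<inter> \<Omega>)" by auto
      ultimately show ?thesis by (auto simp: M.sets_iff)
    qed
    have "measurable_map ?M Z d (h \<circ> \<phi>)"
      unfolding measurable_map_def
      using M.borel_map_essentially_separable[OF d hZ' meas'] hZ' meas' by blast
    then have "h \<circ> \<phi> \<in> Dir p ?M Z d" using \<sigma>_UG by (auto simp: Dir_def)
    moreover have "(\<integral>\<^sup>+ x. f (\<phi> x) * epowr (min_wug p ?M d (h \<circ> \<phi>) x) p \<partial>?M)
        \<le> ennreal K * (\<integral>\<^sup>+ y. f y * epowr (?\<rho> y) p \<partial>?N)"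
      if f: "(\<lambda>y. f y * epowr (?\<rho> y) p) \<in> borel_measurable ?N" for f :: "'b \<Rightarrow> ennreal"
    proof -
      \<comment> \<open>Measurability is known for the product and not for \<open>f\<close>, so the
        two factors are kept together.\<close>
      let ?F = "\<lambda>y. f y * epowr (?\<rho> y) p * indicator \<Omega> y"
      have \<sigma>_loc: "?\<sigma> \<in> UG_loc p ?M d (h \<circ> \<phi>)" by (rule subsetD[OF M.UG_subset_UG_loc[OF p_pos] \<sigma>_UG])
      then have "is_min_wug p ?M d (h \<circ> \<phi>) (min_wug p ?M d (h \<circ> \<phi>))"
        using hZ' by (intro M.is_min_wug_min_wug[OF p_pos d]) auto
      then have le: "AE x in ?M. min_wug p ?M d (h \<circ> \<phi>) x \<le> ?\<sigma> x"
        using \<sigma>_loc by (simp add: is_min_wug_def)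
      have "(\<integral>\<^sup>+ x. f (\<phi> x) * epowr (min_wug p ?M d (h \<circ> \<phi>) x) p \<partial>?M)
          \<le> (\<integral>\<^sup>+ x. f (\<phi> x) * epowr (?\<sigma> x) p \<partial>?M)"
        by (rule nn_integral_mono_AE) (use le in \<open>eventually_elim, intro mult_left_mono epowr_mono p_pos, auto\<close>)
      also have "\<dots> = (\<integral>\<^sup>+ x. ?F (\<phi> x) * epowr (g x) p \<partial>\<mu>\<^sub>X)"
        using p_pos by (subst nn_integral_preimage[OF \<Omega>]) (auto intro!: nn_integral_cong simp: epowr_mult ac_simps)
      also have "\<dots> \<le> ennreal K * (\<integral>\<^sup>+ y. ?F y \<partial>\<mu>\<^sub>Y)"
        using N.zero_extension_measurable[OF f] by (intro energy_bound_nn_integral[OF bound gm]) simp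
      finally show ?thesis by (simp add: N_int)
    qed
    ultimately show ?thesis by blast
  qed
  then show ?thesis
    unfolding pullback_property_def Let_def preimage_measure_def[symmetric] by blast
qed

text \<open>The identity of \<open>\<Omega> n\<close>, viewed as a map into an isometric copy of
  \<open>Y\<close>, has the constant \<open>1\<close> as an integrable upper gradient. Its pullback
  is \<phi>, and the weight \<open>indicator E\<close> turns the integral inequality into the energy
  bound.\<close>

lemma energy_bound_if_pullback_property:
  fixes \<Omega> :: "nat \<Rightarrow> 'b set"
  assumes \<Omega>: "\<And>n. \<Omega> n \<in> sets borel" "incseq \<Omega>" "(\<Union>n. interior (\<Omega> n)) = UNIV"
    and fin: "\<And>n. emeasure \<mu>\<^sub>Y (\<Omega> n) < \<infinity>"
    and pullback: "\<And>n (Z :: ('b + 'c) set) d. Metric_space Z d \<Longrightarrow> pullback_property p \<mu>\<^sub>X \<mu>\<^sub>Y \<phi> K (\<Omega> n) Z d"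
  shows "\<phi> \<in> Dir_loc p \<mu>\<^sub>X UNIV dist \<and> energy_bound (min_wug p \<mu>\<^sub>X dist \<phi>)"
proof -
  define Z :: "('b + 'c) set" where "Z = range Inl"
  define d :: "('b + 'c) \<Rightarrow> ('b + 'c) \<Rightarrow> real" where "d u v = dist (projl u) (projl v)" for u v
  have d: "Metric_space Z d"
    by unfold_locales (auto simp: Z_def d_def dist_commute dist_triangle)
  interpret Z: Metric_space Z d by (rule d)
  let ?i = "Inl :: 'b \<Rightarrow> 'b + 'c"
  have d_Inl: "d (?i x) (?i y) = dist x y" for x y by (simp add: d_def)
  \<comment> \<open>Upper gradients see only distances, so the isometric copy changes neither these
    sets nor the minimal function selected from them.\<close>
  have UG_eq: "UG p M d (?i \<circ> \<phi>) = UG p M dist \<phi>" "UG_loc p M d (?i \<circ> \<phi>) = UG_loc p M dist \<phi>"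
    for M :: "'a measure"
    by (auto simp: UG_def UG_loc_def weak_upper_gradient_def d_Inl)
  have min_eq: "min_wug p M d (?i \<circ> \<phi>) = min_wug p M dist \<phi>" for M :: "'a measure"
    unfolding min_wug_def is_min_wug_def UG_eq ..
  have main: "?i \<circ> \<phi> \<in> Dir p (preimage_measure (\<Omega> n)) Z d \<and> (\<forall>E\<in>sets borel.
      (\<integral>\<^sup>+ x. indicator E (\<phi> x) * epowr (min_wug p (preimage_measure (\<Omega> n)) dist \<phi> x) p \<partial>preimage_measure (\<Omega> n))
        \<le> ennreal K * emeasure \<mu>\<^sub>Y E)" for n
  proof -
    let ?M = "preimage_measure (\<Omega> n)" and ?N = "restrict_space \<mu>\<^sub>Y (\<Omega> n)"
    interpret N: borel_subspace ?N by (rule Y.restrict[OF \<Omega>(1)])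
    have N_space [simp]: "space ?N = \<Omega> n" by (simp add: space_restrict_space)
    have N_int: "(\<integral>\<^sup>+ y. f y \<partial>?N) = (\<integral>\<^sup>+ y. f y * indicator (\<Omega> n) y \<partial>\<mu>\<^sub>Y)" for f
      using \<Omega>(1) by (subst nn_integral_restrict_space) auto
    have iZ: "?i \<in> space ?N \<rightarrow> Z" by (auto simp: Z_def)
    have meas: "?i -` U \<inter> space ?N \<in> sets ?N" if U: "openin Z.mtopology U" for U
    proof -
      have "open (?i -` U)"
        unfolding open_dist
      proof
        fix y assume "y \<in> ?i -` U"
        then obtain r where r: "0 < r" "Z.mball (?i y) r \<subseteq> U"
          using U unfolding Z.openin_mtopology by auto
        have "?i z \<in> Z.mball (?i y) r" if "dist z y < r" for z
          using that by (simp add: d_Inl dist_commute) (simp add: Z_def)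
        then show "\<exists>e>0. \<forall>z. dist z y < e \<longrightarrow> z \<in> ?i -` U" using r by blast
      qed
      then show ?thesis using \<Omega>(1) by (auto simp: N.sets_iff)
    qed
    have one: "(\<lambda>_. 1) \<in> UG p ?N d ?i"
      unfolding N.UG_iff[OF p_pos]
    proof
      show int: "p_integrable p ?N (\<lambda>_. 1)" using fin[of n] \<Omega>(1) by (simp add: p_integrable_def emeasure_restrict_space)
      show "almost_all_curves p ?N (curve_ug d ?i (\<lambda>_. 1))"
      proof (rule almost_all_curves_mono[OF N.almost_all_curves_finite[OF int]])
        fix a b \<gamma> assume "rectifiable_curve a b (\<gamma> :: real \<Rightarrow> 'b)"
        then interpret rectifiable_curve a b \<gamma> .
        show "curve_ug d ?i (\<lambda>_. 1) a b \<gamma>"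
          using dist_le_curve_length[OF le, of \<gamma>] by (simp add: d_Inl line_integral_const dist_commute)
      qed
    qed
    have "measurable_map ?N Z d ?i"
      unfolding measurable_map_def using N.borel_map_essentially_separable[OF d iZ meas] iZ meas by blast
    then have Dir: "?i \<in> Dir p ?N Z d" using one by (auto simp: Dir_def)
    let ?\<rho> = "min_wug p ?N d ?i"
    have one_loc: "(\<lambda>_. 1) \<in> UG_loc p ?N d ?i" by (rule subsetD[OF N.UG_subset_UG_loc[OF p_pos] one])
    then have "is_min_wug p ?N d ?i ?\<rho>" using iZ by (intro N.is_min_wug_min_wug[OF p_pos d]) auto
    then have \<rho>m [measurable]: "?\<rho> \<in> borel_measurable ?N" and \<rho>_le: "AE y in ?N. ?\<rho> y \<le> 1"
      using one_loc by (auto simp: is_min_wug_def UG_loc_def weak_upper_gradient_def)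
    have pull: "?i \<circ> \<phi> \<in> Dir p ?M Z d" "\<And>f :: 'b \<Rightarrow> ennreal.
        (\<lambda>y. f y * epowr (?\<rho> y) p) \<in> borel_measurable ?N \<Longrightarrow>
        (\<integral>\<^sup>+ y. f y * epowr (?\<rho> y) p \<partial>?N) < \<infinity> \<Longrightarrow>
        (\<integral>\<^sup>+ x. f (\<phi> x) * epowr (min_wug p ?M d (?i \<circ> \<phi>) x) p \<partial>?M)
          \<le> ennreal K * (\<integral>\<^sup>+ y. f y * epowr (?\<rho> y) p \<partial>?N)"
      using pullback[OF d, of n] Dir unfolding pullback_property_def Let_def preimage_measure_def by blast+
    have "(\<integral>\<^sup>+ x. indicator E (\<phi> x) * epowr (min_wug p ?M dist \<phi> x) p \<partial>?M) \<le> ennreal K * emeasure \<mu>\<^sub>Y E"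
      if E: "E \<in> sets borel" for E
    proof -
      have "AE y in ?N. indicator E y * epowr (?\<rho> y) p \<le> indicator E y"
        using \<rho>_le
      proof eventually_elim
        case (elim y)
        then have "epowr (?\<rho> y) p \<le> 1" using epowr_mono[OF p_pos elim] by simp
        then show ?case by (auto split: split_indicator)
      qed
      then have "(\<integral>\<^sup>+ y. indicator E y * epowr (?\<rho> y) p \<partial>?N) \<le> (\<integral>\<^sup>+ y. indicator E y \<partial>?N)"
        by (rule nn_integral_mono_AE)
      also have "\<dots> = emeasure \<mu>\<^sub>Y (E \<inter> \<Omega> n)"
        unfolding N_int using E \<Omega>(1)
        by (simp add: nn_integral_indicator[symmetric] indicator_inter_arith del: nn_integral_indicator)
      finally have le: "(\<integral>\<^sup>+ y. indicator E y * epowr (?\<rho> y) p \<partial>?N) \<le> emeasure \<mu>\<^sub>Y (E \<inter> \<Omega> n)" .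
      also have "\<dots> \<le> emeasure \<mu>\<^sub>Y (\<Omega> n)" using E \<Omega>(1) by (intro emeasure_mono) auto
      finally have "(\<integral>\<^sup>+ y. indicator E y * epowr (?\<rho> y) p \<partial>?N) < \<infinity>" using fin[of n] by order
      moreover have "(\<lambda>y. indicator E y * epowr (?\<rho> y) p) \<in> borel_measurable ?N"
        using E by (intro borel_measurable_times_ennreal borel_measurable_epowr \<rho>m N.measurable_borel
            borel_measurable_indicator)
      ultimately have "(\<integral>\<^sup>+ x. indicator E (\<phi> x) * epowr (min_wug p ?M d (?i \<circ> \<phi>) x) p \<partial>?M)
          \<le> ennreal K * (\<integral>\<^sup>+ y. indicator E y * epowr (?\<rho> y) p \<partial>?N)"
        by (intro pull(2))
      also have "\<dots> \<le> ennreal K * emeasure \<mu>\<^sub>Y E"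
        using le emeasure_mono[of "E \<inter> \<Omega> n" E \<mu>\<^sub>Y] E by (intro mult_left_mono) auto
      finally show ?thesis by (simp add: min_eq)
    qed
    with pull(1) show ?thesis by blast
  qed
  show ?thesis
  proof (rule energy_bound_if_exhaustion[OF \<Omega> fin])
    fix n
    obtain h where "h \<in> UG p (preimage_measure (\<Omega> n)) dist \<phi>"
      using main[of n] by (auto simp: Dir_def UG_eq)
    from subsetD[OF borel_subspace.UG_subset_UG_loc[OF borel_subspace_preimage[OF \<Omega>(1)] p_pos] this]
    show "UG_loc p (preimage_measure (\<Omega> n)) dist \<phi> \<noteq> {}" by blast
  qed (use main in blast)
qed

end

theorem proposition2p17:
  fixes \<mu>\<^sub>X :: "'a::polish_space measure" and \<mu>\<^sub>Y :: "'b::polish_space measure"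
    and \<phi> :: "'a \<Rightarrow> 'b" and p K :: real
  assumes "metric_measure_space \<mu>\<^sub>X" and "metric_measure_space \<mu>\<^sub>Y"
    and "continuous_on UNIV \<phi>" and "1 < p" and "0 \<le> K"
  shows "(outer_dilatation_le p \<mu>\<^sub>X \<mu>\<^sub>Y \<phi> K \<longleftrightarrow> pullback_open TYPE('c) p \<mu>\<^sub>X \<mu>\<^sub>Y \<phi> K) \<and>
    (outer_dilatation_le p \<mu>\<^sub>X \<mu>\<^sub>Y \<phi> K \<longleftrightarrow> pullback_closed TYPE('c) p \<mu>\<^sub>X \<mu>\<^sub>Y \<phi> K) \<and>
    (outer_dilatation_le p \<mu>\<^sub>X \<mu>\<^sub>Y \<phi> K \<longleftrightarrow>
       \<phi> \<in> Dir_loc p \<mu>\<^sub>X UNIV dist \<and>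
       (\<forall>E\<in>sets borel.
          (\<integral>\<^sup>+ x. indicator E (\<phi> x) * epowr (min_wug p \<mu>\<^sub>X dist \<phi> x) p \<partial>\<mu>\<^sub>X)
            \<le> ennreal K * emeasure \<mu>\<^sub>Y E))"
proof -
  note X = metric_measure_space_borel_subspace[OF assms(1)]
  note Y = metric_measure_space_borel_subspace[OF assms(2)]
  interpret dilatation_setting \<mu>\<^sub>X \<mu>\<^sub>Y \<phi> p K
    using X Y assms by (auto simp: dilatation_setting_def dilatation_setting_axioms_def metric_measure_space_def)
  let ?energy = "\<phi> \<in> Dir_loc p \<mu>\<^sub>X UNIV dist \<and> energy_bound (min_wug p \<mu>\<^sub>X dist \<phi>)"
  have min: "min_wug p \<mu>\<^sub>X dist \<phi> \<in> UG_loc p \<mu>\<^sub>X dist \<phi>" if ?energy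
    using that X.is_min_wug_min_wug[OF p_pos Metric_space_dist, of \<phi>] by (auto simp: Dir_loc_def is_min_wug_def)
  have dil: "outer_dilatation_le p \<mu>\<^sub>X \<mu>\<^sub>Y \<phi> K \<longleftrightarrow> ?energy"
    using energy_bound_if_outer_dilatation_le outer_dilatation_le_if_energy_bound min by blast
  have pull: "pullback_property p \<mu>\<^sub>X \<mu>\<^sub>Y \<phi> K \<Omega> Z d"
    if ?energy "\<Omega> \<in> sets borel" "Metric_space Z d" for \<Omega> and Z :: "('b + 'c) set" and d
    using that min by (intro pullback_property_if_energy_bound) auto
  have "pullback_open TYPE('c) p \<mu>\<^sub>X \<mu>\<^sub>Y \<phi> K \<longleftrightarrow> ?energy"
  proof
    assume *: "pullback_open TYPE('c) p \<mu>\<^sub>X \<mu>\<^sub>Y \<phi> K"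
    show ?energy
    \<comment> \<open>The base point \<open>undefined\<close> is arbitrary; open balls have finite
      measure, which makes constants integrable on them.\<close>
    proof (rule energy_bound_if_pullback_property[where \<Omega> = "\<lambda>n. ball undefined (real n)" and ?'c = 'c])
      show "emeasure \<mu>\<^sub>Y (ball undefined (real n)) < \<infinity>" for n by (rule finite_on_bounded) auto
    qed (use * in \<open>auto simp: pullback_open_def incseq_def interior_open reals_Archimedean2\<close>)
  qed (auto simp: pullback_open_def intro: pull)
  moreover have "pullback_closed TYPE('c) p \<mu>\<^sub>X \<mu>\<^sub>Y \<phi> K \<longleftrightarrow> ?energy"
  proof
    assume *: "pullback_closed TYPE('c) p \<mu>\<^sub>X \<mu>\<^sub>Y \<phi> K"
    show ?energy
    \<comment> \<open>Closed balls also have finite measure, and their interiors still exhaust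
      \<open>Y\<close>.\<close>
    proof (rule energy_bound_if_pullback_property[where \<Omega> = "\<lambda>n. cball undefined (real n)" and ?'c = 'c])
      show fin: "emeasure \<mu>\<^sub>Y (cball undefined (real n)) < \<infinity>" for n by (rule finite_on_bounded) auto
      show "(\<Union>n. interior (cball (undefined :: 'b) (real n))) = UNIV"
      proof -
        have "(UNIV :: 'b set) = (\<Union>n. ball undefined (real n))" by (auto simp: reals_Archimedean2)
        also have "\<dots> \<subseteq> (\<Union>n. interior (cball undefined (real n)))"
          by (intro UN_mono interior_maximal) auto
        finally show ?thesis by (rule top.extremum_uniqueI)
      qed
      show "pullback_property p \<mu>\<^sub>X \<mu>\<^sub>Y \<phi> K (cball undefined (real n)) Z d"
        if "Metric_space Z d" for n and Z :: "('b + 'c) set" and d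
        using * fin that by (auto simp: pullback_closed_def)
    qed (auto simp: incseq_def)
  qed (auto simp: pullback_closed_def intro: pull)
  ultimately show ?thesis
    using dil unfolding energy_bound_def by blast
qed

end
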